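(* Let $V,V_1,V_2,V_3,\ldots$ be independent identically distributed real random variables. Suppose for each $n\in\mathbb{N}$ that $(Y_n,S_n,Z_n)$ is a triple of integrable real random variables on the same sample space such that: (i) $Y_n$ and $S_n$ are independent, and $S_n$ has the same distribution as $\sum_{j=1}^n V_j$; (ii) both $n^{-1/2}\,\mathbb{E}[|Z_n-(Y_n+S_n)|]$ and $n^{1/2}P[Z_n\neq Y_n+S_n]$ tend to zero as $n\to\infty$; and (iii) for some $\sigma\in[0,\infty)$, $n^{-1/2}(Z_n-\mathbb{E}Z_n)$ converges in distribution to $\mathcal{N}(0,\sigma^2)$ as $n\to\infty$. Then $\mathrm{Var}[V]\le\sigma^2$, and if $b,c_1,c_2,c_3,\ldots$ are positive constants with $h_V\,|\,b$ and $c_n\sim n^{1/2}$ as $n\to\infty$, then $$\sup_{u\in\mathbb{R}}\left|c_nP[Z_n\in[u,u+b)]-\sigma^{-1}b\,\phi\!\left(\frac{u-\mathbb{E}Z_n}{c_n\sigma}\right)\right|\to0\quad\text{as }n\to\infty.$$ Also, $n^{-1/2}(Y_n-\mathbb{E}Y_n)$ converges in distribution to $\mathcal{N}(0,\sigma^2-\mathrm{Var}[V])$ as $n\to\infty$.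
   Context: $\phi(x)=(2\pi)^{-1/2}e^{-x^2/2}$ is the standard normal density. $\mathcal{N}(0,0)$ denotes the distribution of the random variable identically zero. A random variable $X$ is integrable if $\mathbb{E}|X|<\infty$. $X$ is lattice if there exists $h>0$ such that $(X-a)/h\in\mathbb{Z}$ almost surely for some $a\in\mathbb{R}$. The span $h_X\in[0,\infty]$ of $X$ is: the largest such $h$ if $X$ is lattice and non-degenerate; $h_X:=0$ if $X$ is non-lattice; $h_X:=+\infty$ if $X$ is degenerate, i.e. $\mathrm{Var}[X]=0$. For real $a\ge0$, $b>0$, $a\,|\,b$ means that either $b$ is an integer multiple of $a$ or $a=0$; when $a=+\infty$ and $b<\infty$, $a\,|\,b$ does not hold by convention (so if $V$ is degenerate no $b$ is admissible). $c_n\sim n^{1/2}$ means $c_n/n^{1/2}\to1$. *)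

theory Defs
  imports "HOL-Probability.Probability"
begin

definition centered_normal :: "real \<Rightarrow> real measure" where
  \<comment> \<open>The argument is the variance, whereas \<^const>\<open>normal_density\<close> takes the standard deviation.
    Variance zero gives the law of the random variable identically zero.\<close>
  "centered_normal v =
     (if v = 0 then return borel 0 else density lborel (\<lambda>x. ennreal (normal_density 0 (sqrt v) x)))"

definition degenerate_rv :: "'a measure \<Rightarrow> ('a \<Rightarrow> real) \<Rightarrow> bool" where
  \<comment> \<open>The variance is zero. Square integrability is required explicitly because the Bochner integral
    defining \<^term>\<open>prob_space.variance M X\<close> is 0 when the variance is infinite.\<close>
  "degenerate_rv M X \<longleftrightarrow> integrable M (\<lambda>\<omega>. (X \<omega>)\<^sup>2) \<and> prob_space.variance M X = 0"

definition lattice_with_step :: "'a measure \<Rightarrow> ('a \<Rightarrow> real) \<Rightarrow> real \<Rightarrow> bool" where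
  "lattice_with_step M X h \<longleftrightarrow> 0 < h \<and> (\<exists>a::real. AE \<omega> in M. (X \<omega> - a) / h \<in> \<int>)"

definition lattice_rv :: "'a measure \<Rightarrow> ('a \<Rightarrow> real) \<Rightarrow> bool" where
  "lattice_rv M X \<longleftrightarrow> (\<exists>h. lattice_with_step M X h)"

definition rv_span :: "'a measure \<Rightarrow> ('a \<Rightarrow> real) \<Rightarrow> ennreal" where
  "rv_span M X =
     (if degenerate_rv M X then \<infinity>
      else if lattice_rv M X then ennreal (GREATEST h. lattice_with_step M X h)
      else 0)"

definition span_dvd :: "ennreal \<Rightarrow> real \<Rightarrow> bool" where
  "span_dvd a b \<longleftrightarrow> a \<noteq> \<infinity> \<and> (a = 0 \<or> (\<exists>k::int. b = of_int k * enn2real a))"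

end

theory Submission
  imports Defs
begin

text \<open>Write \<phi> for the characteristic function of V - E V, let s^2 be the variance of V, put W = Y + S, and mark
centering at the mean and division by the square root of n with a tilde. Everything is read off from
characteristic functions.

The moment bound and the law of Y. By the first half of (ii) the variables Z~ and W~ are close in mean, so by
(iii) and independence char Y~ (t) \<cdot> \<phi>(t / \<surd>n)^n tends to exp (-\<sigma>^2 t^2 / 2). As a characteristic function is
bounded by 1, the powers \<phi>(1 / \<surd>n)^n stay away from 0; symmetrisation and Fatou's lemma turn this into a
second moment of V (square_integrable_of_char_power). The central limit theorem then says
\<phi>(t / \<surd>n)^n \<rightarrow> exp (-s^2 t^2 / 2), whence s^2 \<le> \<sigma>^2, and dividing gives char Y~ (t) \<rightarrow> exp (-(\<sigma>^2 - s^2) t^2 / 2).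
Levy's continuity theorem makes that the last claim.

The local limit. Nothing is known about the local behaviour of Y, so all of it has to come from S. The
classical local limit theorem for S (local_limit_iid_sum) holds uniformly in the position of the interval.
Conditioning on Y therefore shows, uniformly in u, that \<surd>n P[W \<in> [u, u + b)] is close to b times the
expectation of g(x - Y~), where g is the centered normal density of variance s^2 and x = (u - E W) / \<surd>n
(interval_prob_indep_sum). Since Y~ is asymptotically normal, Fourier inversion of g shows that this
expectation converges uniformly in x to the centered normal density of variance \<sigma>^2
(gaussian_smoothing_uniform). Passing from W to Z and from \<surd>n to c costs terms that vanish by (ii)
(local_limit_perturbation).

The local limit theorem for S. If |\<phi>(t)| < 1 for 0 < |t| \<le> A, then \<phi>(t)^n and the Gaussian
exp (-n s^2 t^2 / 2) differ on [-A, A] by o(1 / \<surd>n) in the mean (char_power_L1_gaussian). If the summands have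
span h, this is applied with A = \<pi> / h: an interval of length h contains exactly one lattice point, whose
mass is a Fourier integral over [-\<pi> / h, \<pi> / h], and [u, u + b) consists of b / h such intervals. For non-lattice summands every A is allowed, and integrals
against a kernel with compactly supported Fourier transform are controlled; a continuity theorem argument
passes from these to intervals (fejer_vague_limit).\<close>

section \<open>Gaussian densities and smoothing\<close>

text \<open>Scaling a standard normal variable by \<surd>v covers the degenerate variance v = 0 together with the others, so the
characteristic function needs no case distinction.\<close>

lemma centered_normal_eq_distr:
  assumes "v \<ge> 0"
  shows "centered_normal v = distr std_normal_distribution borel (\<lambda>x. sqrt v * x)"
proof (cases "v = 0")
  case True
  interpret real_distribution std_normal_distribution by (rule real_dist_normal_dist)
  show ?thesis using True by (simp add: centered_normal_def)
next
  case False
  with assms have v: "sqrt v > 0" by simp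
  interpret real_distribution std_normal_distribution by (rule real_dist_normal_dist)
  have "distributed std_normal_distribution lborel (\<lambda>x. x) (\<lambda>x. ennreal (std_normal_density x))"
    unfolding distributed_def by (auto simp: distr_id2)
  from normal_density_affine[OF this, of "sqrt v" 0] v
  have "distributed std_normal_distribution lborel (\<lambda>x. sqrt v * x) (\<lambda>x. ennreal (normal_density 0 (sqrt v) x))"
    by simp
  then have "distr std_normal_distribution lborel (\<lambda>x. sqrt v * x) = density lborel (\<lambda>x. ennreal (normal_density 0 (sqrt v) x))"
    by (rule distributed_distr_eq_density)
  moreover have "distr std_normal_distribution lborel (\<lambda>x. sqrt v * x) = distr std_normal_distribution borel (\<lambda>x. sqrt v * x)"
    by (rule distr_cong) auto
  ultimately show ?thesis using False by (simp add: centered_normal_def)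
qed

lemma real_distribution_centered_normal:
  assumes "v \<ge> 0" shows "real_distribution (centered_normal v)"
proof -
  interpret real_distribution std_normal_distribution by (rule real_dist_normal_dist)
  show ?thesis unfolding centered_normal_eq_distr[OF assms]
    by (rule real_distribution_distr) simp
qed

lemma char_centered_normal:
  assumes "v \<ge> 0"
  shows "char (centered_normal v) t = of_real (exp (- v * t\<^sup>2 / 2))"
proof -
  have "char (centered_normal v) t = char std_normal_distribution (t * sqrt v)"
    unfolding centered_normal_eq_distr[OF assms] char_def
    by (subst integral_distr) (auto simp: mult_ac)
  also have "\<dots> = of_real (exp (- (t * sqrt v)\<^sup>2 / 2))"
    by (simp add: char_std_normal_distribution)
  finally show ?thesis using assms by (simp add: power_mult_distrib mult.commute)
qed

lemma normal_density_scale: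
  assumes "s > 0"
  shows "normal_density 0 s x = std_normal_density (x / s) / s"
  using assms by (simp add: normal_density_def real_sqrt_mult power_divide)

lemma normal_density_le:
  assumes "s > 0" shows "normal_density 0 s x \<le> 1 / s"
proof -
  have "1 \<le> sqrt (2 * pi)" using pi_gt3 by simp
  then have "1 / sqrt (2 * pi) \<le> 1" by simp
  then have "1 / sqrt (2 * pi) * exp (- (x/s)\<^sup>2 / 2) \<le> 1"
    by (rule mult_le_one) auto
  then have "std_normal_density (x / s) \<le> 1"
    unfolding std_normal_density_def .
  then show ?thesis unfolding normal_density_scale[OF assms] using assms by (simp add: divide_right_mono)
qed

lemma std_normal_density_deriv:
  "(std_normal_density has_real_derivative - x * std_normal_density x) (at x)"
  unfolding std_normal_density_def[abs_def]
  by (auto intro!: derivative_eq_intros simp: field_simps)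

lemma square_mult_gaussian_le_1: "x\<^sup>2 * exp (- x\<^sup>2 / 2) \<le> (1::real)"
proof -
  have "x\<^sup>2 / 2 \<le> exp (x\<^sup>2 / 2 - 1)" using exp_ge_add_one_self[of "x\<^sup>2/2 - 1"] by simp
  also have "\<dots> = exp (x\<^sup>2 / 2) * exp (-1)" by (simp flip: exp_add)
  also have "exp (-1) \<le> (1/2::real)" using exp_ge_add_one_self[of 1] by (simp add: exp_minus field_simps)
  finally have "x\<^sup>2 \<le> exp (x\<^sup>2 / 2)" by (simp add: field_simps)
  then show ?thesis by (simp add: exp_minus divide_simps)
qed

lemma square_mult_std_normal_density_le_1: "x\<^sup>2 * std_normal_density x \<le> 1"
proof -
  have "x\<^sup>2 * std_normal_density x = x\<^sup>2 * exp (- x\<^sup>2 / 2) / sqrt (2 * pi)"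
    by (simp add: std_normal_density_def)
  also have "\<dots> \<le> x\<^sup>2 * exp (- x\<^sup>2 / 2) / 1"
    using pi_gt3 by (intro divide_left_mono) auto
  finally show ?thesis using square_mult_gaussian_le_1[of x] by simp
qed

lemma std_normal_density_lipschitz:
  "\<bar>std_normal_density x - std_normal_density y\<bar> \<le> \<bar>x - y\<bar>"
proof -
  have b: "\<bar>z * std_normal_density z\<bar> \<le> 1" for z
  proof (cases "\<bar>z\<bar> \<le> 1")
    case True
    then show ?thesis using normal_density_le[of 1 z] by (simp add: abs_mult mult_le_one)
  next
    case False
    then have "\<bar>z\<bar> \<le> z\<^sup>2" using self_le_power[of "\<bar>z\<bar>" 2] by simp
    then have "\<bar>z\<bar> * std_normal_density z \<le> z\<^sup>2 * std_normal_density z"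
      by (intro mult_right_mono) auto
    then show ?thesis using square_mult_std_normal_density_le_1[of z] by (simp add: abs_mult)
  qed
  have "norm (std_normal_density x - std_normal_density y) \<le> 1 * norm (x - y)"
    by (rule field_differentiable_bound[where S=UNIV and f'="\<lambda>z. - z * std_normal_density z"])
       (use b std_normal_density_deriv in \<open>auto simp: abs_mult intro: has_field_derivative_at_within\<close>)
  then show ?thesis by simp
qed

text \<open>The derivative of r \<mapsto> \<phi>(r x), for \<phi> the standard normal density, is -r x^2 \<phi>(r x) and hence at most 1 / r
in modulus, whatever x is. The restriction r \<ge> 1/2 gives the constant 2.\<close>

lemma std_normal_density_scaling:
  assumes "1/2 \<le> r"
  shows "\<bar>std_normal_density (r * x) - std_normal_density x\<bar> \<le> 2 * \<bar>r - 1\<bar>"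
proof -
  have b: "\<bar>z * x\<^sup>2 * std_normal_density (z * x)\<bar> \<le> 2" if "1/2 \<le> z" for z
  proof -
    have "z * (z * x\<^sup>2 * std_normal_density (z * x)) = (z * x)\<^sup>2 * std_normal_density (z * x)"
      by (simp add: power2_eq_square)
    also have "\<dots> \<le> 1" by (rule square_mult_std_normal_density_le_1)
    finally have "z * x\<^sup>2 * std_normal_density (z * x) \<le> 1 / z"
      using that by (simp add: field_simps)
    also have "\<dots> \<le> 2" using that by (simp add: field_simps)
    finally show ?thesis using that by (simp add: abs_mult)
  qed
  have d: "((\<lambda>r. std_normal_density (r * x)) has_real_derivative - (z * x) * std_normal_density (z * x) * x) (at z)" for z
    by (rule DERIV_chain2[OF std_normal_density_deriv]) (auto intro!: derivative_eq_intros)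
  have "norm (std_normal_density (r * x) - std_normal_density (1 * x)) \<le> 2 * norm (r - 1)"
    by (rule field_differentiable_bound[where S="{1/2..}" and f'="\<lambda>z. - (z * x) * std_normal_density (z * x) * x"
          and f="\<lambda>r. std_normal_density (r * x)"])
       (use b d assms in \<open>auto simp: abs_mult power2_eq_square mult_ac intro: has_field_derivative_at_within\<close>)
  then show ?thesis by simp
qed

lemma gaussian_exp_eq_density:
  assumes "s > 0"
  shows "exp (- s\<^sup>2 * t\<^sup>2 / 2) = sqrt (2 * pi) * std_normal_density (s * t)"
  by (simp add: std_normal_density_def power_mult_distrib)

lemma integrable_gaussian_exp:
  assumes "s > 0"
  shows "integrable lborel (\<lambda>t. exp (- s\<^sup>2 * t\<^sup>2 / 2) :: real)"
  unfolding gaussian_exp_eq_density[OF assms]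
  using lborel_integrable_real_affine[of std_normal_density s 0] assms by simp

text \<open>The Gaussian is its own Fourier transform up to scaling, so that the inversion formula is the known
characteristic function of the standard normal law, read backwards.\<close>

lemma normal_density_fourier:
  assumes "s > 0"
  shows "of_real (normal_density 0 s x) =
    (CLINT t|lborel. iexp (- (t * x)) * of_real (exp (- s\<^sup>2 * t\<^sup>2 / 2))) / (2 * of_real pi)"
proof -
  have "(CLINT t|lborel. iexp (- (t * x)) * of_real (exp (- s\<^sup>2 * t\<^sup>2 / 2))) =
     (CLINT t|lborel. of_real (sqrt (2 * pi)) * (iexp (- (t * x)) * of_real (std_normal_density (s * t))))"
    unfolding gaussian_exp_eq_density[OF assms] by (rule Bochner_Integration.integral_cong) (auto simp: mult_ac)
  also have "\<dots> = of_real (sqrt (2 * pi)) * (CLINT t|lborel. iexp (- (t * x)) * of_real (std_normal_density (s * t)))"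
    by simp
  also have "(CLINT t|lborel. iexp (- (t * x)) * of_real (std_normal_density (s * t))) =
    (1/s) *\<^sub>R (CLINT t|lborel. iexp ((-x/s) * t) * of_real (std_normal_density t))"
    using assms by (subst lborel_integral_real_affine[where c="1/s" and t=0])
      (auto intro!: arg_cong2[where f="(*\<^sub>R)"] Bochner_Integration.integral_cong simp: divide_simps mult_ac)
  also have "(CLINT t|lborel. iexp ((-x/s) * t) * of_real (std_normal_density t)) = char std_normal_distribution (-x/s)"
    unfolding char_def by (subst integral_density) (auto simp: scaleR_conv_of_real mult_ac)
  also have "\<dots> = of_real (exp (- (x/s)\<^sup>2 / 2))" by (simp add: char_std_normal_distribution)
  finally have "(CLINT t|lborel. iexp (- (t * x)) * of_real (exp (- s\<^sup>2 * t\<^sup>2 / 2)))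
     = of_real (sqrt (2 * pi) * exp (- (x/s)\<^sup>2 / 2) / s)"
    by (simp add: scaleR_conv_of_real)
  moreover have "sqrt (2 * pi) * exp (- (x/s)\<^sup>2 / 2) / s = 2 * pi * normal_density 0 s x"
  proof -
    have "sqrt (2 * pi) * sqrt (2 * pi) = 2 * pi" by simp
    then have "sqrt (2 * pi) = 2 * pi * (1 / sqrt (2 * pi))" by (simp add: field_simps)
    then show ?thesis unfolding normal_density_scale[OF assms] std_normal_density_def by (metis times_divide_eq_right mult.assoc)
  qed
  ultimately have "(CLINT t|lborel. iexp (- (t * x)) * of_real (exp (- s\<^sup>2 * t\<^sup>2 / 2))) = of_real (2 * pi * normal_density 0 s x)"
    by (simp only:)
  then show ?thesis by (simp del: of_real_exp)
qed

lemma integral_normal_density_shift: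
  assumes "real_distribution N" "s > 0"
  shows "of_real (\<integral>y. normal_density 0 s (x - y) \<partial>N) =
    (CLINT t|lborel. iexp (- (t * x)) * of_real (exp (- s\<^sup>2 * t\<^sup>2 / 2)) * char N t) / (2 * of_real pi)"
proof -
  interpret N: real_distribution N by fact
  interpret P: pair_sigma_finite N lborel ..
  let ?g = "\<lambda>t. of_real (exp (- s\<^sup>2 * t\<^sup>2 / 2)) :: complex"
  let ?f = "\<lambda>y t. iexp (- (t * (x - y))) * ?g t"
  have int: "integrable (N \<Otimes>\<^sub>M lborel) (\<lambda>(y, t). ?f y t)"
  proof (rule P.Fubini_integrable)
    show "AE y in N. integrable lborel (\<lambda>t. case (y, t) of (y, t) \<Rightarrow> ?f y t)"
      by (auto intro!: Bochner_Integration.integrable_bound[OF integrable_gaussian_exp[OF assms(2)]] simp: norm_mult)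
  qed (auto simp: split_beta' norm_mult)
  have "complex_of_real (\<integral>y. normal_density 0 s (x - y) \<partial>N) = (CLINT y|N. of_real (normal_density 0 s (x - y)))"
    by simp
  also have "\<dots> = (CLINT y|N. (CLINT t|lborel. ?f y t) / (2 * of_real pi))"
    unfolding normal_density_fourier[OF assms(2)] ..
  also have "\<dots> = (CLINT y|N. CLINT t|lborel. ?f y t) / (2 * of_real pi)" by simp
  also have "(CLINT y|N. CLINT t|lborel. ?f y t) = (CLINT t|lborel. CLINT y|N. ?f y t)"
    by (rule P.Fubini_integral[symmetric]) (use int in simp)
  also have "\<dots> = (CLINT t|lborel. iexp (- (t * x)) * ?g t * char N t)"
  proof (intro Bochner_Integration.integral_cong refl)
    fix t :: real
    have "(CLINT y|N. ?f y t) = (CLINT y|N. (iexp (- (t * x)) * ?g t) * iexp (t * y))"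
      by (intro Bochner_Integration.integral_cong refl) (simp add: algebra_simps exp_add exp_diff exp_minus field_simps)
    then show "(CLINT y|N. ?f y t) = iexp (- (t * x)) * ?g t * char N t"
      unfolding char_def by simp
  qed
  finally show ?thesis .
qed

text \<open>The density of a law smoothed by a Gaussian is a Fourier integral of its characteristic function with a
Gaussian weight. Its distance from the limit is therefore bounded, for all x at once, by the weighted L1 distance of the characteristic
functions, and that tends to 0 by dominated convergence.\<close>

lemma gaussian_smoothing_uniform:
  assumes N: "\<And>n. real_distribution (N n)" and v: "v \<ge> 0" and s: "s > 0"
    and lim: "\<And>t. (\<lambda>n. char (N n) t) \<longlonglongrightarrow> of_real (exp (- v * t\<^sup>2 / 2))"
  shows "uniform_limit UNIV (\<lambda>n x. \<integral>y. normal_density 0 s (x - y) \<partial>N n)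
    (normal_density 0 (sqrt (s\<^sup>2 + v))) sequentially"
proof -
  let ?g = "\<lambda>t. exp (- s\<^sup>2 * t\<^sup>2 / 2)"
  let ?d = "\<lambda>n t. ?g t * cmod (char (N n) t - of_real (exp (- v * t\<^sup>2 / 2)))"
  have sv: "sqrt (s\<^sup>2 + v) > 0" "(sqrt (s\<^sup>2 + v))\<^sup>2 = s\<^sup>2 + v"
    using s v by (auto simp: add_pos_nonneg)
  have [measurable]: "char (N n) \<in> borel_measurable borel" for n
    using real_distribution.char_measurable[OF N] .
  have le1: "cmod (char (N n) t) \<le> 1" for n t
    using real_distribution.cmod_char_le_1[OF N] .
  have e1: "exp (- v * t\<^sup>2 / 2) \<le> 1" for t :: real using v by simp
  have gi: "integrable lborel ?g" by (rule integrable_gaussian_exp[OF s])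
  have le2: "cmod (char (N n) t - of_real (exp (- v * t\<^sup>2 / 2))) \<le> 2" for n t
  proof -
    have "cmod (char (N n) t - of_real (exp (- v * t\<^sup>2 / 2))) \<le> cmod (char (N n) t) + cmod (of_real (exp (- v * t\<^sup>2 / 2)))"
      by (rule norm_triangle_ineq4)
    also have "cmod (of_real (exp (- v * t\<^sup>2 / 2))) = exp (- v * t\<^sup>2 / 2)" by simp
    finally show ?thesis using le1[of n t] e1[of t] by linarith
  qed
  have "(\<lambda>n. LINT t|lborel. ?d n t) \<longlonglongrightarrow> (LINT (t::real)|lborel. (0::real))"
  proof (rule integral_dominated_convergence[where w="\<lambda>t. 2 * ?g t" and M=lborel and s="?d" and f="\<lambda>_. 0"])
    show "AE t in lborel. (\<lambda>n. ?d n t) \<longlonglongrightarrow> 0"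
      using tendsto_mult_right_zero[OF tendsto_norm_zero[OF LIM_zero[OF lim]]] by auto
    show "AE t in lborel. norm (?d n t) \<le> 2 * ?g t" for n
      using le2 by (auto simp: abs_mult mult_ac)
  qed (use gi in auto)
  then have lim0: "(\<lambda>n. LINT t|lborel. ?d n t) \<longlonglongrightarrow> 0" by simp
  have bound: "dist (\<integral>y. normal_density 0 s (x - y) \<partial>N n) (normal_density 0 (sqrt (s\<^sup>2 + v)) x) \<le> (LINT t|lborel. ?d n t)" for n x
  proof -
    let ?A = "\<lambda>t. iexp (- (t * x)) * of_real (?g t) * char (N n) t"
    let ?B = "\<lambda>t. iexp (- (t * x)) * of_real (?g t) * of_real (exp (- v * t\<^sup>2 / 2))"
    have iA: "integrable lborel ?A"
      by (rule Bochner_Integration.integrable_bound[OF gi]) (use le1 in \<open>auto simp: norm_mult intro: mult_left_le\<close>)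
    have iB: "integrable lborel ?B"
      by (rule Bochner_Integration.integrable_bound[OF gi]) (use e1 in \<open>auto simp: norm_mult\<close>)
    have "complex_of_real (normal_density 0 (sqrt (s\<^sup>2 + v)) x) = (CLINT t|lborel. ?B t) / (2 * of_real pi)"
      unfolding normal_density_fourier[OF sv(1)] sv(2)
      by (intro arg_cong2[where f="(/)"] Bochner_Integration.integral_cong refl)
         (simp add: exp_add[symmetric] algebra_simps add_divide_distrib diff_divide_distrib flip: of_real_mult)
    then have "complex_of_real ((\<integral>y. normal_density 0 s (x - y) \<partial>N n) - normal_density 0 (sqrt (s\<^sup>2 + v)) x) =
       (CLINT t|lborel. ?A t - ?B t) / (2 * of_real pi)"
      using integral_normal_density_shift[OF N s, of n x] iA iB
      by (simp add: diff_divide_distrib)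
    then have "cmod (complex_of_real ((\<integral>y. normal_density 0 s (x - y) \<partial>N n) - normal_density 0 (sqrt (s\<^sup>2 + v)) x)) =
       cmod ((CLINT t|lborel. ?A t - ?B t) / (2 * of_real pi))"
      by (rule arg_cong)
    also have "\<dots> = cmod (CLINT t|lborel. ?A t - ?B t) / (2 * pi)"
      unfolding norm_divide norm_mult by simp
    also have "\<dots> \<le> cmod (CLINT t|lborel. ?A t - ?B t) / 1"
      using pi_gt3 by (intro divide_left_mono) auto
    finally have "\<bar>(\<integral>y. normal_density 0 s (x - y) \<partial>N n) - normal_density 0 (sqrt (s\<^sup>2 + v)) x\<bar> \<le>
       cmod (CLINT t|lborel. ?A t - ?B t)"
      unfolding norm_of_real by simp
    also have "\<dots> \<le> (LINT t|lborel. norm (?A t - ?B t))" by (rule integral_norm_bound)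
    also have "\<dots> = (LINT t|lborel. ?d n t)"
      by (intro Bochner_Integration.integral_cong refl)
         (simp add: norm_mult flip: right_diff_distrib)
    finally show ?thesis by (simp add: dist_real_def)
  qed
  show ?thesis
    unfolding uniform_limit_iff
  proof (intro allI impI)
    fix e :: real assume "e > 0"
    from order_tendstoD(2)[OF lim0 this]
    show "\<forall>\<^sub>F n in sequentially. \<forall>x\<in>UNIV. dist (\<integral>y. normal_density 0 s (x - y) \<partial>N n) (normal_density 0 (sqrt (s\<^sup>2 + v)) x) < e"
      by eventually_elim (use bound in \<open>auto intro: le_less_trans\<close>)
  qed
qed

section \<open>Powers of a characteristic function near the origin\<close>

text \<open>Uniformity in the position of an interval is obtained by letting the position depend on n: if uniformity
failed, positions where it fails could be selected along the sequence.\<close>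

lemma uniform_limit_by_sequences:
  fixes f :: "nat \<Rightarrow> 'a \<Rightarrow> real"
  assumes "\<And>u. (\<lambda>n. f n (u n)) \<longlonglongrightarrow> 0"
  shows "uniform_limit UNIV f (\<lambda>_. 0) sequentially"
proof (rule ccontr)
  assume "\<not> ?thesis"
  then obtain e where e: "e > 0" and F: "\<not> (\<forall>\<^sub>F n in sequentially. \<forall>x\<in>UNIV. dist (f n x) 0 < e)"
    unfolding uniform_limit_iff by blast
  define u where "u n = (SOME x. \<not> dist (f n x) 0 < e)" for n
  have "\<forall>\<^sub>F n in sequentially. dist (f n (u n)) 0 < e"
    using assms[of u] e by (rule tendstoD)
  then have "\<forall>\<^sub>F n in sequentially. \<forall>x\<in>UNIV. dist (f n x) 0 < e"
    by eventually_elim (metis (mono_tags, lifting) someI u_def)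
  with F show False ..
qed


lemma exp_minus_le_inverse:
  fixes y :: real
  assumes "0 \<le> y" shows "exp (- y) \<le> 1 / (1 + y)"
  using exp_ge_add_one_self[of y] assms by (simp add: exp_minus divide_simps)

text \<open>Centering and the second moment determine the expansion at 0 up to o(t^2). The comparison is with a Gaussian
instead of a quadratic polynomial, so that n-th powers can be compared directly.\<close>

lemma char_second_order:
  assumes "real_distribution M" "integrable M (\<lambda>x. x)" "integrable M (\<lambda>x. x\<^sup>2)"
    and "(\<integral>x. x \<partial>M) = 0" and "(\<integral>x. x\<^sup>2 \<partial>M) = s\<^sup>2"
  shows "((\<lambda>t. (char M t - of_real (exp (- s\<^sup>2 * t\<^sup>2 / 2))) / of_real (t\<^sup>2)) \<longlongrightarrow> 0) (at 0)"
proof -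
  interpret real_distribution M by fact
  let ?m = "\<lambda>t x. min (6 * x\<^sup>2) (\<bar>t\<bar> * \<bar>x\<bar> ^ 3) :: real"
  let ?E = "\<lambda>t. \<integral>x. ?m t x \<partial>M"
  have 1: "(?E \<longlongrightarrow> 0) (at 0)"
    unfolding tendsto_at_iff_sequentially
  proof (intro allI impI)
    fix X :: "nat \<Rightarrow> real" assume X: "X \<longlonglongrightarrow> 0"
    have "(\<lambda>n. ?E (X n)) \<longlonglongrightarrow> (\<integral>x. 0 \<partial>M)"
    proof (rule integral_dominated_convergence[where w="\<lambda>x. 6 * x\<^sup>2" and f="\<lambda>_. 0" and M=M and s="\<lambda>n. ?m (X n)"])
      show "AE x in M. (\<lambda>n. ?m (X n) x) \<longlonglongrightarrow> 0"
      proof (intro AE_I2)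
        fix x
        have "(\<lambda>n. ?m (X n) x) \<longlonglongrightarrow> min (6 * x\<^sup>2) (\<bar>0\<bar> * \<bar>x\<bar> ^ 3)"
          by (intro tendsto_intros X)
        then show "(\<lambda>n. ?m (X n) x) \<longlonglongrightarrow> 0" by simp
      qed
    qed (use assms(3) in \<open>auto simp: min_le_iff_disj\<close>)
    then show "(?E \<circ> X) \<longlonglongrightarrow> 0" by (simp add: comp_def)
  qed
  have 2: "((\<lambda>t. ((1 - s\<^sup>2 * t\<^sup>2 / 2) - exp (- s\<^sup>2 * t\<^sup>2 / 2)) / t\<^sup>2) \<longlongrightarrow> (0::real)) (at 0)"
  proof (rule Lim_null_comparison)
    show "((\<lambda>t. s^4 * t\<^sup>2) \<longlongrightarrow> (0::real)) (at 0)"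
      by (auto intro!: tendsto_eq_intros)
    have b: "\<bar>(1 - y) - exp (- y)\<bar> \<le> y\<^sup>2" if "0 \<le> y" for y :: real
    proof -
      have "1 - y \<le> exp (- y)" using exp_ge_add_one_self[of "-y"] by simp
      moreover have "exp (- y) \<le> 1 - y + y\<^sup>2"
      proof -
        have "exp (-y) \<le> 1 / (1 + y)"
          by (rule exp_minus_le_inverse[OF that])
        also have "\<dots> \<le> 1 - y + y\<^sup>2"
          using that by (simp add: divide_simps) (simp add: algebra_simps power2_eq_square power3_eq_cube)
        finally show ?thesis .
      qed
      ultimately show ?thesis by simp
    qed
    have "norm (((1 - s\<^sup>2 * t\<^sup>2 / 2) - exp (- s\<^sup>2 * t\<^sup>2 / 2)) / t\<^sup>2) \<le> s^4 * t\<^sup>2" if "t \<noteq> 0" for t :: real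
    proof -
      have "\<bar>(1 - s\<^sup>2 * t\<^sup>2 / 2) - exp (- s\<^sup>2 * t\<^sup>2 / 2)\<bar> \<le> (s\<^sup>2 * t\<^sup>2 / 2)\<^sup>2"
        using b[of "s\<^sup>2 * t\<^sup>2 / 2"] by simp
      also have "\<dots> = s^4 * t\<^sup>2 * t\<^sup>2 / 4"
        by (simp add: power2_eq_square power4_eq_xxxx)
      also have "\<dots> \<le> s^4 * t\<^sup>2 * t\<^sup>2" by simp
      finally show ?thesis using that by (simp add: divide_le_eq)
    qed
    then show "\<forall>\<^sub>F t in at 0. norm (((1 - s\<^sup>2 * t\<^sup>2 / 2) - exp (- s\<^sup>2 * t\<^sup>2 / 2)) / t\<^sup>2) \<le> s^4 * t\<^sup>2"
      by (simp add: eventually_at_filter)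
  qed
  show ?thesis
  proof (rule Lim_null_comparison)
    show "((\<lambda>t. ?E t / 6 + \<bar>((1 - s\<^sup>2 * t\<^sup>2 / 2) - exp (- s\<^sup>2 * t\<^sup>2 / 2)) / t\<^sup>2\<bar>) \<longlongrightarrow> 0) (at 0)"
      by (rule tendsto_eq_intros 1 tendsto_rabs_zero[OF 2] refl | simp)+
    have "norm ((char M t - of_real (exp (- s\<^sup>2 * t\<^sup>2 / 2))) / of_real (t\<^sup>2))
        \<le> ?E t / 6 + \<bar>((1 - s\<^sup>2 * t\<^sup>2 / 2) - exp (- s\<^sup>2 * t\<^sup>2 / 2)) / t\<^sup>2\<bar>" if "t \<noteq> 0" for t
    proof -
      have "cmod (char M t - (1 - t\<^sup>2 * s\<^sup>2 / 2)) \<le> t\<^sup>2 / 6 * ?E t"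
        by (rule char_approx3) (use assms in auto)
      moreover have "cmod (of_real (1 - t\<^sup>2 * s\<^sup>2 / 2) - of_real (exp (- s\<^sup>2 * t\<^sup>2 / 2)))
         = \<bar>(1 - s\<^sup>2 * t\<^sup>2 / 2) - exp (- s\<^sup>2 * t\<^sup>2 / 2)\<bar>"
        unfolding of_real_diff[symmetric] norm_of_real by (simp add: mult.commute)
      ultimately have "cmod (char M t - of_real (exp (- s\<^sup>2 * t\<^sup>2 / 2)))
          \<le> t\<^sup>2 / 6 * ?E t + \<bar>(1 - s\<^sup>2 * t\<^sup>2 / 2) - exp (- s\<^sup>2 * t\<^sup>2 / 2)\<bar>"
        by (intro norm_diff_triangle_le[where y="of_real (1 - t\<^sup>2 * s\<^sup>2 / 2)"]) auto
      then have "cmod (char M t - of_real (exp (- s\<^sup>2 * t\<^sup>2 / 2))) / t\<^sup>2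
          \<le> (t\<^sup>2 / 6 * ?E t + \<bar>(1 - s\<^sup>2 * t\<^sup>2 / 2) - exp (- s\<^sup>2 * t\<^sup>2 / 2)\<bar>) / t\<^sup>2"
        by (rule divide_right_mono) simp
      also have "\<dots> = ?E t / 6 + \<bar>((1 - s\<^sup>2 * t\<^sup>2 / 2) - exp (- s\<^sup>2 * t\<^sup>2 / 2)) / t\<^sup>2\<bar>"
        using that by (simp add: add_divide_distrib)
      finally show ?thesis by (simp add: norm_divide norm_power)
    qed
    then show "\<forall>\<^sub>F t in at 0. norm ((char M t - of_real (exp (- s\<^sup>2 * t\<^sup>2 / 2))) / of_real (t\<^sup>2))
        \<le> ?E t / 6 + \<bar>((1 - s\<^sup>2 * t\<^sup>2 / 2) - exp (- s\<^sup>2 * t\<^sup>2 / 2)) / t\<^sup>2\<bar>"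
      by (simp add: eventually_at_filter)
  qed
qed

text \<open>The central limit theorem in terms of characteristic functions. For numbers of modulus at most 1, taking n-th
powers multiplies the distance by at most n, which the factor t^2 / n of the second-order expansion compensates.\<close>

lemma char_power_tendsto_gaussian:
  assumes M: "real_distribution M" "integrable M (\<lambda>x. x)" "integrable M (\<lambda>x. x\<^sup>2)"
    and "(\<integral>x. x \<partial>M) = 0" and "(\<integral>x. x\<^sup>2 \<partial>M) = s\<^sup>2"
  shows "(\<lambda>n. char M (t / sqrt (real n)) ^ n) \<longlonglongrightarrow> of_real (exp (- s\<^sup>2 * t\<^sup>2 / 2))"
proof (cases "t = 0")
  case True
  then show ?thesis using real_distribution.char_zero[OF M(1)] by simp
next
  case False
  interpret real_distribution M by fact
  let ?r = "\<lambda>t. (char M t - of_real (exp (- s\<^sup>2 * t\<^sup>2 / 2))) / of_real (t\<^sup>2) :: complex"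
  let ?t = "\<lambda>n. t / sqrt (real n)"
  have t0: "?t \<longlonglongrightarrow> 0"
    by (intro tendsto_divide_0[OF tendsto_const] filterlim_at_top_imp_at_infinity
        filterlim_compose[OF sqrt_at_top filterlim_real_sequentially])
  have "filterlim ?t (at 0) sequentially"
    unfolding filterlim_at using t0 False
    by (auto simp: eventually_sequentially intro!: exI[of _ 1])
  from filterlim_compose[OF char_second_order[OF assms] this]
  have r0: "(\<lambda>n. ?r (?t n)) \<longlonglongrightarrow> 0" .
  have "(\<lambda>n. char M (?t n) ^ n - of_real (exp (- s\<^sup>2 * t\<^sup>2 / 2))) \<longlonglongrightarrow> 0"
  proof (rule Lim_null_comparison)
    show "(\<lambda>n. t\<^sup>2 * cmod (?r (?t n))) \<longlonglongrightarrow> 0"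
      by (rule tendsto_mult_right_zero[OF tendsto_norm_zero[OF r0]])
    have "cmod (char M (?t n) ^ n - of_real (exp (- s\<^sup>2 * t\<^sup>2 / 2))) \<le> t\<^sup>2 * cmod (?r (?t n))" if "n \<ge> 1" for n
    proof -
      have e: "complex_of_real (exp (- s\<^sup>2 * t\<^sup>2 / 2)) = of_real (exp (- s\<^sup>2 * (?t n)\<^sup>2 / 2)) ^ n"
        using that by (simp add: power_divide flip: exp_of_nat_mult of_real_power)
      have "cmod (char M (?t n) ^ n - of_real (exp (- s\<^sup>2 * t\<^sup>2 / 2)))
         \<le> n * cmod (char M (?t n) - of_real (exp (- s\<^sup>2 * (?t n)\<^sup>2 / 2)))"
        unfolding e by (rule norm_power_diff) (auto simp: cmod_char_le_1)
      also have "\<dots> = t\<^sup>2 * cmod (?r (?t n))"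
        using that False by (simp add: norm_mult norm_divide norm_power power_divide)
      finally show ?thesis .
    qed
    then show "\<forall>\<^sub>F n in sequentially. cmod (char M (?t n) ^ n - of_real (exp (- s\<^sup>2 * t\<^sup>2 / 2))) \<le> t\<^sup>2 * cmod (?r (?t n))"
      by (auto simp: eventually_sequentially)
  qed
  then show ?thesis by (rule LIM_zero_cancel)
qed

lemma char_gaussian_bound_near_0:
  assumes M: "real_distribution M" "integrable M (\<lambda>x. x)" "integrable M (\<lambda>x. x\<^sup>2)"
    and "(\<integral>x. x \<partial>M) = 0" and "(\<integral>x. x\<^sup>2 \<partial>M) = s\<^sup>2" and s: "s > 0"
  obtains d where "d > 0" "\<And>t. \<bar>t\<bar> \<le> d \<Longrightarrow> cmod (char M t) \<le> exp (- (s/2)\<^sup>2 * t\<^sup>2 / 2)"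
proof -
  interpret real_distribution M by fact
  let ?r = "\<lambda>t. (char M t - of_real (exp (- s\<^sup>2 * t\<^sup>2 / 2))) / of_real (t\<^sup>2) :: complex"
  have "\<forall>\<^sub>F t in at 0. dist (?r t) 0 < s\<^sup>2 / 8"
    using char_second_order[OF assms(1-5)] by (rule tendstoD) (use s in simp)
  then obtain d0 where d0: "d0 > 0" "\<And>t. t \<noteq> 0 \<Longrightarrow> \<bar>t\<bar> < d0 \<Longrightarrow> cmod (?r t) < s\<^sup>2 / 8"
    by (auto simp: eventually_at dist_real_def)
  define d where "d = min d0 (1 / s) / 2"
  have d: "0 < d" "d < d0" "d * s < 1" using d0 s by (auto simp: d_def min_def field_simps)
  have near: "cmod (char M t) \<le> exp (- (s/2)\<^sup>2 * t\<^sup>2 / 2)" if "\<bar>t\<bar> \<le> d" for t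
  proof (cases "t = 0")
    case False
    let ?y = "s\<^sup>2 * t\<^sup>2 / 2"
    have y0: "0 \<le> ?y" by simp
    have "\<bar>t\<bar> * s < 1" using that d s by (meson le_less_trans mult_le_cancel_right_pos)
    then have "(\<bar>t\<bar> * s)\<^sup>2 < 1" using s by (simp add: power_less_one_iff abs_square_less_1)
    then have y1: "?y \<le> 1/2" by (simp add: power_mult_distrib mult.commute)
    have "cmod (?r t) \<le> s\<^sup>2 / 8" using d0(2)[of t] that d False by auto
    then have "cmod (char M t - of_real (exp (- ?y))) \<le> ?y / 4"
      using False by (simp add: norm_divide norm_power divide_le_eq)
    then have "cmod (char M t) \<le> exp (- ?y) + ?y / 4"
      using norm_triangle_sub[of "char M t" "of_real (exp (- ?y))"] by simp
    also have "exp (- ?y) \<le> 1 - ?y / 2"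
    proof -
      have "exp (- ?y) \<le> 1 / (1 + ?y)"
        by (rule exp_minus_le_inverse[OF y0])
      also have "\<dots> \<le> 1 - ?y / 2"
      proof -
        have "?y * ?y \<le> ?y * 1" using y0 y1 by (intro mult_left_mono) auto
        then have "1 \<le> (1 - ?y / 2) * (1 + ?y)" by (simp add: algebra_simps)
        then show ?thesis using y0 by (simp add: pos_divide_le_eq add_pos_nonneg)
      qed
      finally show ?thesis .
    qed
    also have "1 - ?y / 2 + ?y / 4 \<le> exp (- (?y / 4))"
      using exp_ge_add_one_self[of "-(?y/4)"] by simp
    finally show ?thesis by (simp add: power_divide)
  qed (simp add: char_zero)
  with d(1) show ?thesis by (rule that)
qed

text \<open>This provides the integrable majorant for \<phi>(t / \<surd>n)^n. Near 0 it comes from the second-order expansion; on the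
compact rest of [-A, A] the modulus is bounded away from 1, and a sufficiently flat Gaussian lies above that
bound.\<close>

lemma char_gaussian_domination:
  assumes M: "real_distribution M" "integrable M (\<lambda>x. x)" "integrable M (\<lambda>x. x\<^sup>2)"
    and "(\<integral>x. x \<partial>M) = 0" and "(\<integral>x. x\<^sup>2 \<partial>M) = s\<^sup>2" and s: "s > 0"
    and lt1: "\<And>t. 0 < \<bar>t\<bar> \<Longrightarrow> \<bar>t\<bar> \<le> A \<Longrightarrow> cmod (char M t) < 1"
  obtains c where "c > 0" "\<And>t. \<bar>t\<bar> \<le> A \<Longrightarrow> cmod (char M t) \<le> exp (- c\<^sup>2 * t\<^sup>2 / 2)"
proof -
  interpret real_distribution M by fact
  obtain d where d: "d > 0" and near: "\<And>t. \<bar>t\<bar> \<le> d \<Longrightarrow> cmod (char M t) \<le> exp (- (s/2)\<^sup>2 * t\<^sup>2 / 2)"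
    using char_gaussian_bound_near_0[OF assms(1-6)] by blast
  let ?K = "{t. d \<le> \<bar>t\<bar> \<and> \<bar>t\<bar> \<le> A}"
  have K: "compact ?K"
  proof -
    have "?K = {-A..A} \<inter> {t. d \<le> \<bar>t\<bar>}" by auto
    then show ?thesis by (auto intro!: compact_Int_closed closed_Collect_le continuous_intros)
  qed
  obtain q where q: "0 \<le> q" "q < 1" "\<And>t. t \<in> ?K \<Longrightarrow> cmod (char M t) \<le> q"
  proof (cases "?K = {}")
    case True
    then show ?thesis using that[of 0] by auto
  next
    case False
    have "continuous_on ?K (\<lambda>t. cmod (char M t))"
      by (intro continuous_on_norm continuous_at_imp_continuous_on ballI isCont_char)
    from continuous_attains_sup[OF K False this] obtain t0 where
      t0: "t0 \<in> ?K" "\<And>t. t \<in> ?K \<Longrightarrow> cmod (char M t) \<le> cmod (char M t0)" by blast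
    have "cmod (char M t0) < 1" using t0(1) d by (intro lt1) auto
    then show ?thesis using that[of "cmod (char M t0)"] t0 by auto
  qed
  \<comment> \<open>With this c the Gaussian is at least p throughout [-A, A], and above the bound near 0. Replacing q by p
    and A by A' avoids the logarithm of 0 and division by 0.\<close>
  define p where "p = max q (1/2)"
  have p: "0 < p" "p < 1" "\<And>t. t \<in> ?K \<Longrightarrow> cmod (char M t) \<le> p"
    using q by (auto simp: p_def intro: le_max_iff_disj[THEN iffD2])
  define A' where "A' = \<bar>A\<bar> + 1"
  define c where "c = min (s/2) (sqrt (- 2 * ln p) / A')"
  have A': "A' > 0" by (simp add: A'_def)
  have lnp: "ln p < 0" using p by simp
  have cpos: "c > 0" using s A' lnp by (simp add: c_def)
  have c1: "c\<^sup>2 \<le> (s/2)\<^sup>2" using cpos unfolding c_def by (intro power_mono min.cobounded1) simp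
  have "c\<^sup>2 \<le> (sqrt (- 2 * ln p) / A')\<^sup>2" using cpos unfolding c_def by (intro power_mono min.cobounded2) simp
  then have c2: "c\<^sup>2 \<le> - 2 * ln p / A'\<^sup>2" using lnp by (simp add: power_divide)
  show ?thesis
  proof (rule that[OF cpos])
    fix t assume t: "\<bar>t\<bar> \<le> A"
    show "cmod (char M t) \<le> exp (- c\<^sup>2 * t\<^sup>2 / 2)"
    proof (cases "\<bar>t\<bar> \<le> d")
      case True
      have "c\<^sup>2 * t\<^sup>2 \<le> (s/2)\<^sup>2 * t\<^sup>2" using c1 by (rule mult_right_mono) simp
      then have "exp (- (s/2)\<^sup>2 * t\<^sup>2 / 2) \<le> exp (- c\<^sup>2 * t\<^sup>2 / 2)" by simp
      with near[OF True] show ?thesis by (rule order_trans)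
    next
      case False
      have "t\<^sup>2 \<le> A'\<^sup>2" using t by (intro abs_le_square_iff[THEN iffD1]) (auto simp: A'_def)
      then have "c\<^sup>2 * t\<^sup>2 \<le> - 2 * ln p / A'\<^sup>2 * A'\<^sup>2" using c2 by (intro mult_mono order_trans[OF zero_le_power2 c2]) auto
      then have "ln p \<le> - c\<^sup>2 * t\<^sup>2 / 2" using A' by simp
      then have "exp (ln p) \<le> exp (- c\<^sup>2 * t\<^sup>2 / 2)" by (subst exp_le_cancel_iff)
      then have "p \<le> exp (- c\<^sup>2 * t\<^sup>2 / 2)" using p(1) by simp
      moreover have "cmod (char M t) \<le> p" using False t by (intro p(3)) auto
      ultimately show ?thesis by (rule order_trans[rotated])
    qed
  qed
qed

section \<open>A second moment from characteristic functions\<close>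

text \<open>The square of |\<phi>(t)| is the characteristic function of X - X' for an independent copy X' of X. The lower bound on
the n-th power makes n (1 - |\<phi>(1 / \<surd>n)|^2) bounded, that is, n times the expectation of
1 - cos ((X - X') / \<surd>n). The integrand tends to (X - X')^2 / 2, which is thus integrable by Fatou's lemma;
Fubini's theorem then fixes one of the two variables.\<close>

lemma square_integrable_of_char_power:
  assumes M: "real_distribution M" and d: "d > 0"
    and lb: "\<forall>\<^sub>F n in sequentially. d \<le> cmod (char M (1 / sqrt (real n))) ^ n"
  shows "integrable M (\<lambda>x. x\<^sup>2)"
proof -
  interpret real_distribution M by fact
  interpret P: pair_prob_space M M ..
  have [measurable_cong]: "sets M = sets borel" by simp
  let ?f = "\<lambda>n x y. real n * (1 - cos ((x - y) / sqrt (real n))) :: real"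
  define C where "C = - 2 * ln d"
  have int: "integrable M (\<lambda>x. cos (t * x))" "integrable M (\<lambda>x. sin (t * x))" for t :: real
    by (auto intro!: integrable_const_bound[where B=1])
  have char: "char M t = Complex (\<integral>x. cos (t * x) \<partial>M) (\<integral>x. sin (t * x) \<partial>M)" for t
  proof -
    have i: "integrable M (\<lambda>x. iexp (t * x))" by (rule integrable_const_bound[where B=1]) auto
    have "Re (char M t) = (\<integral>x. cos (t * x) \<partial>M)" "Im (char M t) = (\<integral>x. sin (t * x) \<partial>M)"
      unfolding char_def using i by (simp_all add: integral_Re[symmetric] integral_Im[symmetric] Re_exp Im_exp flip: of_real_mult)
    then show ?thesis by (simp add: complex_eq_iff)
  qed
  have sym: "(\<integral>\<^sup>+x. \<integral>\<^sup>+y. ennreal (?f n x y) \<partial>M \<partial>M) = ennreal (real n * (1 - (cmod (char M (1 / sqrt (real n))))\<^sup>2))" for n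
  proof -
    let ?t = "1 / sqrt (real n)"
    let ?c = "\<integral>x. cos (?t * x) \<partial>M" let ?s = "\<integral>x. sin (?t * x) \<partial>M"
    have e: "?f n x y = real n * (1 - (cos (?t * x) * cos (?t * y) + sin (?t * x) * sin (?t * y)))" for x y
      by (simp add: cos_diff diff_divide_distrib)
    have i1: "integrable M (\<lambda>y. ?f n x y)" for x
      unfolding e by (intro integrable_mult_right Bochner_Integration.integrable_diff Bochner_Integration.integrable_add int) simp
    have v1: "(\<integral>y. ?f n x y \<partial>M) = real n * (1 - (cos (?t * x) * ?c + sin (?t * x) * ?s))" for x
      unfolding e using int[of ?t] by (simp add: prob_space[simplified])
    have i2: "integrable M (\<lambda>x. real n * (1 - (cos (?t * x) * ?c + sin (?t * x) * ?s)))"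
      by (intro integrable_mult_right Bochner_Integration.integrable_diff Bochner_Integration.integrable_add integrable_mult_left int) simp
    then have i3: "integrable M (\<lambda>x. \<integral>y. ?f n x y \<partial>M)" unfolding v1 .
    have "(\<integral>\<^sup>+x. \<integral>\<^sup>+y. ennreal (?f n x y) \<partial>M \<partial>M) = (\<integral>\<^sup>+x. ennreal (\<integral>y. ?f n x y \<partial>M) \<partial>M)"
      by (intro nn_integral_cong nn_integral_eq_integral i1) auto
    also have "\<dots> = ennreal (\<integral>x. (\<integral>y. ?f n x y \<partial>M) \<partial>M)"
      by (intro nn_integral_eq_integral i3) (auto intro!: integral_nonneg_AE)
    also have "(\<integral>x. (\<integral>y. ?f n x y \<partial>M) \<partial>M) = real n * (1 - (?c * ?c + ?s * ?s))"
      unfolding v1 using int[of ?t] by (simp add: prob_space[simplified])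
    also have "?c * ?c + ?s * ?s = (cmod (char M ?t))\<^sup>2"
      unfolding char by (simp add: cmod_power2) (simp add: power2_eq_square)
    finally show ?thesis .
  qed
  have bound: "\<forall>\<^sub>F n in sequentially. (\<integral>\<^sup>+x. \<integral>\<^sup>+y. ennreal (?f n x y) \<partial>M \<partial>M) \<le> ennreal C"
    using lb eventually_ge_at_top[of 1]
  proof eventually_elim
    case (elim n)
    let ?x = "cmod (char M (1 / sqrt (real n)))"
    have "?x > 0"
    proof (rule ccontr)
      assume "\<not> ?x > 0"
      then have "?x ^ n = 0" using elim by simp
      with elim d show False by simp
    qed
    have "ln d \<le> ln (?x ^ n)" using elim d by (subst ln_le_cancel_iff) auto
    also have "\<dots> = n * ln ?x" using \<open>?x > 0\<close> by (simp add: ln_realpow)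
    finally have "ln d \<le> n * ln ?x" .
    moreover have "ln (?x\<^sup>2) \<le> ?x\<^sup>2 - 1" using \<open>?x > 0\<close> by (intro ln_le_minus_one) simp
    then have "real n * (1 - ?x\<^sup>2) \<le> real n * (- 2 * ln ?x)"
      using \<open>?x > 0\<close> by (intro mult_left_mono) (auto simp: ln_realpow)
    ultimately have "real n * (1 - ?x\<^sup>2) \<le> C" by (simp add: C_def)
    then show ?case unfolding sym by (rule ennreal_leI)
  qed
  have lim: "(\<lambda>n. ?f n x y) \<longlonglongrightarrow> (x - y)\<^sup>2 / 2" for x y
  proof -
    let ?w = "\<lambda>n. (x - y) / 2 / sqrt (real n)"
    have w0: "?w \<longlonglongrightarrow> 0"
      by (intro tendsto_divide_0[OF tendsto_const] filterlim_at_top_imp_at_infinity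
          filterlim_compose[OF sqrt_at_top filterlim_real_sequentially])
    have "(\<lambda>n. 2 * ((x - y) / 2 * sinc (?w n))\<^sup>2) \<longlonglongrightarrow> 2 * ((x - y) / 2 * sinc 0)\<^sup>2"
      by (intro tendsto_intros isCont_tendsto_compose[OF isCont_sinc] w0)
    then have "(\<lambda>n. 2 * ((x - y) / 2 * sinc (?w n))\<^sup>2) \<longlonglongrightarrow> (x - y)\<^sup>2 / 2"
      by (simp add: power2_eq_square)
    moreover have "\<forall>\<^sub>F n in sequentially. 2 * ((x - y) / 2 * sinc (?w n))\<^sup>2 = ?f n x y"
      using eventually_ge_at_top[of 1]
    proof eventually_elim
      case (elim n)
      have "(x - y) / 2 * sinc (?w n) = sqrt (real n) * sin (?w n)"
        using elim by auto
      then have "2 * ((x - y) / 2 * sinc (?w n))\<^sup>2 = real n * (2 * (sin (?w n))\<^sup>2)"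
        by (simp add: power_mult_distrib)
      also have "2 * (sin (?w n))\<^sup>2 = 1 - cos (2 * ?w n)"
        using cos_double_sin[of "?w n"] by linarith
      also have "2 * ?w n = (x - y) / sqrt (real n)" by (simp only: divide_divide_eq_left' divide_divide_eq_left times_divide_eq_right)
      finally show ?case .
    qed
    ultimately show ?thesis by (rule Lim_transform_eventually)
  qed
  have "(\<integral>\<^sup>+x. \<integral>\<^sup>+y. ennreal ((x - y)\<^sup>2 / 2) \<partial>M \<partial>M) \<le> ennreal C"
  proof -
    have "(\<integral>\<^sup>+x. \<integral>\<^sup>+y. ennreal ((x - y)\<^sup>2 / 2) \<partial>M \<partial>M) =
       (\<integral>\<^sup>+p. ennreal ((fst p - snd p)\<^sup>2 / 2) \<partial>(M \<Otimes>\<^sub>M M))"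
      by (subst nn_integral_fst[symmetric]) auto
    also have "\<dots> = (\<integral>\<^sup>+p. liminf (\<lambda>n. ennreal (?f n (fst p) (snd p))) \<partial>(M \<Otimes>\<^sub>M M))"
      by (intro nn_integral_cong lim_imp_Liminf[symmetric] tendsto_ennrealI lim) simp
    also have "\<dots> \<le> liminf (\<lambda>n. \<integral>\<^sup>+p. ennreal (?f n (fst p) (snd p)) \<partial>(M \<Otimes>\<^sub>M M))"
      by (rule nn_integral_liminf) auto
    also have "(\<lambda>n. \<integral>\<^sup>+p. ennreal (?f n (fst p) (snd p)) \<partial>(M \<Otimes>\<^sub>M M)) = (\<lambda>n. \<integral>\<^sup>+x. \<integral>\<^sup>+y. ennreal (?f n x y) \<partial>M \<partial>M)"
      by (subst nn_integral_fst[symmetric]) auto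
    also have "liminf \<dots> \<le> ennreal C"
      using bound by (intro Liminf_le) (auto intro: eventually_frequently)
    finally show ?thesis .
  qed
  then have "(\<integral>\<^sup>+x. \<integral>\<^sup>+y. ennreal ((x - y)\<^sup>2 / 2) \<partial>M \<partial>M) \<noteq> \<infinity>"
    by (auto simp: top_unique)
  then have "AE x in M. (\<integral>\<^sup>+y. ennreal ((x - y)\<^sup>2 / 2) \<partial>M) \<noteq> \<infinity>"
    by (intro nn_integral_PInf_AE) auto
  then have "\<exists>x. (\<integral>\<^sup>+y. ennreal ((x - y)\<^sup>2 / 2) \<partial>M) \<noteq> \<infinity>"
    using AE_False eventually_elim2 by (metis (mono_tags, lifting) eventually_mono)
  then obtain x where x: "(\<integral>\<^sup>+y. ennreal ((x - y)\<^sup>2 / 2) \<partial>M) \<noteq> \<infinity>" ..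
  have ix: "integrable M (\<lambda>y. (x - y)\<^sup>2 / 2)"
    using x by (intro integrableI_nonneg) (auto simp: less_top)
  have "integrable M (\<lambda>y. 4 * ((x - y)\<^sup>2 / 2) + 2 * x\<^sup>2)"
    by (intro Bochner_Integration.integrable_add integrable_mult_right ix) simp
  then show ?thesis
  proof (rule Bochner_Integration.integrable_bound)
    have "y\<^sup>2 \<le> 4 * ((x - y)\<^sup>2 / 2) + 2 * x\<^sup>2" for y :: real
      using zero_le_power2[of "y - 2 * x"] by (simp add: power2_diff mult.commute[of y x] diff_divide_distrib add_divide_distrib)
    then show "AE y in M. norm (y\<^sup>2) \<le> norm (4 * ((x - y)\<^sup>2 / 2) + 2 * x\<^sup>2)"
      by (auto intro!: AE_I2 order_trans[OF _ abs_ge_self])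
  qed simp
qed

section \<open>Mean approximation and lattice distributions\<close>

text \<open>The substitution t \<rightarrow> t / \<surd>n absorbs the factor \<surd>n, and the central limit theorem with the Gaussian majorant gives
dominated convergence. Letting the Gaussian run over the whole line, and not only over [-A, A], spares a
separate estimate of its tails in the inversion formula for lattice laws.\<close>

lemma char_power_L1_gaussian:
  assumes M: "real_distribution M" "integrable M (\<lambda>x. x)" "integrable M (\<lambda>x. x\<^sup>2)"
    and "(\<integral>x. x \<partial>M) = 0" and "(\<integral>x. x\<^sup>2 \<partial>M) = s\<^sup>2" and s: "s > 0" and A: "A > 0"
    and lt1: "\<And>t. 0 < \<bar>t\<bar> \<Longrightarrow> \<bar>t\<bar> \<le> A \<Longrightarrow> cmod (char M t) < 1"
  shows "(\<lambda>n. sqrt (real n) * (LINT t|lborel.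
     cmod (indicator {-A..A} t * char M t ^ n - of_real (exp (- real n * s\<^sup>2 * t\<^sup>2 / 2))))) \<longlonglongrightarrow> 0"
proof -
  interpret real_distribution M by fact
  obtain c where c: "c > 0" "\<And>t. \<bar>t\<bar> \<le> A \<Longrightarrow> cmod (char M t) \<le> exp (- c\<^sup>2 * t\<^sup>2 / 2)"
    using char_gaussian_domination[OF assms(1-6) lt1] by blast
  let ?G = "\<lambda>n t. cmod (indicator {-A..A} t * char M t ^ n - of_real (exp (- real n * s\<^sup>2 * t\<^sup>2 / 2)))"
  let ?F = "\<lambda>n t. if n = 0 then 0 else ?G n (t / sqrt (real n))"
  have scale: "sqrt (real n) * (LINT t|lborel. ?G n t) = (LINT t|lborel. ?F n t)" for n
  proof (cases "n = 0")
    case False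
    then have "(LINT t|lborel. ?G n t) = \<bar>1 / sqrt (real n)\<bar> *\<^sub>R (LINT t|lborel. ?G n (0 + 1 / sqrt (real n) * t))"
      by (intro lborel_integral_real_affine) simp
    then show ?thesis using False by simp
  qed simp
  have sq: "- real n * s\<^sup>2 * (t / sqrt (real n))\<^sup>2 / 2 = - s\<^sup>2 * t\<^sup>2 / 2" if "n \<noteq> 0" for n t
    using that by (simp add: power_divide)
  have cq: "exp (- c\<^sup>2 * (t / sqrt (real n))\<^sup>2 / 2) ^ n = exp (- c\<^sup>2 * t\<^sup>2 / 2)" if "n \<noteq> 0" for n t
    using that by (simp add: power_divide flip: exp_of_nat_mult)
  have "(\<lambda>n. LINT t|lborel. ?F n t) \<longlonglongrightarrow> (LINT (t::real)|lborel. (0::real))"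
  proof (rule integral_dominated_convergence[where M=lborel and s="?F" and f="\<lambda>_. 0"
        and w="\<lambda>t. exp (- c\<^sup>2 * t\<^sup>2 / 2) + exp (- s\<^sup>2 * t\<^sup>2 / 2)"])
    show "integrable lborel (\<lambda>t. exp (- c\<^sup>2 * t\<^sup>2 / 2) + exp (- s\<^sup>2 * t\<^sup>2 / 2))"
      by (intro Bochner_Integration.integrable_add integrable_gaussian_exp s c)
    show "AE t in lborel. norm (?F n t) \<le> exp (- c\<^sup>2 * t\<^sup>2 / 2) + exp (- s\<^sup>2 * t\<^sup>2 / 2)" for n
    proof (intro AE_I2)
      fix t :: real
      show "norm (?F n t) \<le> exp (- c\<^sup>2 * t\<^sup>2 / 2) + exp (- s\<^sup>2 * t\<^sup>2 / 2)"
      proof (cases "n = 0")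
        case False
        let ?u = "t / sqrt (real n)"
        have "cmod (indicator {-A..A} ?u * char M ?u ^ n) \<le> exp (- c\<^sup>2 * t\<^sup>2 / 2)"
        proof (cases "\<bar>?u\<bar> \<le> A")
          case True
          then have "cmod (char M ?u) ^ n \<le> exp (- c\<^sup>2 * ?u\<^sup>2 / 2) ^ n" by (intro power_mono c(2)) auto
          with True show ?thesis unfolding cq[OF False] by (auto simp: norm_mult norm_power indicator_def)
        next
          case F: False
          then have "?u \<notin> {-A..A}" by auto
          then have "indicator {-A..A} ?u = (0::complex)" by (rule indicator_simps(2))
          then show ?thesis by simp
        qed
        moreover have "cmod (of_real (exp (- real n * s\<^sup>2 * ?u\<^sup>2 / 2))) = exp (- s\<^sup>2 * t\<^sup>2 / 2)"
          unfolding sq[OF False] by simp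
        ultimately have "?G n ?u \<le> exp (- c\<^sup>2 * t\<^sup>2 / 2) + exp (- s\<^sup>2 * t\<^sup>2 / 2)"
          by (intro order_trans[OF norm_triangle_ineq4] add_mono) (simp_all only: order_refl)
        with False show ?thesis by simp
      qed simp
    qed
    show "AE t in lborel. (\<lambda>n. ?F n t) \<longlonglongrightarrow> 0"
    proof (intro AE_I2)
      fix t :: real
      let ?t = "\<lambda>n. t / sqrt (real n)"
      have t0: "?t \<longlonglongrightarrow> 0"
        by (intro tendsto_divide_0[OF tendsto_const] filterlim_at_top_imp_at_infinity
            filterlim_compose[OF sqrt_at_top filterlim_real_sequentially])
      have "(\<lambda>n. cmod (char M (?t n) ^ n - of_real (exp (- s\<^sup>2 * t\<^sup>2 / 2)))) \<longlonglongrightarrow> 0"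
        by (rule tendsto_norm_zero[OF LIM_zero[OF char_power_tendsto_gaussian[OF assms(1-5)]]])
      moreover have "\<forall>\<^sub>F n in sequentially. cmod (char M (?t n) ^ n - of_real (exp (- s\<^sup>2 * t\<^sup>2 / 2))) = ?F n t"
        using tendstoD[OF t0 A] eventually_gt_at_top[of 0]
      proof eventually_elim
        case (elim n)
        then have "?t n \<in> {-A..A}"
          unfolding dist_real_def by (simp only: diff_zero atLeastAtMost_iff) linarith
        then have i: "indicator {-A..A} (?t n) = (1::complex)" by (rule indicator_simps(1))
        have n: "n \<noteq> 0" using elim by simp
        show ?case unfolding i sq[OF n] using n by simp
      qed
      ultimately show "(\<lambda>n. ?F n t) \<longlonglongrightarrow> 0" by (rule Lim_transform_eventually)
    qed
    show "?F n \<in> borel_measurable lborel" for n by (cases "n = 0") auto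
  qed simp
  then show ?thesis unfolding scale by simp
qed

text \<open>If \<phi>(t) = exp (i \<theta>), then 1 - cos (t X - \<theta>) is nonnegative with expectation 0, so that t X - \<theta> is almost surely a
multiple of 2 \<pi>.\<close>

lemma cmod_char_eq_1_iff_lattice:
  assumes M: "real_distribution M" and t: "t \<noteq> 0"
  shows "cmod (char M t) = 1 \<longleftrightarrow> (\<exists>a. AE x in M. (x - a) / (2 * pi / t) \<in> \<int>)"
proof -
  interpret real_distribution M by fact
  have i: "integrable M (\<lambda>x. iexp (t * x))" by (rule integrable_const_bound[where B=1]) auto
  show ?thesis
  proof
    assume c: "cmod (char M t) = 1"
    define \<theta> where "\<theta> = Arg (char M t)"
    have "char M t \<noteq> 0" using c by auto
    then have ch: "char M t = iexp \<theta>"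
      using c Arg_eq[of "char M t"] by (simp add: \<theta>_def)
    have Ii: "integrable M (\<lambda>x. cos (t * x - \<theta>))" by (rule integrable_const_bound[where B=1]) auto
    have "(\<integral>x. cos (t * x - \<theta>) \<partial>M) = (\<integral>x. Re (iexp (t * x) * iexp (- \<theta>)) \<partial>M)"
      by (intro Bochner_Integration.integral_cong refl) (simp add: exp_add[symmetric] Re_exp algebra_simps flip: of_real_mult of_real_diff)
    also have "\<dots> = Re (CLINT x|M. iexp (t * x) * iexp (- \<theta>))"
      using i by (intro integral_Re integrable_mult_left) auto
    also have "\<dots> = Re (char M t * iexp (- \<theta>))" unfolding char_def by simp
    also have "\<dots> = 1" unfolding ch by (simp add: exp_add[symmetric])
    finally have "(\<integral>x. 1 - cos (t * x - \<theta>) \<partial>M) = 0" using Ii by (simp add: prob_space[simplified])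
    then have "AE x in M. 1 - cos (t * x - \<theta>) = 0"
      using Ii by (subst (asm) integral_nonneg_eq_0_iff_AE) auto
    then have "AE x in M. (x - \<theta> / t) / (2 * pi / t) \<in> \<int>"
    proof eventually_elim
      case (elim x)
      then obtain k :: int where "t * x - \<theta> = of_int k * 2 * pi"
        by (auto simp: cos_one_2pi_int)
      then have "(x - \<theta> / t) / (2 * pi / t) = of_int k" using t by (simp add: field_simps)
      then show ?case by simp
    qed
    then show "\<exists>a. AE x in M. (x - a) / (2 * pi / t) \<in> \<int>" ..
  next
    assume "\<exists>a. AE x in M. (x - a) / (2 * pi / t) \<in> \<int>"
    then obtain a where a: "AE x in M. (x - a) / (2 * pi / t) \<in> \<int>" ..
    have "char M t = (CLINT x|M. iexp (t * a))"
      unfolding char_def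
    proof (rule integral_cong_AE)
      show "AE x in M. iexp (t * x) = iexp (t * a)"
        using a
      proof eventually_elim
        case (elim x)
        then obtain k :: int where "(x - a) / (2 * pi / t) = of_int k" by (auto elim: Ints_cases)
        then have "t * x = t * a + 2 * of_int k * pi" using t by (simp add: field_simps)
        then have "iexp (t * x) = iexp (t * a) * exp (2 * of_int k * of_real pi * \<i>)"
          by (simp add: exp_add[symmetric] algebra_simps)
        then show ?case by (simp add: exp_integer_2pi mult_ac)
      qed
    qed auto
    then show "cmod (char M t) = 1" by (simp add: prob_space[simplified])
  qed
qed

section \<open>A kernel with compactly supported Fourier transform\<close>

text \<open>This is 2 (1 - cos (T x)) / x^2, the Fourier transform of the triangle function T - |t| on [-T, T]. Written as a
square, its positivity and its continuity at 0 are visible.\<close>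

definition fejer_kernel :: "real \<Rightarrow> real \<Rightarrow> real" where
  "fejer_kernel T x = (T * sinc (T * x / 2))\<^sup>2"

lemma fejer_kernel_nonneg [simp]: "0 \<le> fejer_kernel T x"
  by (simp add: fejer_kernel_def)

lemma isCont_fejer_kernel: "isCont (fejer_kernel T) x"
  unfolding fejer_kernel_def[abs_def]
  by (intro continuous_intros isCont_o2[OF _ isCont_sinc]) auto

lemma borel_measurable_fejer_kernel [measurable]: "fejer_kernel T \<in> borel_measurable borel"
  by (intro borel_measurable_continuous_onI continuous_at_imp_continuous_on ballI isCont_fejer_kernel)

text \<open>The first zeros of the kernel are at 2 \<pi> / T and -2 \<pi> / T. A small T therefore makes it positive on a given
bounded interval.\<close>

lemma fejer_kernel_pos:
  assumes "T > 0" "0 \<le> x" "T * x < 2 * pi" shows "0 < fejer_kernel T x"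
proof (cases "x = 0")
  case False
  then have "0 < sin (T * x / 2)" using assms by (intro sin_gt_zero) auto
  then show ?thesis using False assms by (simp add: fejer_kernel_def)
qed (use assms in \<open>simp add: fejer_kernel_def\<close>)

lemma fejer_kernel_bounds: "fejer_kernel T x \<le> T\<^sup>2" "x\<^sup>2 * fejer_kernel T x \<le> 4"
proof -
  have "\<bar>sinc y\<bar> \<le> 1" for y
    using abs_sin_x_le_abs_x[of y] by (auto simp: divide_le_eq)
  then have "(sinc (T * x / 2))\<^sup>2 \<le> 1" unfolding abs_square_le_1 .
  then show "fejer_kernel T x \<le> T\<^sup>2"
    unfolding fejer_kernel_def power_mult_distrib by (intro mult_left_le) auto
  have "x * (T * sinc (T * x / 2)) = (if T * x = 0 then 0 else 2 * sin (T * x / 2))" by auto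
  then have "\<bar>x * (T * sinc (T * x / 2))\<bar> \<le> 2" by (auto simp: abs_mult)
  then have "(x * (T * sinc (T * x / 2)))\<^sup>2 \<le> 2\<^sup>2" by (subst abs_le_square_iff[symmetric]) simp
  then show "x\<^sup>2 * fejer_kernel T x \<le> 4" by (simp add: fejer_kernel_def power_mult_distrib)
qed

lemma integrable_inverse_one_plus_square: "integrable lborel (\<lambda>x::real. inverse (1 + x\<^sup>2))"
proof -
  have "einterval (- \<infinity>) \<infinity> = (UNIV :: real set)" by (auto simp: einterval_iff)
  then show ?thesis using integrable_inverse_1_plus_square unfolding set_integrable_def by simp
qed

lemma integrable_fejer_kernel: "integrable lborel (fejer_kernel T)"
proof (rule Bochner_Integration.integrable_bound)
  show "integrable lborel (\<lambda>x::real. (T\<^sup>2 + 4) * inverse (1 + x\<^sup>2))"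
    by (intro integrable_mult_right integrable_inverse_one_plus_square)
  have "fejer_kernel T x * (1 + x\<^sup>2) \<le> T\<^sup>2 + 4" for x
    using fejer_kernel_bounds[where T=T and x=x] by (simp add: algebra_simps)
  then have "fejer_kernel T x \<le> (T\<^sup>2 + 4) * inverse (1 + x\<^sup>2)" for x
    by (simp add: divide_inverse[symmetric] pos_le_divide_eq add_pos_nonneg)
  then show "AE x in lborel. norm (fejer_kernel T x) \<le> norm ((T\<^sup>2 + 4) * inverse (1 + x\<^sup>2))"
    by (auto intro!: AE_I2 order_trans[OF _ abs_ge_self] simp del: abs_mult)
qed simp

lemma fejer_kernel_fourier:
  assumes "T > 0"
  shows "of_real (fejer_kernel T x) =
    (CLINT t|lborel. indicator {0..T} t *\<^sub>R (of_real (T - t) * (iexp (t * x) + iexp (- (t * x)))))"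
proof -
  have c: "iexp y + iexp (- y) = of_real (2 * cos y)" for y
    by (simp add: complex_eq_iff Re_exp Im_exp)
  have "(LINT t|lborel. indicator {0..T} t *\<^sub>R ((T - t) * (2 * cos (t * x)))) = fejer_kernel T x"
  proof (cases "x = 0")
    case True
    have "(LINT t|lborel. indicator {0..T} t *\<^sub>R ((T - t) * 2)) = (2 * T * T - T\<^sup>2) - (2 * T * 0 - 0\<^sup>2)"
      using assms by (intro integral_FTC_atLeastAtMost)
        (auto intro!: derivative_eq_intros continuous_intros simp flip: has_real_derivative_iff_has_vector_derivative)
    then show ?thesis using True by (simp add: fejer_kernel_def power2_eq_square)
  next
    case False
    let ?F = "\<lambda>t. 2 * ((T - t) * sin (t * x) / x - cos (t * x) / x\<^sup>2)"
    have "(LINT t|lborel. indicator {0..T} t *\<^sub>R ((T - t) * (2 * cos (t * x)))) = ?F T - ?F 0"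
      using assms False by (intro integral_FTC_atLeastAtMost)
        (auto intro!: derivative_eq_intros continuous_intros
          simp: power2_eq_square field_simps simp flip: has_real_derivative_iff_has_vector_derivative)
    also have "\<dots> = 2 * (1 - cos (T * x)) / x\<^sup>2" by (simp add: diff_divide_distrib)
    also have "1 - cos (T * x) = 2 * (sin (T * x / 2))\<^sup>2"
      using cos_double_sin[of "T * x / 2"] by simp
    also have "2 * (2 * (sin (T * x / 2))\<^sup>2) / x\<^sup>2 = fejer_kernel T x"
      using assms False by (simp add: fejer_kernel_def power_mult_distrib power_divide)
    finally show ?thesis .
  qed
  then have "of_real (fejer_kernel T x) = complex_of_real (LINT t|lborel. indicator {0..T} t *\<^sub>R ((T - t) * (2 * cos (t * x))))"
    by simp
  also have "\<dots> = (CLINT t|lborel. of_real (indicator {0..T} t *\<^sub>R ((T - t) * (2 * cos (t * x)))))"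
    by (rule integral_complex_of_real[symmetric])
  also have "\<dots> = (CLINT t|lborel. indicator {0..T} t *\<^sub>R (of_real (T - t) * (iexp (t * x) + iexp (- (t * x)))))"
    unfolding c by (intro Bochner_Integration.integral_cong refl) (simp add: scaleR_conv_of_real)
  finally show ?thesis .
qed

lemma integral_fejer_kernel_iexp:
  assumes N: "real_distribution N" and T: "T > 0"
  shows "(CLINT x|N. of_real (fejer_kernel T x) * iexp (\<theta> * x)) =
    (CLINT t|lborel. indicator {0..T} t *\<^sub>R (of_real (T - t) * (char N (\<theta> + t) + char N (\<theta> - t))))"
proof -
  interpret N: real_distribution N by fact
  interpret P: pair_sigma_finite N lborel ..
  let ?f = "\<lambda>x t. indicator {0..T} t *\<^sub>R (of_real (T - t) * (iexp ((\<theta> + t) * x) + iexp ((\<theta> - t) * x)))"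
  let ?b = "\<lambda>t. indicator {0..T} t * (2 * T)"
  have bi: "integrable lborel ?b" by (intro integrable_mult_left integrable_real_indicator) (auto simp: emeasure_lborel_Icc_eq)
  have b: "norm (?f x t) \<le> ?b t" for x t
  proof (cases "t \<in> {0..T}")
    case True
    have "norm (iexp ((\<theta> + t) * x) + iexp ((\<theta> - t) * x)) \<le> 1 + 1"
      by (rule order_trans[OF norm_triangle_ineq]) (simp flip: of_real_mult of_real_add of_real_diff)
    moreover have "cmod (of_real (T - t)) \<le> T" unfolding norm_of_real using True by auto
    ultimately have "cmod (of_real (T - t)) * norm (iexp ((\<theta> + t) * x) + iexp ((\<theta> - t) * x)) \<le> T * 2"
      using T by (intro mult_mono) auto
    with True show ?thesis by (simp add: norm_mult mult_ac)
  qed simp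
  have int: "integrable (N \<Otimes>\<^sub>M lborel) (\<lambda>(x, t). ?f x t)"
  proof (rule P.Fubini_integrable)
    have i: "integrable lborel (?f x)" for x
      by (rule Bochner_Integration.integrable_bound[OF bi], simp, intro AE_I2 order_trans[OF b], simp)
    then show "AE x in N. integrable lborel (\<lambda>t. case (x, t) of (x, t) \<Rightarrow> ?f x t)" by simp
    have "(\<integral>t. norm (?f x t) \<partial>lborel) \<le> (\<integral>t. ?b t \<partial>lborel)" for x
      by (intro integral_mono integrable_norm i bi b)
    then show "integrable N (\<lambda>x. \<integral>t. norm (case (x, t) of (x, t) \<Rightarrow> ?f x t) \<partial>lborel)"
      by (intro N.integrable_const_bound[where B="\<integral>t. ?b t \<partial>lborel"]) (auto simp: split_beta')
  qed simp
  have ch: "integrable N (\<lambda>x. iexp (t * x))" for t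
    by (rule N.integrable_const_bound[where B=1]) auto
  have "(CLINT x|N. of_real (fejer_kernel T x) * iexp (\<theta> * x)) = (CLINT x|N. CLINT t|lborel. ?f x t)"
  proof (intro Bochner_Integration.integral_cong refl)
    fix x
    have "of_real (fejer_kernel T x) * iexp (\<theta> * x) =
      (CLINT t|lborel. indicator {0..T} t *\<^sub>R (of_real (T - t) * (iexp (t * x) + iexp (- (t * x)))) * iexp (\<theta> * x))"
      unfolding fejer_kernel_fourier[OF T] by (rule integral_mult_left_zero[symmetric])
    also have "\<dots> = (CLINT t|lborel. ?f x t)"
      by (intro Bochner_Integration.integral_cong refl) (simp add: algebra_simps exp_add[symmetric] scaleR_conv_of_real)
    finally show "of_real (fejer_kernel T x) * iexp (\<theta> * x) = (CLINT t|lborel. ?f x t)" .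
  qed
  also have "\<dots> = (CLINT t|lborel. CLINT x|N. ?f x t)"
    by (rule P.Fubini_integral[symmetric]) (use int in simp)
  also have "\<dots> = (CLINT t|lborel. indicator {0..T} t *\<^sub>R (of_real (T - t) * (char N (\<theta> + t) + char N (\<theta> - t))))"
    unfolding char_def using ch[of "\<theta> + t" for t] ch[of "\<theta> - t" for t]
    by (intro Bochner_Integration.integral_cong refl) (simp add: Bochner_Integration.integral_add)
  finally show ?thesis .
qed

text \<open>Only frequencies up to T + |\<theta>| enter. This matters because the characteristic function of a non-lattice law may
come arbitrarily close to modulus 1 at large frequencies.\<close>

lemma integral_fejer_kernel_diff_bound:
  assumes N: "real_distribution N" and L: "real_distribution L" and T: "T > 0"
  shows "cmod ((CLINT x|N. of_real (fejer_kernel T x) * iexp (\<theta> * x)) - (CLINT x|L. of_real (fejer_kernel T x) * iexp (\<theta> * x)))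
    \<le> 2 * T * (LINT t|lborel. indicator {- (T + \<bar>\<theta>\<bar>)..T + \<bar>\<theta>\<bar>} t * cmod (char N t - char L t))"
proof -
  define A where "A = T + \<bar>\<theta>\<bar>"
  interpret N: real_distribution N by fact
  interpret L: real_distribution L by fact
  let ?D = "\<lambda>t. cmod (char N t - char L t)"
  let ?E = "\<lambda>t. indicator {-A..A} t * ?D t"
  let ?f = "\<lambda>M t. indicator {0..T} t *\<^sub>R (of_real (T - t) * (char M (\<theta> + t) + char M (\<theta> - t)))"
  have D2: "?D t \<le> 2" for t
    using norm_triangle_ineq4[of "char N t" "char L t"] N.cmod_char_le_1[of t] L.cmod_char_le_1[of t] by linarith
  have iE: "integrable lborel ?E"
  proof (rule Bochner_Integration.integrable_bound)
    show "integrable lborel (\<lambda>t. indicator {-A..A} t * (2::real))" by (intro integrable_mult_left integrable_real_indicator) (auto simp: emeasure_lborel_Icc_eq)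
  qed (use D2 in \<open>auto intro!: AE_I2 mult_left_mono simp: abs_mult\<close>)
  have if1: "integrable lborel (?f M)" if "real_distribution M" for M
  proof -
    interpret M: real_distribution M by fact
    show ?thesis
    proof (rule Bochner_Integration.integrable_bound)
    show "integrable lborel (\<lambda>t. indicator {0..T} t * (2 * T))" by (intro integrable_mult_left integrable_real_indicator) (auto simp: emeasure_lborel_Icc_eq)
    have "cmod (?f M t) \<le> indicator {0..T} t * (2 * T)" for t
    proof (cases "t \<in> {0..T}")
      case True
      have "cmod (char M (\<theta> + t) + char M (\<theta> - t)) \<le> 2"
        using norm_triangle_ineq[of "char M (\<theta> + t)" "char M (\<theta> - t)"]
          M.cmod_char_le_1[of "\<theta> + t"] M.cmod_char_le_1[of "\<theta> - t"] by linarith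
      moreover have "cmod (of_real (T - t)) \<le> T" unfolding norm_of_real using True by auto
      ultimately have "cmod (of_real (T - t)) * cmod (char M (\<theta> + t) + char M (\<theta> - t)) \<le> T * 2"
        using T by (intro mult_mono) auto
      with True show ?thesis by (simp add: norm_mult mult_ac)
    qed simp
    then show "AE t in lborel. cmod (?f M t) \<le> norm (indicator {0..T} t * (2 * T))"
      by (auto intro!: AE_I2 order_trans[OF _ abs_ge_self] simp del: abs_mult)
    qed simp
  qed
  have sp: "integrable lborel (\<lambda>t. ?E (\<theta> + 1 * t))" "integrable lborel (\<lambda>t. ?E (\<theta> + (-1) * t))"
    by (intro lborel_integrable_real_affine iE; simp)+
  have eq: "(LINT t|lborel. ?E (\<theta> + 1 * t)) = (LINT t|lborel. ?E t)" "(LINT t|lborel. ?E (\<theta> + (-1) * t)) = (LINT t|lborel. ?E t)"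
    using lborel_integral_real_affine[of 1 ?E \<theta>] lborel_integral_real_affine[of "-1" ?E \<theta>] by simp_all
  have "cmod ((CLINT x|N. of_real (fejer_kernel T x) * iexp (\<theta> * x)) - (CLINT x|L. of_real (fejer_kernel T x) * iexp (\<theta> * x)))
     = cmod (CLINT t|lborel. ?f N t - ?f L t)"
    unfolding integral_fejer_kernel_iexp[OF N T] integral_fejer_kernel_iexp[OF L T]
    by (subst Bochner_Integration.integral_diff[OF if1[OF N] if1[OF L]]) simp
  also have "\<dots> \<le> (LINT t|lborel. cmod (?f N t - ?f L t))" by (rule integral_norm_bound)
  also have "\<dots> \<le> (LINT t|lborel. T * (?E (\<theta> + 1 * t) + ?E (\<theta> + (-1) * t)))"
  proof (rule integral_mono)
    show "integrable lborel (\<lambda>t. cmod (?f N t - ?f L t))"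
      by (intro integrable_norm Bochner_Integration.integrable_diff if1 N L)
    show "integrable lborel (\<lambda>t. T * (?E (\<theta> + 1 * t) + ?E (\<theta> + (-1) * t)))"
      by (intro integrable_mult_right Bochner_Integration.integrable_add sp)
    fix t
    show "cmod (?f N t - ?f L t) \<le> T * (?E (\<theta> + 1 * t) + ?E (\<theta> + (-1) * t))"
    proof (cases "t \<in> {0..T}")
      case True
      then have m: "\<theta> + t \<in> {-A..A}" "\<theta> - t \<in> {-A..A}" by (auto simp: A_def)
      have "?f N t - ?f L t = of_real (T - t) * ((char N (\<theta> + t) - char L (\<theta> + t)) + (char N (\<theta> - t) - char L (\<theta> - t)))"
        using True by (simp add: algebra_simps)
      also have "cmod \<dots> = \<bar>T - t\<bar> * cmod ((char N (\<theta> + t) - char L (\<theta> + t)) + (char N (\<theta> - t) - char L (\<theta> - t)))"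
        by (simp only: norm_mult norm_of_real)
      also have "\<dots> \<le> T * (?D (\<theta> + t) + ?D (\<theta> - t))"
        using True T by (intro mult_mono norm_triangle_ineq) auto
      also have "\<dots> = T * (?E (\<theta> + 1 * t) + ?E (\<theta> + (-1) * t))"
        using m by simp
      finally show ?thesis .
    qed (use T in simp)
  qed
  also have "\<dots> = T * ((LINT t|lborel. ?E (\<theta> + 1 * t)) + (LINT t|lborel. ?E (\<theta> + (-1) * t)))"
    by (subst integral_mult_right_zero, subst Bochner_Integration.integral_add[OF sp]) simp
  also have "\<dots> = 2 * T * (LINT t|lborel. ?E t)" unfolding eq by simp
  finally show ?thesis unfolding A_def .
qed

lemma tendsto_by_subsequences:
  fixes X :: "nat \<Rightarrow> 'a::metric_space"
  assumes "\<And>r. strict_mono r \<Longrightarrow> \<exists>r'. strict_mono (r' :: nat \<Rightarrow> nat) \<and> (\<lambda>n. X (r (r' n))) \<longlonglongrightarrow> L"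
  shows "X \<longlonglongrightarrow> L"
proof (rule ccontr)
  assume "\<not> X \<longlonglongrightarrow> L"
  then obtain e where e: "e > 0" "\<not> (\<forall>\<^sub>F n in sequentially. dist (X n) L < e)"
    unfolding tendsto_iff by blast
  then have "\<exists>\<^sub>\<infinity>n. \<not> dist (X n) L < e"
    by (simp add: not_eventually cofinite_eq_sequentially)
  then have inf: "infinite {n. \<not> dist (X n) L < e}"
    by (simp add: INFM_iff_infinite)
  define r where "r = enumerate {n. \<not> dist (X n) L < e}"
  have r: "strict_mono r" unfolding r_def by (rule strict_mono_enumerate[OF inf])
  have far: "\<not> dist (X (r n)) L < e" for n
    using enumerate_in_set[OF inf, of n] by (simp add: r_def)
  from assms[OF r] obtain r' where "(\<lambda>n. X (r (r' n))) \<longlonglongrightarrow> L" by blast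
  from tendstoD[OF this e(1)] far show False by simp
qed

text \<open>The total masses of the measures w n \<mu> n need not be bounded, but weighting them with the kernel and normalising turns them
into probability measures whose characteristic functions converge by hypothesis. Levy's continuity
theorem then yields weak convergence to the normalised kernel, and testing against the indicator of [0, b)
divided by the kernel removes the weight again. If a = 0, normalisation is impossible; then the total weighted
mass tends to 0, which is enough since the kernel is bounded below on [0, b].\<close>

lemma fejer_vague_limit_convergent:
  fixes \<mu> :: "nat \<Rightarrow> real measure" and w :: "nat \<Rightarrow> real"
  assumes rd: "\<And>n. real_distribution (\<mu> n)" and w: "\<And>n. 0 \<le> w n" and a: "0 \<le> a"
    and T: "T > 0" and b: "b > 0" "T * b < 2 * pi"
    and lim: "\<And>\<theta>. (\<lambda>n. of_real (w n) * (CLINT x|\<mu> n. of_real (fejer_kernel T x) * iexp (\<theta> * x)))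
       \<longlonglongrightarrow> of_real a * (CLINT x|lborel. of_real (fejer_kernel T x) * iexp (\<theta> * x))"
  shows "(\<lambda>n. w n * measure (\<mu> n) {0..<b}) \<longlonglongrightarrow> a * b"
proof -
  let ?q = "fejer_kernel T"
  interpret \<mu>: real_distribution "\<mu> n" for n by (rule rd)
  have q_int: "integrable (\<mu> n) ?q" for n
    by (rule \<mu>.integrable_const_bound[where B="T\<^sup>2"]) (auto simp: fejer_kernel_bounds)
  have qpos: "0 < ?q x" if "x \<in> {0..b}" for x
  proof (rule fejer_kernel_pos)
    have "T * x \<le> T * b" using that T by simp
    then show "T * x < 2 * pi" using b by simp
  qed (use that T in auto)
  obtain x0 where x0: "x0 \<in> {0..b}" "\<And>x. x \<in> {0..b} \<Longrightarrow> ?q x0 \<le> ?q x"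
    using continuous_attains_inf[of "{0..b}" ?q] b continuous_at_imp_continuous_on[OF ballI[OF isCont_fejer_kernel]]
    by (metis atLeastatMost_empty_iff2 compact_Icc less_eq_real_def linorder_not_less)
  define m where "m = ?q x0"
  have m: "m > 0" "\<And>x. x \<in> {0..b} \<Longrightarrow> m \<le> ?q x" using x0 qpos by (auto simp: m_def)
  define I where "I = (LINT x|lborel. ?q x)"
  define J where "J n = (LINT x|\<mu> n. ?q x)" for n
  have J0: "0 \<le> J n" for n unfolding J_def by (rule integral_nonneg_AE) auto
  have "measure lborel {0..b} * m \<le> I"
  proof -
    have "(LINT x|lborel. indicator {0..b} x * m) \<le> I"
      unfolding I_def using m b
      by (intro integral_mono integrable_fejer_kernel integrable_mult_left integrable_real_indicator)
         (auto simp: indicator_def)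
    then show ?thesis using b by simp
  qed
  then have I: "0 < I" using m b by (auto intro: less_le_trans[OF mult_pos_pos])
  have mJ: "m * measure (\<mu> n) {0..<b} \<le> J n" for n
  proof -
    have "(LINT x|\<mu> n. indicator {0..<b} x * m) \<le> J n"
      unfolding J_def using m
      by (intro integral_mono q_int integrable_mult_left integrable_real_indicator)
         (auto simp: indicator_def \<mu>.emeasure_eq_measure)
    then show ?thesis by (simp add: mult.commute)
  qed
  have "(\<lambda>n. complex_of_real (w n * J n)) \<longlonglongrightarrow> of_real (a * I)"
    using lim[of 0] by (simp add: J_def I_def)
  then have wJ: "(\<lambda>n. w n * J n) \<longlonglongrightarrow> a * I" by (simp only: tendsto_of_real_iff)
  show ?thesis
  proof (cases "a = 0")
    case True
    have "(\<lambda>n. w n * measure (\<mu> n) {0..<b}) \<longlonglongrightarrow> 0"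
    proof (rule Lim_null_comparison)
      show "(\<lambda>n. w n * J n / m) \<longlonglongrightarrow> 0" using tendsto_divide[OF wJ tendsto_const[of m]] True m by simp
      have "norm (w n * measure (\<mu> n) {0..<b}) \<le> w n * J n / m" for n
      proof -
        have "measure (\<mu> n) {0..<b} \<le> J n / m" using mJ[of n] m by (simp add: pos_le_divide_eq mult.commute)
        then have "w n * measure (\<mu> n) {0..<b} \<le> w n * (J n / m)" using w by (intro mult_left_mono)
        then show ?thesis using w by simp
      qed
      then show "\<forall>\<^sub>F n in sequentially. norm (w n * measure (\<mu> n) {0..<b}) \<le> w n * J n / m" by simp
    qed
    with True show ?thesis by simp
  next
    case False
    with a have a: "a > 0" by simp
    define Q where "Q = density lborel (\<lambda>x. ennreal (?q x / I))"
    define R where "R n = (if J n > 0 then density (\<mu> n) (\<lambda>x. ennreal (?q x / J n)) else Q)" for n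
    have Q: "real_distribution Q"
    proof -
      have "prob_space Q"
        unfolding Q_def by (rule prob_spaceI, subst emeasure_density)
          (use I integrable_fejer_kernel in \<open>auto simp: I_def nn_integral_eq_integral\<close>)
      then show ?thesis by (simp add: real_distribution_def real_distribution_axioms_def Q_def)
    qed
    have R: "real_distribution (R n)" for n
    proof (cases "J n > 0")
      case True
      have "prob_space (density (\<mu> n) (\<lambda>x. ennreal (?q x / J n)))"
        by (rule prob_spaceI, subst emeasure_density)
          (use True q_int in \<open>auto simp: J_def nn_integral_eq_integral\<close>)
      then show ?thesis using True by (simp add: real_distribution_def real_distribution_axioms_def R_def)
    qed (use Q in \<open>simp add: R_def\<close>)
    have ev: "\<forall>\<^sub>F n in sequentially. 0 < J n \<and> 0 < w n"
    proof -
      have "\<forall>\<^sub>F n in sequentially. 0 < w n * J n"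
        using order_tendstoD(1)[OF wJ, of 0] a I by simp
      then show ?thesis
      proof eventually_elim
        case (elim n)
        then show ?case using w[of n] J0[of n] by (auto simp: zero_less_mult_iff)
      qed
    qed
    have intR: "(\<integral>x. f x \<partial>R n) = (\<integral>x. (?q x / J n) *\<^sub>R f x \<partial>\<mu> n)"
      if "J n > 0" "f \<in> borel_measurable borel" for n and f :: "real \<Rightarrow> 'b::{banach, second_countable_topology}"
      using that by (simp add: R_def integral_density)
    have intQ: "(\<integral>x. f x \<partial>Q) = (\<integral>x. (?q x / I) *\<^sub>R f x \<partial>lborel)"
      if "f \<in> borel_measurable borel" for f :: "real \<Rightarrow> 'b::{banach, second_countable_topology}"
      using that I by (simp add: Q_def integral_density)
    have conv: "weak_conv_m R Q"
    proof (rule levy_continuity[OF R Q])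
      fix \<theta> :: real
      let ?Z = "\<lambda>M. CLINT x|M. of_real (?q x) * iexp (\<theta> * x)"
      have L: "(\<lambda>n. (of_real (w n) * ?Z (\<mu> n)) / of_real (w n * J n)) \<longlonglongrightarrow> (of_real a * ?Z lborel) / of_real (a * I)"
        using a I by (intro tendsto_divide lim tendsto_of_real wJ) auto
      have Z: "(of_real a * ?Z lborel) / of_real (a * I) = char Q \<theta>"
        unfolding char_def using a by (subst intQ) (auto simp: scaleR_conv_of_real)
      have "\<forall>\<^sub>F n in sequentially. (of_real (w n) * ?Z (\<mu> n)) / of_real (w n * J n) = char (R n) \<theta>"
        using ev
      proof eventually_elim
        case (elim n)
        have "char (R n) \<theta> = (CLINT x|\<mu> n. (?q x / J n) *\<^sub>R iexp (\<theta> * x))"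
          unfolding char_def using elim by (intro intR) auto
        also have "\<dots> = (CLINT x|\<mu> n. (of_real (?q x) * iexp (\<theta> * x)) / of_real (J n))"
          by (intro Bochner_Integration.integral_cong refl) (simp add: scaleR_conv_of_real)
        also have "\<dots> = ?Z (\<mu> n) / of_real (J n)" by (rule integral_divide_zero)
        finally show ?case using elim by simp
      qed
      from Lim_transform_eventually[OF L this]
      show "(\<lambda>n. char (R n) \<theta>) \<longlonglongrightarrow> char Q \<theta>" unfolding Z .
    qed
    let ?f = "\<lambda>x. indicator {0..<b} x / ?q x :: real"
    have "(\<lambda>n. \<integral>x. ?f x \<partial>R n) \<longlonglongrightarrow> (\<integral>x. ?f x \<partial>Q)"
    proof (rule weak_conv_imp_bdd_ae_continuous_conv[OF R Q conv])
      have "isCont ?f x" if "x \<noteq> 0" "x \<noteq> b" for x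
      proof (cases "x \<in> {0<..<b}")
        case True
        have "isCont (\<lambda>x. 1 / ?q x) x"
          using qpos[of x] True by (intro continuous_intros isCont_fejer_kernel) auto
        moreover have "\<forall>\<^sub>F y in nhds x. y \<in> {0<..<b}" using True by (intro eventually_nhds_in_open) auto
        then have "\<forall>\<^sub>F y in nhds x. ?f y = 1 / ?q y" by eventually_elim auto
        ultimately show ?thesis by (subst isCont_cong)
      next
        case False
        have "\<forall>\<^sub>F y in nhds x. y \<in> {..<0} \<union> {b<..}" using False that by (intro eventually_nhds_in_open) auto
        then have "\<forall>\<^sub>F y in nhds x. ?f y = 0" by eventually_elim (use b in auto)
        from isCont_cong[OF this] show ?thesis by simp
      qed
      then have "{x. \<not> isCont ?f x} \<subseteq> {0, b}" by auto
      then have "finite {x. \<not> isCont ?f x}" by (rule finite_subset) simp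
      then show "emeasure Q {x. \<not> isCont ?f x} = 0"
        unfolding Q_def by (subst emeasure_density)
         (auto simp: finite_imp_closed borel_closed intro!: nn_integral_null_set finite_imp_null_set_lborel)
      show "norm (?f x) \<le> 1 / m" for x
        using m(1) m(2)[of x] by (auto simp: indicator_def intro!: frac_le)
    qed simp
    moreover have "(\<integral>x. ?f x \<partial>Q) = b / I"
    proof -
      have "(\<integral>x. ?f x \<partial>Q) = (\<integral>x. (?q x / I) *\<^sub>R ?f x \<partial>lborel)" by (rule intQ) simp
      also have "\<dots> = (\<integral>x. indicator {0..<b} x / I \<partial>lborel)"
      proof (intro Bochner_Integration.integral_cong refl)
        fix x show "(?q x / I) *\<^sub>R ?f x = indicator {0..<b} x / I"
          using qpos[of x] by (cases "x \<in> {0..<b}") auto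
      qed
      also have "\<dots> = b / I" using b by simp
      finally show ?thesis .
    qed
    ultimately have "(\<lambda>n. (w n * J n) * (\<integral>x. ?f x \<partial>R n)) \<longlonglongrightarrow> (a * I) * (b / I)"
      by (intro tendsto_mult wJ) simp
    then have "(\<lambda>n. (w n * J n) * (\<integral>x. ?f x \<partial>R n)) \<longlonglongrightarrow> a * b" using I by simp
    moreover have "\<forall>\<^sub>F n in sequentially. (w n * J n) * (\<integral>x. ?f x \<partial>R n) = w n * measure (\<mu> n) {0..<b}"
      using ev
    proof eventually_elim
      case (elim n)
      have "(\<integral>x. ?f x \<partial>R n) = (\<integral>x. (?q x / J n) *\<^sub>R ?f x \<partial>\<mu> n)" using elim by (intro intR) simp_all
      also have "\<dots> = (\<integral>x. indicator {0..<b} x / J n \<partial>\<mu> n)"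
      proof (intro Bochner_Integration.integral_cong refl)
        fix x show "(?q x / J n) *\<^sub>R ?f x = indicator {0..<b} x / J n"
          using qpos[of x] by (cases "x \<in> {0..<b}") auto
      qed
      also have "\<dots> = measure (\<mu> n) {0..<b} / J n" by simp
      finally show ?case using elim by simp
    qed
    ultimately show ?thesis by (rule Lim_transform_eventually)
  qed
qed

text \<open>In the application the intended limit a n depends on the position of an interval that moves with n and need
not converge. It stays bounded, so that subsequences reduce to the convergent case.\<close>

lemma fejer_vague_limit:
  fixes \<mu> :: "nat \<Rightarrow> real measure" and w a :: "nat \<Rightarrow> real"
  assumes rd: "\<And>n. real_distribution (\<mu> n)" and w: "\<And>n. 0 \<le> w n"
    and a: "\<And>n. 0 \<le> a n" "\<And>n. a n \<le> C"
    and T: "T > 0" and b: "b > 0" "T * b < 2 * pi"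
    and lim: "\<And>\<theta>. (\<lambda>n. of_real (w n) * (CLINT x|\<mu> n. of_real (fejer_kernel T x) * iexp (\<theta> * x))
       - of_real (a n) * (CLINT x|lborel. of_real (fejer_kernel T x) * iexp (\<theta> * x))) \<longlonglongrightarrow> 0"
  shows "(\<lambda>n. w n * measure (\<mu> n) {0..<b} - a n * b) \<longlonglongrightarrow> 0"
proof (rule tendsto_by_subsequences)
  fix r :: "nat \<Rightarrow> nat" assume r: "strict_mono r"
  have "\<forall>n. a (r n) \<in> {0..C}" using a by auto
  then obtain l r' where l: "l \<in> {0..C}" and r': "strict_mono r'" and "((\<lambda>n. a (r n)) \<circ> r') \<longlonglongrightarrow> l"
    using compact_Icc[of 0 C] unfolding compact_def by (metis (mono_tags, lifting))
  then have al: "(\<lambda>n. a (r (r' n))) \<longlonglongrightarrow> l" by (simp add: comp_def)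
  have s: "strict_mono (\<lambda>n. r (r' n))" using r r' by (simp add: strict_mono_def)
  have "(\<lambda>n. w (r (r' n)) * measure (\<mu> (r (r' n))) {0..<b}) \<longlonglongrightarrow> l * b"
  proof (rule fejer_vague_limit_convergent[OF rd w _ T b])
    fix \<theta>
    let ?Z = "\<lambda>M. CLINT x|M. of_real (fejer_kernel T x) * iexp (\<theta> * x)"
    have "(\<lambda>n. (of_real (w (r (r' n))) * ?Z (\<mu> (r (r' n))) - of_real (a (r (r' n))) * ?Z lborel) + of_real (a (r (r' n))) * ?Z lborel)
       \<longlonglongrightarrow> 0 + of_real l * ?Z lborel"
      using LIMSEQ_subseq_LIMSEQ[OF lim s, unfolded comp_def]
      by (intro tendsto_add tendsto_mult tendsto_of_real al tendsto_const) 
    then show "(\<lambda>n. of_real (w (r (r' n))) * ?Z (\<mu> (r (r' n)))) \<longlonglongrightarrow> of_real l * ?Z lborel" by simp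
  qed (use l in auto)
  from tendsto_diff[OF this tendsto_mult[OF al tendsto_const[of b]]] r'
  show "\<exists>r'. strict_mono r' \<and> (\<lambda>n. w (r (r' n)) * measure (\<mu> (r (r' n))) {0..<b} - a (r (r' n)) * b) \<longlonglongrightarrow> 0"
    by auto
qed

section \<open>The local limit theorem for non-lattice summands\<close>

lemma normal_density_lipschitz:
  assumes "s > 0"
  shows "\<bar>normal_density 0 s x - normal_density 0 s y\<bar> \<le> \<bar>x - y\<bar> / s\<^sup>2"
proof -
  have "\<bar>normal_density 0 s x - normal_density 0 s y\<bar> = \<bar>std_normal_density (x / s) - std_normal_density (y / s)\<bar> / s"
    unfolding normal_density_scale[OF assms] using assms by (simp flip: diff_divide_distrib)
  also have "\<dots> \<le> \<bar>x / s - y / s\<bar> / s"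
    using assms by (intro divide_right_mono std_normal_density_lipschitz) simp
  also have "\<dots> = \<bar>x - y\<bar> / s\<^sup>2"
    using assms by (simp add: power2_eq_square flip: diff_divide_distrib)
  finally show ?thesis .
qed

lemma normal_density_sqrt_scale:
  assumes "s > 0" "n \<ge> 1"
  shows "sqrt (real n) * normal_density 0 (sqrt (real n * s\<^sup>2)) x = normal_density 0 s (x / sqrt (real n))"
proof -
  have e: "sqrt (real n * s\<^sup>2) = sqrt (real n) * s" using assms by (simp add: real_sqrt_mult)
  have p: "0 < sqrt (real n) * s" using assms by simp
  show ?thesis unfolding e normal_density_scale[OF p] normal_density_scale[OF assms(1)]
    using assms by (simp add: field_simps)
qed

lemma integral_centered_normal_shift:
  fixes g :: "real \<Rightarrow> complex"
  assumes v: "v > 0" and [measurable]: "g \<in> borel_measurable borel"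
  shows "(\<integral>x. g x \<partial>distr (centered_normal v) borel (\<lambda>x. x - u)) =
    (\<integral>x. g x * of_real (normal_density 0 (sqrt v) (x + u)) \<partial>lborel)"
proof -
  have "(\<integral>x. g x \<partial>distr (centered_normal v) borel (\<lambda>x. x - u)) = (\<integral>x. g (x - u) \<partial>centered_normal v)"
    by (subst integral_distr) (auto simp: centered_normal_def)
  also have "\<dots> = (\<integral>x. normal_density 0 (sqrt v) x *\<^sub>R g (x - u) \<partial>lborel)"
    using v by (simp add: centered_normal_def integral_density)
  also have "\<dots> = (\<integral>x. normal_density 0 (sqrt v) (u + 1 * x) *\<^sub>R g (u + 1 * x - u) \<partial>lborel)"
    by (subst lborel_integral_real_affine[where c=1 and t=u]) simp_all
  finally show ?thesis by (simp add: scaleR_conv_of_real mult.commute add.commute)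
qed

text \<open>The normal law of variance n s^2, seen from the point u n, has after multiplication by \<surd>n a density that is
asymptotically constant on the scale of the kernel, with the value that it has at the point u n.\<close>

lemma gaussian_fejer_limit:
  fixes u :: "nat \<Rightarrow> real"
  assumes s: "s > 0"
  shows "(\<lambda>n. of_real (sqrt (real n)) * (CLINT x|distr (centered_normal (real n * s\<^sup>2)) borel (\<lambda>x. x - u n). of_real (fejer_kernel T x) * iexp (\<theta> * x))
       - of_real (normal_density 0 s (u n / sqrt (real n))) * (CLINT x|lborel. of_real (fejer_kernel T x) * iexp (\<theta> * x))) \<longlonglongrightarrow> 0"
    (is "?X \<longlonglongrightarrow> 0")
proof -
  let ?q = "fejer_kernel T"
  let ?d = "\<lambda>n x. normal_density 0 s ((x + u n) / sqrt (real n)) - normal_density 0 s (u n / sqrt (real n))"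
  have d1: "\<bar>?d n x\<bar> \<le> 1 / s" for n x
    using normal_density_le[OF s, of "(x + u n) / sqrt (real n)"] normal_density_le[OF s, of "u n / sqrt (real n)"]
      normal_density_nonneg[of 0 s "(x + u n) / sqrt (real n)"] normal_density_nonneg[of 0 s "u n / sqrt (real n)"]
    by linarith
  have d2: "\<bar>?d n x\<bar> \<le> \<bar>x\<bar> / s\<^sup>2 / sqrt (real n)" for n x
  proof -
    have "\<bar>?d n x\<bar> \<le> \<bar>(x + u n) / sqrt (real n) - u n / sqrt (real n)\<bar> / s\<^sup>2"
      by (rule normal_density_lipschitz[OF s])
    then show ?thesis by (simp add: mult.commute flip: diff_divide_distrib)
  qed
  have "(\<lambda>n. LINT x|lborel. ?q x * \<bar>?d n x\<bar>) \<longlonglongrightarrow> (LINT (x::real)|lborel. (0::real))"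
  proof (rule integral_dominated_convergence[where M=lborel and s="\<lambda>n x. ?q x * \<bar>?d n x\<bar>" and f="\<lambda>_. 0" and w="\<lambda>x. ?q x * (1 / s)"])
    show "integrable lborel (\<lambda>x. ?q x * (1 / s))" by (intro integrable_mult_left integrable_fejer_kernel)
    show "AE x in lborel. norm (?q x * \<bar>?d n x\<bar>) \<le> ?q x * (1 / s)" for n
      unfolding real_norm_def abs_mult abs_abs using d1[of _ n]
      by (intro AE_I2 mult_mono) auto
    show "AE x in lborel. (\<lambda>n. ?q x * \<bar>?d n x\<bar>) \<longlonglongrightarrow> 0"
    proof (intro AE_I2 tendsto_mult_right_zero)
      fix x
      show "(\<lambda>n. \<bar>?d n x\<bar>) \<longlonglongrightarrow> 0"
      proof (rule Lim_null_comparison)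
        show "(\<lambda>n. \<bar>x\<bar> / s\<^sup>2 / sqrt (real n)) \<longlonglongrightarrow> 0"
          by (intro tendsto_divide_0[OF tendsto_const] filterlim_at_top_imp_at_infinity
              filterlim_compose[OF sqrt_at_top filterlim_real_sequentially])
      qed (use d2 in simp)
    qed
  qed auto
  then have lim: "(\<lambda>n. LINT x|lborel. ?q x * \<bar>?d n x\<bar>) \<longlonglongrightarrow> 0" by simp
  show ?thesis
  proof (rule Lim_null_comparison[OF _ lim])
    have "norm (?X n) \<le> (LINT x|lborel. ?q x * \<bar>?d n x\<bar>)" if n: "n \<ge> 1" for n
    proof -
      let ?a = "normal_density 0 s (u n / sqrt (real n))"
      let ?g = "\<lambda>x. of_real (?q x) * iexp (\<theta> * x)"
      have ig: "integrable lborel ?g"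
        by (rule Bochner_Integration.integrable_bound[OF integrable_fejer_kernel[of T]]) (auto simp: norm_mult simp flip: of_real_mult)
      have igd: "integrable lborel (\<lambda>x. ?g x * of_real (normal_density 0 s ((x + u n) / sqrt (real n))))"
      proof (rule Bochner_Integration.integrable_bound)
        show "integrable lborel (\<lambda>x. ?q x * (1 / s))" by (intro integrable_mult_left integrable_fejer_kernel)
        show "AE x in lborel. norm (?g x * of_real (normal_density 0 s ((x + u n) / sqrt (real n)))) \<le> norm (?q x * (1 / s))"
          using s normal_density_le[OF s] by (intro AE_I2) (auto simp: norm_mult mult_left_mono simp flip: of_real_mult simp del: times_divide_eq_right)
      qed simp
      have "of_real (sqrt (real n)) * (CLINT x|distr (centered_normal (real n * s\<^sup>2)) borel (\<lambda>x. x - u n). ?g x)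
        = (CLINT x|lborel. of_real (sqrt (real n)) * (?g x * of_real (normal_density 0 (sqrt (real n * s\<^sup>2)) (x + u n))))"
        using n s by (subst integral_centered_normal_shift) simp_all
      also have "\<dots> = (CLINT x|lborel. ?g x * of_real (normal_density 0 s ((x + u n) / sqrt (real n))))"
        unfolding normal_density_sqrt_scale[OF s n, symmetric] by (simp add: mult_ac)
      finally have "?X n = (CLINT x|lborel. ?g x * of_real (normal_density 0 s ((x + u n) / sqrt (real n)))) - (CLINT x|lborel. of_real ?a * ?g x)"
        by simp
      also have "\<dots> = (CLINT x|lborel. ?g x * of_real (normal_density 0 s ((x + u n) / sqrt (real n))) - of_real ?a * ?g x)"
        using ig igd by (intro Bochner_Integration.integral_diff[symmetric] integrable_mult_right)
      also have "\<dots> = (CLINT x|lborel. ?g x * of_real (?d n x))"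
        by (intro Bochner_Integration.integral_cong refl) (simp add: algebra_simps)
      finally have "norm (?X n) = norm (CLINT x|lborel. ?g x * of_real (?d n x))" by (rule arg_cong)
      also have "\<dots> \<le> (LINT x|lborel. norm (?g x * of_real (?d n x)))" by (rule integral_norm_bound)
      also have "\<dots> = (LINT x|lborel. ?q x * \<bar>?d n x\<bar>)"
        unfolding norm_mult norm_of_real by (simp flip: of_real_mult)
      finally show ?thesis .
    qed
    then show "\<forall>\<^sub>F n in sequentially. norm (?X n) \<le> (LINT x|lborel. ?q x * \<bar>?d n x\<bar>)"
      unfolding eventually_sequentially by blast
  qed
qed

lemma char_distr_diff_const:
  assumes "real_distribution N"
  shows "char (distr N borel (\<lambda>x. x - u)) t = iexp (- (t * u)) * char N t"
proof -
  interpret real_distribution N by fact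
  have "char (distr N borel (\<lambda>x. x - u)) t = (CLINT x|N. iexp (t * (x - u)))"
    unfolding char_def by (subst integral_distr) auto
  also have "\<dots> = (CLINT x|N. iexp (- (t * u)) * iexp (t * x))"
    by (intro Bochner_Integration.integral_cong refl) (simp add: exp_add[symmetric] algebra_simps)
  finally show ?thesis unfolding char_def by simp
qed

lemma real_distribution_distr_diff:
  assumes "real_distribution N" shows "real_distribution (distr N borel (\<lambda>x. x - u))"
proof -
  interpret real_distribution N by fact
  show ?thesis by (rule real_distribution_distr) simp
qed

text \<open>The law of the sum is compared with the normal law of the same variance, whose integrals against the kernel
are known asymptotically. The difference only involves frequencies in a compact interval [-A, A], where the mean
approximation of the characteristic functions is o(1 / \<surd>n).\<close>

lemma local_limit_nonlattice:
  assumes M: "real_distribution M" "integrable M (\<lambda>x. x)" "integrable M (\<lambda>x. x\<^sup>2)"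
    and "(\<integral>x. x \<partial>M) = 0" and "(\<integral>x. x\<^sup>2 \<partial>M) = s\<^sup>2" and s: "s > 0"
    and lt1: "\<And>t. t \<noteq> 0 \<Longrightarrow> cmod (char M t) < 1"
    and \<nu>: "\<And>n. real_distribution (\<nu> n)" "\<And>n t. char (\<nu> n) t = char M t ^ n"
    and b: "b > 0"
  shows "uniform_limit UNIV (\<lambda>n u. sqrt (real n) * measure (\<nu> n) {u..<u + b} - b * normal_density 0 s (u / sqrt (real n)))
     (\<lambda>_. 0) sequentially"
proof (rule uniform_limit_by_sequences)
  fix u :: "nat \<Rightarrow> real"
  \<comment> \<open>Any T with T b < 2 \<pi> makes the kernel positive on the interval.\<close>
  define T where "T = pi / b"
  have T: "T > 0" "T * b < 2 * pi" using b by (simp_all add: T_def)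
  define \<mu> where "\<mu> n = distr (\<nu> n) borel (\<lambda>x. x - u n)" for n
  define \<gamma> where "\<gamma> n = distr (centered_normal (real n * s\<^sup>2)) borel (\<lambda>x. x - u n)" for n
  have \<mu>: "real_distribution (\<mu> n)" for n unfolding \<mu>_def by (intro real_distribution_distr_diff \<nu>)
  have \<gamma>: "real_distribution (\<gamma> n)" for n unfolding \<gamma>_def by (intro real_distribution_distr_diff real_distribution_centered_normal) simp
  have "(\<lambda>n. sqrt (real n) * measure (\<mu> n) {0..<b} - normal_density 0 s (u n / sqrt (real n)) * b) \<longlonglongrightarrow> 0"
  proof (rule fejer_vague_limit[OF \<mu> _ normal_density_nonneg normal_density_le[OF s] T(1) b T(2)])
    fix \<theta> :: real
    define A where "A = T + \<bar>\<theta>\<bar>"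
    have A: "A > 0" using T by (simp add: A_def)
    let ?Z = "\<lambda>M. CLINT x|M. of_real (fejer_kernel T x) * iexp (\<theta> * x)"
    let ?a = "\<lambda>n. complex_of_real (normal_density 0 s (u n / sqrt (real n)))"
    let ?L = "\<lambda>n. LINT t|lborel. cmod (indicator {-A..A} t * char M t ^ n - of_real (exp (- real n * s\<^sup>2 * t\<^sup>2 / 2)))"
    have "(\<lambda>n. of_real (sqrt (real n)) * ?Z (\<mu> n) - of_real (sqrt (real n)) * ?Z (\<gamma> n)) \<longlonglongrightarrow> 0"
    proof (rule Lim_null_comparison)
      have "(\<lambda>n. sqrt (real n) * ?L n) \<longlonglongrightarrow> 0"
        by (rule char_power_L1_gaussian[OF assms(1-6) A]) (use lt1 in auto)
      from tendsto_mult_right_zero[OF this, of "2 * T"]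
      show "(\<lambda>n. 2 * T * (sqrt (real n) * ?L n)) \<longlonglongrightarrow> 0" .
      have "norm (of_real (sqrt (real n)) * ?Z (\<mu> n) - of_real (sqrt (real n)) * ?Z (\<gamma> n)) \<le> 2 * T * (sqrt (real n) * ?L n)"
        if n: "n \<ge> 1" for n
      proof -
        have "cmod (char (\<mu> n) t - char (\<gamma> n) t) = cmod (char M t ^ n - of_real (exp (- real n * s\<^sup>2 * t\<^sup>2 / 2)))" for t
        proof -
          have "char (\<mu> n) t - char (\<gamma> n) t = iexp (- (t * u n)) * (char M t ^ n - of_real (exp (- real n * s\<^sup>2 * t\<^sup>2 / 2)))"
            unfolding \<mu>_def \<gamma>_def char_distr_diff_const[OF \<nu>(1)]
            by (subst char_distr_diff_const) (auto simp: \<nu>(2) char_centered_normal real_distribution_centered_normal right_diff_distrib)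
          then show ?thesis by (simp add: norm_mult del: of_real_mult of_real_minus)
        qed
        then have e: "(LINT t|lborel. indicator {-A..A} t * cmod (char (\<mu> n) t - char (\<gamma> n) t)) =
           (LINT t|lborel. indicator {-A..A} t * cmod (char M t ^ n - of_real (exp (- real n * s\<^sup>2 * t\<^sup>2 / 2))))"
          by simp
        have i: "integrable lborel (\<lambda>t. cmod (indicator {-A..A} t * char M t ^ n - of_real (exp (- real n * s\<^sup>2 * t\<^sup>2 / 2))))"
        proof (rule integrable_norm[OF Bochner_Integration.integrable_diff])
          interpret real_distribution M by fact
          show "integrable lborel (\<lambda>t. indicator {-A..A} t * char M t ^ n)"
          proof (rule Bochner_Integration.integrable_bound)
            show "integrable lborel (indicator {-A..A} :: real \<Rightarrow> real)"
              by (intro integrable_real_indicator) (auto simp: emeasure_lborel_Icc_eq)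
            show "AE t in lborel. norm (indicator {-A..A} t * char M t ^ n) \<le> norm (indicator {-A..A} t :: real)"
              by (intro AE_I2) (auto simp: indicator_def norm_power cmod_char_le_1 power_le_one)
            show "(\<lambda>t. indicator {-A..A} t * char M t ^ n) \<in> borel_measurable lborel"
              by (intro borel_measurable_times borel_measurable_power) (auto intro: char_measurable)
          qed
          have "integrable lborel (\<lambda>t. exp (- (sqrt (real n) * s)\<^sup>2 * t\<^sup>2 / 2) :: real)"
            using s n by (intro integrable_gaussian_exp) simp
          then show "integrable lborel (\<lambda>t. complex_of_real (exp (- real n * s\<^sup>2 * t\<^sup>2 / 2)))"
            by (intro integrable_of_real) (simp add: power_mult_distrib)
        qed
        have "(LINT t|lborel. indicator {-A..A} t * cmod (char M t ^ n - of_real (exp (- real n * s\<^sup>2 * t\<^sup>2 / 2)))) \<le> ?L n"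
        proof (rule Bochner_Integration.integral_mono'[OF i])
          show "indicator {-A..A} t * cmod (char M t ^ n - of_real (exp (- real n * s\<^sup>2 * t\<^sup>2 / 2)))
             \<le> cmod (indicator {-A..A} t * char M t ^ n - of_real (exp (- real n * s\<^sup>2 * t\<^sup>2 / 2)))" for t
            by (cases "t \<in> {-A..A}") auto
        qed auto
        moreover have "cmod (?Z (\<mu> n) - ?Z (\<gamma> n)) \<le> 2 * T *
           (LINT t|lborel. indicator {-A..A} t * cmod (char M t ^ n - of_real (exp (- real n * s\<^sup>2 * t\<^sup>2 / 2))))"
          using integral_fejer_kernel_diff_bound[OF \<mu> \<gamma> T(1), of n \<theta> n] unfolding e A_def[symmetric] .
        ultimately have "cmod (?Z (\<mu> n) - ?Z (\<gamma> n)) \<le> 2 * T * ?L n"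
          using T by (meson mult_left_mono order_trans less_imp_le mult_pos_pos zero_less_numeral)
        then have "sqrt (real n) * cmod (?Z (\<mu> n) - ?Z (\<gamma> n)) \<le> sqrt (real n) * (2 * T * ?L n)"
          by (rule mult_left_mono) simp
        moreover have "norm (of_real (sqrt (real n)) * ?Z (\<mu> n) - of_real (sqrt (real n)) * ?Z (\<gamma> n)) = sqrt (real n) * cmod (?Z (\<mu> n) - ?Z (\<gamma> n))"
          unfolding right_diff_distrib[symmetric] norm_mult by simp
        ultimately show ?thesis by (simp only: mult_ac)
      qed
      then show "\<forall>\<^sub>F n in sequentially. norm (of_real (sqrt (real n)) * ?Z (\<mu> n) - of_real (sqrt (real n)) * ?Z (\<gamma> n)) \<le> 2 * T * (sqrt (real n) * ?L n)"
        unfolding eventually_sequentially by blast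
    qed
    moreover have "(\<lambda>n. of_real (sqrt (real n)) * ?Z (\<gamma> n) - ?a n * ?Z lborel) \<longlonglongrightarrow> 0"
      unfolding \<gamma>_def by (rule gaussian_fejer_limit[OF s])
    ultimately have "(\<lambda>n. (of_real (sqrt (real n)) * ?Z (\<mu> n) - of_real (sqrt (real n)) * ?Z (\<gamma> n)) +
        (of_real (sqrt (real n)) * ?Z (\<gamma> n) - ?a n * ?Z lborel)) \<longlonglongrightarrow> 0 + 0"
      by (rule tendsto_add)
    then show "(\<lambda>n. of_real (sqrt (real n)) * ?Z (\<mu> n) - ?a n * ?Z lborel) \<longlonglongrightarrow> 0" by simp
  qed simp
  moreover have "measure (\<mu> n) {0..<b} = measure (\<nu> n) {u n..<u n + b}" for n
  proof -
    interpret real_distribution "\<nu> n" by (rule \<nu>)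
    have "(\<lambda>x. x - u n) -` {0..<b} \<inter> space (\<nu> n) = {u n..<u n + b}" by (auto simp: space_eq_univ)
    then show ?thesis unfolding \<mu>_def by (subst measure_distr) auto
  qed
  ultimately show "(\<lambda>n. sqrt (real n) * measure (\<nu> n) {u n..<u n + b} - b * normal_density 0 s (u n / sqrt (real n))) \<longlonglongrightarrow> 0"
    by (simp add: mult.commute)
qed

section \<open>The local limit theorem for lattice summands\<close>

lemma integral_iexp_lattice:
  assumes h: "h > 0" and y: "y / h \<in> \<int>"
  shows "(CLINT t|lborel. indicator {- (pi / h)..pi / h} t *\<^sub>R iexp (t * y)) = of_real (if y = 0 then 2 * pi / h else 0)"
proof (cases "y = 0")
  case True
  then show ?thesis using h by (simp add: scaleR_conv_of_real)
next
  case False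
  from y obtain k :: int where "y / h = of_int k" by (auto elim: Ints_cases)
  then have k: "pi / h * y = pi * of_int k" using h by (simp add: field_simps)
  let ?F = "\<lambda>t. iexp (t * y) / (\<i> * of_real y)"
  have "(CLINT t|lborel. indicator {- (pi / h)..pi / h} t *\<^sub>R iexp (t * y)) = ?F (pi / h) - ?F (- (pi / h))"
  proof (rule integral_FTC_atLeastAtMost)
    show "- (pi / h) \<le> pi / h" using h by simp
    show "(?F has_vector_derivative iexp (t * y)) (at t within {- (pi / h)..pi / h})" for t
    proof -
      have "((\<lambda>t. iexp (t * y)) has_vector_derivative y *\<^sub>R (\<i> * iexp (t * y))) (at t within {- (pi / h)..pi / h})"
        by (rule vector_diff_chain_within[unfolded comp_def, where f="\<lambda>t. t * y" and g=iexp])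
           (auto intro!: derivative_eq_intros has_vector_derivative_iexp simp flip: has_real_derivative_iff_has_vector_derivative)
      from has_vector_derivative_divide[OF this, of "\<i> * of_real y"] False
      show ?thesis by (simp add: scaleR_conv_of_real)
    qed
  qed (intro continuous_intros)
  also have "\<dots> = 0"
  proof -
    have "iexp (pi / h * y) = iexp (- (pi / h) * y)"
      using k by (simp add: complex_eq_iff Re_exp Im_exp mult.commute sin_npi_int flip: of_real_mult of_real_minus)
    then show ?thesis by simp
  qed
  finally show ?thesis using False by simp
qed

text \<open>The preceding integral, evaluated at x - p and averaged over x, retains only the mass at p; Fubini's theorem
moves the average onto the characteristic function.\<close>

lemma measure_lattice_point:
  assumes N: "real_distribution N" and h: "h > 0"
    and lat: "AE x in N. (x - a) / h \<in> \<int>" and p: "(p - a) / h \<in> \<int>"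
  shows "of_real (2 * pi / h * measure N {p}) =
    (CLINT t|lborel. iexp (- (t * p)) * (indicator {- (pi / h)..pi / h} t * char N t))"
proof -
  interpret N: real_distribution N by fact
  interpret P: pair_sigma_finite N lborel ..
  let ?I = "{- (pi / h)..pi / h}"
  let ?f = "\<lambda>x t. indicator ?I t *\<^sub>R iexp (t * (x - p))"
  have Ii: "integrable lborel (indicator ?I :: real \<Rightarrow> real)"
    by (intro integrable_real_indicator) (auto simp: emeasure_lborel_Icc_eq)
  have fb: "norm (?f x t) \<le> indicator ?I t" for x t
    by (simp flip: of_real_mult of_real_diff)
  have i: "integrable lborel (?f x)" for x
    by (rule Bochner_Integration.integrable_bound[OF Ii]) (auto intro!: AE_I2 simp flip: of_real_mult of_real_diff)
  have int: "integrable (N \<Otimes>\<^sub>M lborel) (\<lambda>(x, t). ?f x t)"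
  proof (rule P.Fubini_integrable)
    have "(\<integral>t. norm (?f x t) \<partial>lborel) \<le> (\<integral>t. indicator ?I t \<partial>lborel)" for x
      by (intro integral_mono integrable_norm i Ii fb)
    then show "integrable N (\<lambda>x. \<integral>t. norm (case (x, t) of (x, t) \<Rightarrow> ?f x t) \<partial>lborel)"
      by (intro N.integrable_const_bound[where B="\<integral>t. indicator ?I t \<partial>lborel"]) (auto simp: split_beta')
  qed (use i in auto)
  have "complex_of_real (2 * pi / h * measure N {p}) = of_real (\<integral>x. indicator {p} x * (2 * pi / h) \<partial>N)"
    by (simp add: mult.commute)
  also have "\<dots> = (CLINT x|N. of_real (indicator {p} x * (2 * pi / h)))" by (rule integral_complex_of_real[symmetric])
  also have "\<dots> = (CLINT x|N. CLINT t|lborel. ?f x t)"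
  proof (rule integral_cong_AE)
    show "AE x in N. of_real (indicator {p} x * (2 * pi / h)) = (CLINT t|lborel. ?f x t)"
      using lat
    proof eventually_elim
      case (elim x)
      have "(x - p) / h = (x - a) / h - (p - a) / h" by (simp add: diff_divide_distrib)
      then have "(x - p) / h \<in> \<int>" using elim p by simp
      from integral_iexp_lattice[OF h this]
      have "(CLINT t|lborel. ?f x t) = of_real (if x - p = 0 then 2 * pi / h else 0)" .
      then show ?case by (simp add: indicator_def)
    qed
  qed auto
  also have "\<dots> = (CLINT t|lborel. CLINT x|N. ?f x t)"
    by (rule P.Fubini_integral[symmetric]) (use int in simp)
  also have "\<dots> = (CLINT t|lborel. iexp (- (t * p)) * (indicator ?I t * char N t))"
  proof (intro Bochner_Integration.integral_cong refl)
    fix t :: real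
    have "(CLINT x|N. ?f x t) = (CLINT x|N. (iexp (- (t * p)) * indicator ?I t) * iexp (t * x))"
      by (intro Bochner_Integration.integral_cong refl)
         (simp add: indicator_def exp_add[symmetric] algebra_simps)
    then show "(CLINT x|N. ?f x t) = iexp (- (t * p)) * (indicator ?I t * char N t)"
      unfolding char_def by (simp add: mult.assoc)
  qed
  finally show ?thesis .
qed

lemma char_uminus:
  "char N (- t) = cnj (char N t)"
proof -
  have "char N (- t) = (CLINT x|N. cnj (iexp (t * x)))"
    unfolding char_def by (intro Bochner_Integration.integral_cong refl) (simp add: exp_cnj)
  then show ?thesis unfolding char_def by simp
qed

text \<open>A half-open interval of length h contains exactly one lattice point p. Its mass and the normal density at p are
both Fourier integrals, whose difference is bounded by the mean approximation with A = \<pi> / h; this A lies strictly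
below 2 \<pi> / h, the first frequency at which the modulus returns to 1. Replacing p by the left end point of
the interval moves the density by O(1 / \<surd>n).\<close>

lemma local_limit_lattice_cell:
  assumes M: "real_distribution M" "integrable M (\<lambda>x. x)" "integrable M (\<lambda>x. x\<^sup>2)"
    and "(\<integral>x. x \<partial>M) = 0" and "(\<integral>x. x\<^sup>2 \<partial>M) = s\<^sup>2" and s: "s > 0"
    and h: "h > 0" and eq1: "cmod (char M (2 * pi / h)) = 1"
    and lt1: "\<And>t. 0 < t \<Longrightarrow> t < 2 * pi / h \<Longrightarrow> cmod (char M t) < 1"
    and \<nu>: "\<And>n. real_distribution (\<nu> n)" "\<And>n t. char (\<nu> n) t = char M t ^ n"
  shows "(\<lambda>n. sqrt (real n) * measure (\<nu> n) {u n..<u n + h} - h * normal_density 0 s (u n / sqrt (real n))) \<longlonglongrightarrow> 0"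
proof -
  interpret real_distribution M by fact
  define A where "A = pi / h"
  have A: "A > 0" "A < 2 * pi / h" using h by (simp_all add: A_def divide_strict_right_mono)
  let ?G = "\<lambda>n t. complex_of_real (exp (- real n * s\<^sup>2 * t\<^sup>2 / 2))"
  let ?L = "\<lambda>n. LINT t|lborel. cmod (indicator {-A..A} t * char M t ^ n - ?G n t)"
  have lt1': "cmod (char M t) < 1" if "0 < \<bar>t\<bar>" "\<bar>t\<bar> \<le> A" for t
  proof (cases "t > 0")
    case True
    then show ?thesis using lt1[of t] that A by auto
  next
    case False
    then have "cmod (char M (- t)) < 1" using that A by (intro lt1) auto
    then show ?thesis unfolding char_uminus by simp
  qed
  have L0: "(\<lambda>n. sqrt (real n) * ?L n) \<longlonglongrightarrow> 0"
    by (rule char_power_L1_gaussian[OF assms(1-6) A(1) lt1'])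
  show ?thesis
  proof (rule Lim_null_comparison)
    have "(\<lambda>n. h * (h / s\<^sup>2 / sqrt (real n))) \<longlonglongrightarrow> h * 0"
      by (intro tendsto_mult tendsto_const tendsto_divide_0[OF tendsto_const] filterlim_at_top_imp_at_infinity
              filterlim_compose[OF sqrt_at_top filterlim_real_sequentially])
    from tendsto_add[OF tendsto_mult_right_zero[OF L0, of "h / (2 * pi)"] this]
    show "(\<lambda>n. h / (2 * pi) * (sqrt (real n) * ?L n) + h * (h / s\<^sup>2 / sqrt (real n))) \<longlonglongrightarrow> 0" by simp
    have "norm (sqrt (real n) * measure (\<nu> n) {u n..<u n + h} - h * normal_density 0 s (u n / sqrt (real n)))
       \<le> h / (2 * pi) * (sqrt (real n) * ?L n) + h * (h / s\<^sup>2 / sqrt (real n))" if n: "n \<ge> 1" for n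
    proof -
      interpret \<nu>n: real_distribution "\<nu> n" by (rule \<nu>)
      have "cmod (char (\<nu> n) (2 * pi / h)) = 1" unfolding \<nu>(2) by (simp add: norm_power eq1)
      then have "\<exists>a. AE x in \<nu> n. (x - a) / (2 * pi / (2 * pi / h)) \<in> \<int>"
        using h by (subst (asm) cmod_char_eq_1_iff_lattice[OF \<nu>(1)]) simp_all
      then obtain a where a: "AE x in \<nu> n. (x - a) / h \<in> \<int>" by auto
      \<comment> \<open>The sum is itself lattice with step h; the offset a comes from its own characteristic function. The
        least lattice point at or above u n is the only one in the interval.\<close>
      define p where "p = a + h * of_int \<lceil>(u n - a) / h\<rceil>"
      have p: "(p - a) / h \<in> \<int>" using h by (simp add: p_def)
      have pu: "u n \<le> p" "p < u n + h"
      proof -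
        have "h * ((u n - a) / h) \<le> h * of_int \<lceil>(u n - a) / h\<rceil>" using h by (intro mult_left_mono) auto
        then show "u n \<le> p" using h by (simp add: p_def)
        have "h * of_int \<lceil>(u n - a) / h\<rceil> < h * ((u n - a) / h + 1)" using h by (intro mult_strict_left_mono) linarith+
        also have "h * ((u n - a) / h + 1) = u n - a + h" using h by (simp add: field_simps)
        finally show "p < u n + h" by (simp add: p_def)
      qed
      have "measure (\<nu> n) {u n..<u n + h} = measure (\<nu> n) {p}"
      proof (rule \<nu>n.finite_measure_eq_AE)
        show "AE x in \<nu> n. x \<in> {u n..<u n + h} \<longleftrightarrow> x \<in> {p}"
          using a
        proof eventually_elim
          case (elim x)
          have "(x - p) / h = (x - a) / h - (p - a) / h" by (simp add: diff_divide_distrib)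
          then have "(x - p) / h \<in> \<int>" using elim p by simp
          then obtain k :: int where "(x - p) / h = of_int k" by (auto elim: Ints_cases)
          then have k: "x - p = of_int k * h" using h by (simp add: field_simps)
          have "k = 0" if "x \<in> {u n..<u n + h}"
          proof -
            have "\<bar>of_int k * h\<bar> < 1 * h" unfolding k[symmetric] using that pu by auto
            then have "\<bar>of_int k :: real\<bar> < 1" using h by (simp add: abs_mult)
            then show ?thesis by linarith
          qed
          then show ?case using k pu by auto
        qed
      qed auto
      have ns: "0 < sqrt (real n * s\<^sup>2)" "(sqrt (real n * s\<^sup>2))\<^sup>2 = real n * s\<^sup>2" using n s by simp_all
      have i1: "integrable lborel (\<lambda>t. iexp (- (t * p)) * (indicator {-A..A} t * char M t ^ n))"
      proof (rule Bochner_Integration.integrable_bound)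
        show "integrable lborel (indicator {-A..A} :: real \<Rightarrow> real)"
          by (intro integrable_real_indicator) (auto simp: emeasure_lborel_Icc_eq)
        show "AE t in lborel. norm (iexp (- (t * p)) * (indicator {-A..A} t * char M t ^ n)) \<le> norm (indicator {-A..A} t :: real)"
          by (intro AE_I2) (auto simp: norm_mult indicator_def norm_power cmod_char_le_1 power_le_one)
        show "(\<lambda>t. iexp (- (t * p)) * (indicator {-A..A} t * char M t ^ n)) \<in> borel_measurable lborel"
          by (intro borel_measurable_times borel_measurable_power) (auto intro: char_measurable)
      qed
      have g: "integrable lborel (\<lambda>t. exp (- real n * s\<^sup>2 * t\<^sup>2 / 2) :: real)"
        using integrable_gaussian_exp[OF ns(1)] unfolding ns(2) by simp
      have i2: "integrable lborel (\<lambda>t. iexp (- (t * p)) * ?G n t)"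
        by (rule Bochner_Integration.integrable_bound[OF g]) (auto simp: norm_mult)
      have m: "complex_of_real (2 * pi / h * measure (\<nu> n) {p}) = (CLINT t|lborel. iexp (- (t * p)) * (indicator {-A..A} t * char M t ^ n))"
        unfolding measure_lattice_point[OF \<nu>(1) h a p] \<nu>(2) A_def ..
      have f: "complex_of_real (2 * pi * normal_density 0 (sqrt (real n * s\<^sup>2)) p) = (CLINT t|lborel. iexp (- (t * p)) * ?G n t)"
        unfolding of_real_mult normal_density_fourier[OF ns(1)] ns(2) by simp
      have "complex_of_real (2 * pi / h * measure (\<nu> n) {p} - 2 * pi * normal_density 0 (sqrt (real n * s\<^sup>2)) p)
        = (CLINT t|lborel. iexp (- (t * p)) * (indicator {-A..A} t * char M t ^ n) - iexp (- (t * p)) * ?G n t)"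
        unfolding of_real_diff m f by (rule Bochner_Integration.integral_diff[OF i1 i2, symmetric])
      then have "cmod (complex_of_real (2 * pi / h * measure (\<nu> n) {p} - 2 * pi * normal_density 0 (sqrt (real n * s\<^sup>2)) p))
        = cmod (CLINT t|lborel. iexp (- (t * p)) * (indicator {-A..A} t * char M t ^ n) - iexp (- (t * p)) * ?G n t)"
        by (rule arg_cong)
      also have "\<dots> \<le> (LINT t|lborel. cmod (iexp (- (t * p)) * (indicator {-A..A} t * char M t ^ n) - iexp (- (t * p)) * ?G n t))"
        by (rule integral_norm_bound)
      also have "\<dots> = ?L n"
        unfolding right_diff_distrib[symmetric] norm_mult by simp
      finally have d: "\<bar>2 * pi / h * measure (\<nu> n) {p} - 2 * pi * normal_density 0 (sqrt (real n * s\<^sup>2)) p\<bar> \<le> ?L n"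
        by (simp only: norm_of_real)
      have "\<bar>sqrt (real n) * measure (\<nu> n) {p} - h * normal_density 0 s (p / sqrt (real n))\<bar>
        = h / (2 * pi) * sqrt (real n) * \<bar>2 * pi / h * measure (\<nu> n) {p} - 2 * pi * normal_density 0 (sqrt (real n * s\<^sup>2)) p\<bar>"
      proof -
        have "sqrt (real n) * measure (\<nu> n) {p} - h * normal_density 0 s (p / sqrt (real n))
          = h / (2 * pi) * sqrt (real n) * (2 * pi / h * measure (\<nu> n) {p} - 2 * pi * normal_density 0 (sqrt (real n * s\<^sup>2)) p)"
          unfolding normal_density_sqrt_scale[OF s n, symmetric] using h by (simp add: field_simps)
        then show ?thesis using h by (simp add: abs_mult)
      qed
      also have "\<dots> \<le> h / (2 * pi) * sqrt (real n) * ?L n"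
        using h by (intro mult_left_mono d) simp
      finally have d1: "\<bar>sqrt (real n) * measure (\<nu> n) {p} - h * normal_density 0 s (p / sqrt (real n))\<bar> \<le> h / (2 * pi) * (sqrt (real n) * ?L n)"
        by (simp only: mult.assoc)
      have "\<bar>normal_density 0 s (p / sqrt (real n)) - normal_density 0 s (u n / sqrt (real n))\<bar> \<le> \<bar>p / sqrt (real n) - u n / sqrt (real n)\<bar> / s\<^sup>2"
        by (rule normal_density_lipschitz[OF s])
      also have "\<dots> = \<bar>p - u n\<bar> / s\<^sup>2 / sqrt (real n)"
        by (simp add: mult.commute flip: diff_divide_distrib)
      also have "\<dots> \<le> h / s\<^sup>2 / sqrt (real n)"
        using pu by (intro divide_right_mono) auto
      finally have "h * \<bar>normal_density 0 s (p / sqrt (real n)) - normal_density 0 s (u n / sqrt (real n))\<bar> \<le> h * (h / s\<^sup>2 / sqrt (real n))"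
        using h by (intro mult_left_mono) auto
      then have d2: "\<bar>h * normal_density 0 s (p / sqrt (real n)) - h * normal_density 0 s (u n / sqrt (real n))\<bar> \<le> h * (h / s\<^sup>2 / sqrt (real n))"
        using h by (simp add: abs_mult flip: right_diff_distrib)
      show ?thesis
        using d1 d2 unfolding \<open>measure (\<nu> n) {u n..<u n + h} = measure (\<nu> n) {p}\<close> real_norm_def by linarith
    qed
    then show "\<forall>\<^sub>F n in sequentially. norm (sqrt (real n) * measure (\<nu> n) {u n..<u n + h} - h * normal_density 0 s (u n / sqrt (real n)))
       \<le> h / (2 * pi) * (sqrt (real n) * ?L n) + h * (h / s\<^sup>2 / sqrt (real n))"
      unfolding eventually_sequentially by blast
  qed
qed

text \<open>An interval of length k h is cut into k intervals of length h. The positions u may depend on n, so that the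
statement for a single interval also applies to the shifted ones.\<close>

lemma local_limit_lattice:
  assumes M: "real_distribution M" "integrable M (\<lambda>x. x)" "integrable M (\<lambda>x. x\<^sup>2)"
    and "(\<integral>x. x \<partial>M) = 0" and "(\<integral>x. x\<^sup>2 \<partial>M) = s\<^sup>2" and s: "s > 0"
    and h: "h > 0" and eq1: "cmod (char M (2 * pi / h)) = 1"
    and lt1: "\<And>t. 0 < t \<Longrightarrow> t < 2 * pi / h \<Longrightarrow> cmod (char M t) < 1"
    and \<nu>: "\<And>n. real_distribution (\<nu> n)" "\<And>n t. char (\<nu> n) t = char M t ^ n"
  shows "uniform_limit UNIV (\<lambda>n u. sqrt (real n) * measure (\<nu> n) {u..<u + real k * h} - (real k * h) * normal_density 0 s (u / sqrt (real n)))
     (\<lambda>_. 0) sequentially"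
proof (rule uniform_limit_by_sequences)
  fix u :: "nat \<Rightarrow> real"
  show "(\<lambda>n. sqrt (real n) * measure (\<nu> n) {u n..<u n + real k * h} - (real k * h) * normal_density 0 s (u n / sqrt (real n))) \<longlonglongrightarrow> 0"
  proof (induction k)
    case (Suc k)
    let ?v = "\<lambda>n. u n + real k * h"
    have cell: "(\<lambda>n. sqrt (real n) * measure (\<nu> n) {?v n..<?v n + h} - h * normal_density 0 s (?v n / sqrt (real n))) \<longlonglongrightarrow> 0"
      by (rule local_limit_lattice_cell[OF assms])
    have shift: "(\<lambda>n. h * (normal_density 0 s (?v n / sqrt (real n)) - normal_density 0 s (u n / sqrt (real n)))) \<longlonglongrightarrow> 0"
    proof (rule tendsto_mult_right_zero, rule Lim_null_comparison)
      show "(\<lambda>n. real k * h / s\<^sup>2 / sqrt (real n)) \<longlonglongrightarrow> 0"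
        by (intro tendsto_divide_0[OF tendsto_const] filterlim_at_top_imp_at_infinity
              filterlim_compose[OF sqrt_at_top filterlim_real_sequentially])
      have "norm (normal_density 0 s (?v n / sqrt (real n)) - normal_density 0 s (u n / sqrt (real n))) \<le> real k * h / s\<^sup>2 / sqrt (real n)" for n
      proof -
        have "\<bar>normal_density 0 s (?v n / sqrt (real n)) - normal_density 0 s (u n / sqrt (real n))\<bar> \<le> \<bar>?v n / sqrt (real n) - u n / sqrt (real n)\<bar> / s\<^sup>2"
          by (rule normal_density_lipschitz[OF s])
        also have "\<dots> = real k * h / s\<^sup>2 / sqrt (real n)"
          using h by (simp add: mult.commute flip: diff_divide_distrib)
        finally show ?thesis by simp
      qed
      then show "\<forall>\<^sub>F n in sequentially. norm (normal_density 0 s (?v n / sqrt (real n)) - normal_density 0 s (u n / sqrt (real n))) \<le> real k * h / s\<^sup>2 / sqrt (real n)"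
        by simp
    qed
    have split: "measure (\<nu> n) {u n..<u n + real (Suc k) * h} = measure (\<nu> n) {u n..<?v n} + measure (\<nu> n) {?v n..<?v n + h}" for n
    proof -
      interpret real_distribution "\<nu> n" by (rule \<nu>)
      have "{u n..<u n + real (Suc k) * h} = {u n..<?v n} \<union> {?v n..<?v n + h}"
        using h by (subst ivl_disj_un_two(3)) (auto simp: algebra_simps)
      then show ?thesis by (simp add: finite_measure_Union)
    qed
    have "(\<lambda>n. (sqrt (real n) * measure (\<nu> n) {u n..<?v n} - (real k * h) * normal_density 0 s (u n / sqrt (real n))) +
       ((sqrt (real n) * measure (\<nu> n) {?v n..<?v n + h} - h * normal_density 0 s (?v n / sqrt (real n))) +
        h * (normal_density 0 s (?v n / sqrt (real n)) - normal_density 0 s (u n / sqrt (real n))))) \<longlonglongrightarrow> 0 + (0 + 0)"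
      by (intro tendsto_add Suc.IH cell shift)
    then show ?case unfolding split by (simp add: algebra_simps)
  qed simp
qed

text \<open>The frequencies where the modulus is 1 form a closed set, and the Gaussian bound near 0 keeps the positive ones
away from 0. The least of them corresponds to the largest lattice step, so this also shows that the largest
step exists.\<close>

lemma least_char_modulus_1:
  assumes M: "real_distribution M" "integrable M (\<lambda>x. x)" "integrable M (\<lambda>x. x\<^sup>2)"
    and "(\<integral>x. x \<partial>M) = 0" and "(\<integral>x. x\<^sup>2 \<partial>M) = s\<^sup>2" and s: "s > 0"
    and t1: "t1 \<noteq> 0" "cmod (char M t1) = 1"
  obtains t0 where "t0 > 0" "cmod (char M t0) = 1" "\<And>t. 0 < t \<Longrightarrow> t < t0 \<Longrightarrow> cmod (char M t) < 1"
proof -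
  interpret real_distribution M by fact
  obtain d where d: "d > 0" "\<And>t. \<bar>t\<bar> \<le> d \<Longrightarrow> cmod (char M t) \<le> exp (- (s/2)\<^sup>2 * t\<^sup>2 / 2)"
    using char_gaussian_bound_near_0[OF assms(1-6)] by blast
  have near: "cmod (char M t) < 1" if "0 < t" "t \<le> d" for t
  proof -
    have "cmod (char M t) \<le> exp (- (s/2)\<^sup>2 * t\<^sup>2 / 2)" using d(2)[of t] that by simp
    also have "\<dots> < 1" using that s by simp
    finally show ?thesis .
  qed
  define K where "K = {t \<in> {d..\<bar>t1\<bar>}. cmod (char M t) = 1}"
  have c: "cmod (char M \<bar>t1\<bar>) = 1" using t1(2) char_uminus[of M t1] by (cases "t1 \<ge> 0") auto
  then have "\<bar>t1\<bar> \<in> K" using near[of "\<bar>t1\<bar>"] t1(1) unfolding K_def by force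
  moreover have "compact K"
  proof -
    have "closed (K \<inter> {d..\<bar>t1\<bar>})"
      unfolding K_def by (intro continuous_closed_preimage_constant[of "{d..\<bar>t1\<bar>}" "\<lambda>t. cmod (char M t)" 1, THEN closed_Int] continuous_on_norm continuous_at_imp_continuous_on ballI isCont_char) auto
    moreover have "K = {d..\<bar>t1\<bar>} \<inter> (K \<inter> {d..\<bar>t1\<bar>})" by (auto simp: K_def)
    ultimately show ?thesis by (metis compact_Icc compact_Int_closed)
  qed
  ultimately obtain t0 where t0: "t0 \<in> K" "\<And>t. t \<in> K \<Longrightarrow> t0 \<le> t"
    using compact_attains_inf[of K] by blast
  show ?thesis
  proof (rule that)
    show "t0 > 0" "cmod (char M t0) = 1" using t0(1) d by (auto simp: K_def)
    fix t assume t: "0 < t" "t < t0"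
    show "cmod (char M t) < 1"
    proof (cases "t \<le> d")
      case False
      have "t \<notin> K" using t0(2)[of t] t by auto
      then have "cmod (char M t) \<noteq> 1" using False t t0(1) by (auto simp: K_def)
      then show ?thesis using cmod_char_le_1[of t] by simp
    qed (use near t in auto)
  qed
qed

section \<open>Adding an independent summand\<close>

text \<open>Hypotheses that start at n = 1 become hypotheses about all indices after a shift.\<close>

lemma weak_conv_m_Suc: "weak_conv_m (\<lambda>n. X (Suc n)) L \<longleftrightarrow> weak_conv_m X L"
  unfolding weak_conv_m_def weak_conv_def
  by (simp only: filterlim_sequentially_Suc[of "\<lambda>n. cdf (X n) x" for x])

lemma (in prob_space) char_distr_diff_bound:
  assumes "integrable M X" "integrable M Y"
  shows "cmod (char (distr M borel X) t - char (distr M borel Y) t) \<le> \<bar>t\<bar> * expectation (\<lambda>\<omega>. \<bar>X \<omega> - Y \<omega>\<bar>)"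
proof -
  have [measurable]: "X \<in> borel_measurable M" "Y \<in> borel_measurable M" using assms by auto
  have i: "integrable M (\<lambda>\<omega>. iexp (t * X \<omega>))" "integrable M (\<lambda>\<omega>. iexp (t * Y \<omega>))"
    by (auto intro!: integrable_const_bound[where B=1])
  have "char (distr M borel X) t - char (distr M borel Y) t = (CLINT \<omega>|M. iexp (t * X \<omega>) - iexp (t * Y \<omega>))"
    unfolding char_def using i by (simp add: integral_distr)
  also have "cmod \<dots> \<le> (LINT \<omega>|M. cmod (iexp (t * X \<omega>) - iexp (t * Y \<omega>)))" by (rule integral_norm_bound)
  also have "\<dots> \<le> (LINT \<omega>|M. \<bar>t\<bar> * \<bar>X \<omega> - Y \<omega>\<bar>)"
  proof (rule integral_mono)
    show "integrable M (\<lambda>\<omega>. cmod (iexp (t * X \<omega>) - iexp (t * Y \<omega>)))"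
      by (intro integrable_norm Bochner_Integration.integrable_diff i)
    show "integrable M (\<lambda>\<omega>. \<bar>t\<bar> * \<bar>X \<omega> - Y \<omega>\<bar>)"
      using assms by (intro integrable_mult_right integrable_abs Bochner_Integration.integrable_diff)
    fix \<omega>
    have "iexp (t * X \<omega>) - iexp (t * Y \<omega>) = iexp (t * Y \<omega>) * (iexp (t * (X \<omega> - Y \<omega>)) - 1)"
      by (simp add: right_diff_distrib exp_add[symmetric] algebra_simps)
    then have "cmod (iexp (t * X \<omega>) - iexp (t * Y \<omega>)) = cmod (iexp (t * (X \<omega> - Y \<omega>)) - 1)"
      by (simp only: norm_mult norm_exp_i_times mult_1_left)
    also have "\<dots> \<le> \<bar>t * (X \<omega> - Y \<omega>)\<bar>" using iexp_approx1[of "t * (X \<omega> - Y \<omega>)" 0] by simp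
    finally show "cmod (iexp (t * X \<omega>) - iexp (t * Y \<omega>)) \<le> \<bar>t\<bar> * \<bar>X \<omega> - Y \<omega>\<bar>" by (simp add: abs_mult)
  qed
  finally show ?thesis by simp
qed

lemma (in prob_space) indep_var_expectation_iterated:
  fixes f :: "real \<times> real \<Rightarrow> real"
  assumes ind: "indep_var borel Y borel S" and [measurable]: "f \<in> borel_measurable (borel \<Otimes>\<^sub>M borel)"
    and B: "\<And>p. \<bar>f p\<bar> \<le> B"
  shows "expectation (\<lambda>\<omega>. f (Y \<omega>, S \<omega>)) = (\<integral>y. (\<integral>s. f (y, s) \<partial>distr M borel S) \<partial>distr M borel Y)"
    and "integrable (distr M borel Y) (\<lambda>y. \<integral>s. f (y, s) \<partial>distr M borel S)"
proof -
  have [measurable]: "Y \<in> borel_measurable M" "S \<in> borel_measurable M"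
    using indep_var_rv1[OF ind] indep_var_rv2[OF ind] by auto
  interpret Y: prob_space "distr M borel Y" by (rule prob_space_distr) simp
  interpret S: prob_space "distr M borel S" by (rule prob_space_distr) simp
  interpret P: pair_prob_space "distr M borel Y" "distr M borel S" ..
  have int: "integrable (distr M borel Y \<Otimes>\<^sub>M distr M borel S) f"
    by (rule P.integrable_const_bound[where B=B]) (use B in auto)
  have "expectation (\<lambda>\<omega>. f (Y \<omega>, S \<omega>)) = (\<integral>p. f p \<partial>distr M (borel \<Otimes>\<^sub>M borel) (\<lambda>\<omega>. (Y \<omega>, S \<omega>)))"
    by (subst integral_distr) auto
  also have "\<dots> = (\<integral>p. f p \<partial>(distr M borel Y \<Otimes>\<^sub>M distr M borel S))"
    using ind by (simp add: indep_var_distribution_eq)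
  also have "\<dots> = (\<integral>y. (\<integral>s. f (y, s) \<partial>distr M borel S) \<partial>distr M borel Y)"
    by (rule P.integral_fst'[OF int, symmetric])
  finally show "expectation (\<lambda>\<omega>. f (Y \<omega>, S \<omega>)) = (\<integral>y. (\<integral>s. f (y, s) \<partial>distr M borel S) \<partial>distr M borel Y)" .
  show "integrable (distr M borel Y) (\<lambda>y. \<integral>s. f (y, s) \<partial>distr M borel S)"
    by (rule P.integrable_fst'[OF int])
qed

text \<open>Given Y = y, the event is that S lies in an interval of length b at u - y. An approximation of such probabilities
that is uniform in the position survives integration over y. In the application q is \<surd>n, and a and y0 are
the means of S and Y.\<close>

lemma (in prob_space) interval_prob_indep_sum:
  assumes ind: "indep_var borel Y borel S" and q: "q > 0" and s: "s > 0"
    and loc: "\<And>v. \<bar>q * measure (distr M borel S) {v..<v + b} - b * normal_density 0 s ((v - a) / q)\<bar> \<le> e"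
  shows "\<bar>q * prob {\<omega> \<in> space M. Y \<omega> + S \<omega> \<in> {u..<u + b}}
      - b * (\<integral>y. normal_density 0 s ((u - (y0 + a)) / q - y) \<partial>distr M borel (\<lambda>\<omega>. (Y \<omega> - y0) / q))\<bar> \<le> e"
proof -
  have [measurable]: "Y \<in> borel_measurable M" "S \<in> borel_measurable M"
    using indep_var_rv1[OF ind] indep_var_rv2[OF ind] by auto
  interpret Y: prob_space "distr M borel Y" by (rule prob_space_distr) simp
  interpret S: prob_space "distr M borel S" by (rule prob_space_distr) simp
  let ?f = "\<lambda>p. indicator {u..<u + b} (fst p + snd p) :: real"
  let ?m = "\<lambda>y. measure (distr M borel S) {u - y..<u - y + b}"
  let ?g = "\<lambda>y. normal_density 0 s ((u - y - a) / q)"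
  have f: "(\<lambda>y. \<integral>s. ?f (y, s) \<partial>distr M borel S) = ?m"
  proof
    fix y
    have "(\<integral>s. ?f (y, s) \<partial>distr M borel S) = (\<integral>s. indicator {u - y..<u - y + b} s \<partial>distr M borel S)"
      by (intro Bochner_Integration.integral_cong refl) (auto simp: indicator_def)
    then show "(\<integral>s. ?f (y, s) \<partial>distr M borel S) = ?m y" by simp
  qed
  have fB: "\<bar>?f p\<bar> \<le> 1" for p by (simp add: indicator_def)
  have fM: "?f \<in> borel_measurable (borel \<Otimes>\<^sub>M borel)" by measurable
  have "prob {\<omega> \<in> space M. Y \<omega> + S \<omega> \<in> {u..<u + b}} = expectation (\<lambda>\<omega>. ?f (Y \<omega>, S \<omega>))"
  proof -
    have "prob {\<omega> \<in> space M. Y \<omega> + S \<omega> \<in> {u..<u + b}} = expectation (indicator {\<omega> \<in> space M. Y \<omega> + S \<omega> \<in> {u..<u + b}})"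
      by simp
    also have "\<dots> = expectation (\<lambda>\<omega>. ?f (Y \<omega>, S \<omega>))"
      by (intro Bochner_Integration.integral_cong refl) (auto simp: indicator_def)
    finally show ?thesis .
  qed
  also have "\<dots> = (\<integral>y. ?m y \<partial>distr M borel Y)"
    using indep_var_expectation_iterated(1)[OF ind fM fB] unfolding f .
  finally have p: "prob {\<omega> \<in> space M. Y \<omega> + S \<omega> \<in> {u..<u + b}} = (\<integral>y. ?m y \<partial>distr M borel Y)" .
  have mi: "integrable (distr M borel Y) ?m"
    using indep_var_expectation_iterated(2)[OF ind fM fB] unfolding f .
  have gi: "integrable (distr M borel Y) ?g"
    by (rule Y.integrable_const_bound[where B="1 / s"]) (use normal_density_le[OF s] in auto)
  have g: "(\<integral>y. normal_density 0 s ((u - (y0 + a)) / q - y) \<partial>distr M borel (\<lambda>\<omega>. (Y \<omega> - y0) / q)) = (\<integral>y. ?g y \<partial>distr M borel Y)"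
    using q by (simp add: integral_distr flip: diff_divide_distrib) (simp add: algebra_simps)
  have "q * (\<integral>y. ?m y \<partial>distr M borel Y) - b * (\<integral>y. ?g y \<partial>distr M borel Y) = (\<integral>y. q * ?m y - b * ?g y \<partial>distr M borel Y)"
    using mi gi by simp
  then have "\<bar>q * (\<integral>y. ?m y \<partial>distr M borel Y) - b * (\<integral>y. ?g y \<partial>distr M borel Y)\<bar> = \<bar>\<integral>y. q * ?m y - b * ?g y \<partial>distr M borel Y\<bar>"
    by (rule arg_cong)
  also have "\<dots> \<le> (\<integral>y. \<bar>q * ?m y - b * ?g y\<bar> \<partial>distr M borel Y)" by (rule integral_abs_bound)
  also have "\<dots> \<le> (\<integral>y. e \<partial>distr M borel Y)"
  proof (rule integral_mono)
    show "integrable (distr M borel Y) (\<lambda>y. \<bar>q * ?m y - b * ?g y\<bar>)"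
      using mi gi by (intro integrable_abs Bochner_Integration.integrable_diff integrable_mult_right)
    show "\<bar>q * ?m y - b * ?g y\<bar> \<le> e" for y using loc[of "u - y"] .
  qed simp
  also have "\<dots> = e" by (simp add: Y.prob_space[simplified])
  finally show ?thesis unfolding p g .
qed

text \<open>In the application z and p are probabilities for Z and for Y + S, the centers m' and m are their means, and q
is \<surd>n. The bound does not involve u, as the normal density is bounded, Lipschitz,
and insensitive to a change of scale.\<close>

lemma local_limit_perturbation:
  fixes \<sigma> b q c e u :: real
  assumes pos: "\<sigma> > 0" "b > 0" "q > 0" "c > 0" and r: "c / q \<le> 2"
    and z: "\<bar>z - p\<bar> \<le> d" and m: "\<bar>m' - m\<bar> \<le> k"
    and p: "\<bar>q * p - b * normal_density 0 \<sigma> ((u - m) / q)\<bar> \<le> e"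
  shows "\<bar>c * z - inverse \<sigma> * b * std_normal_density ((u - m') / (c * \<sigma>))\<bar>
     \<le> 2 * (q * d + e) + b / \<sigma> * \<bar>c / q - 1\<bar> + b / \<sigma> * (2 * \<bar>q / c - 1\<bar> + k / q / \<sigma>)"
proof -
  let ?r = "c / q" and ?w = "(u - m') / (q * \<sigma>)" and ?x = "(u - m) / q"
  have r0: "0 < ?r" using pos by simp
  have rh: "1 / 2 \<le> q / c" using r pos by (simp add: field_simps)
  let ?n = "normal_density 0 \<sigma> ?x"
  have n: "0 \<le> ?n" "?n \<le> 1 / \<sigma>" using normal_density_le[OF pos(1)] by auto
  have "\<bar>q * z - b * ?n\<bar> \<le> q * d + e"
  proof -
    have "\<bar>q * z - q * p\<bar> \<le> q * d" using z pos by (simp add: abs_mult flip: right_diff_distrib)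
    with p show ?thesis by linarith
  qed
  then have "\<bar>?r * (q * z - b * ?n)\<bar> \<le> 2 * (q * d + e)"
    unfolding abs_mult using r r0 by (intro mult_mono) auto
  moreover have "\<bar>(?r - 1) * (b * ?n)\<bar> \<le> b / \<sigma> * \<bar>?r - 1\<bar>"
  proof -
    have "b * ?n \<le> b * (1 / \<sigma>)" using n pos by (intro mult_left_mono) auto
    then have "\<bar>?r - 1\<bar> * (b * ?n) \<le> \<bar>?r - 1\<bar> * (b * (1 / \<sigma>))" by (rule mult_left_mono) simp
    then show ?thesis using n pos by (simp add: abs_mult mult.commute)
  qed
  moreover have "c * z - b * ?n = ?r * (q * z - b * ?n) + (?r - 1) * (b * ?n)"
    using pos by (simp add: field_simps)
  ultimately have 1: "\<bar>c * z - b * ?n\<bar> \<le> 2 * (q * d + e) + b / \<sigma> * \<bar>?r - 1\<bar>"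
    by (simp only:) (rule order_trans[OF abs_triangle_ineq add_mono])
  have a: "\<bar>std_normal_density ?w - std_normal_density (?x / \<sigma>)\<bar> \<le> k / q / \<sigma>"
  proof -
    have "\<bar>std_normal_density ?w - std_normal_density (?x / \<sigma>)\<bar> \<le> \<bar>?w - ?x / \<sigma>\<bar>"
      by (rule std_normal_density_lipschitz)
    also have "\<dots> = \<bar>m' - m\<bar> / q / \<sigma>"
      using pos by (simp add: abs_minus_commute flip: diff_divide_distrib)
    also have "\<dots> \<le> k / q / \<sigma>" using m pos by (intro divide_right_mono) auto
    finally show ?thesis .
  qed
  have "\<bar>std_normal_density (q / c * ?w) - std_normal_density ?w\<bar> \<le> 2 * \<bar>q / c - 1\<bar>"
    by (rule std_normal_density_scaling[OF rh])
  moreover have "q / c * ?w = (u - m') / (c * \<sigma>)" using pos by simp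
  ultimately have "\<bar>std_normal_density (?x / \<sigma>) - std_normal_density ((u - m') / (c * \<sigma>))\<bar> \<le> 2 * \<bar>q / c - 1\<bar> + k / q / \<sigma>"
    using a by (simp only:)
  then have "b / \<sigma> * \<bar>std_normal_density (?x / \<sigma>) - std_normal_density ((u - m') / (c * \<sigma>))\<bar> \<le> b / \<sigma> * (2 * \<bar>q / c - 1\<bar> + k / q / \<sigma>)"
    using pos by (intro mult_left_mono) auto
  moreover have "b * ?n - inverse \<sigma> * b * std_normal_density ((u - m') / (c * \<sigma>)) = b / \<sigma> * (std_normal_density (?x / \<sigma>) - std_normal_density ((u - m') / (c * \<sigma>)))"
    unfolding normal_density_scale[OF pos(1)] using pos by (simp add: field_simps)
  ultimately have "\<bar>b * ?n - inverse \<sigma> * b * std_normal_density ((u - m') / (c * \<sigma>))\<bar> \<le> b / \<sigma> * (2 * \<bar>q / c - 1\<bar> + k / q / \<sigma>)"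
    using pos by (simp only: abs_mult) simp
  with 1 show ?thesis by linarith
qed

text \<open>The bound is also what keeps the suprema meaningful: a supremum of an unbounded set of reals has no intended
value.\<close>

lemma tendsto_SUP_abs_zeroI:
  fixes f :: "nat \<Rightarrow> 'a \<Rightarrow> real"
  assumes "\<And>e. e > 0 \<Longrightarrow> \<forall>\<^sub>F n in sequentially. \<forall>u. \<bar>f n u\<bar> \<le> e"
  shows "(\<lambda>n. SUP u. \<bar>f n u\<bar>) \<longlonglongrightarrow> 0"
proof (rule tendstoI)
  fix e :: real assume e: "e > 0"
  have "\<forall>\<^sub>F n in sequentially. \<forall>u. \<bar>f n u\<bar> \<le> e / 2" using assms[of "e / 2"] e by simp
  then show "\<forall>\<^sub>F n in sequentially. dist (SUP u. \<bar>f n u\<bar>) 0 < e"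
  proof eventually_elim
    case (elim n)
    have "(SUP u. \<bar>f n u\<bar>) \<le> e / 2" by (rule cSUP_least) (use elim in auto)
    moreover have "0 \<le> (SUP u. \<bar>f n u\<bar>)"
      by (rule cSUP_upper2[where x=undefined]) (use elim in \<open>auto intro!: bdd_aboveI2[where M="e / 2"]\<close>)
    ultimately show ?case using e by simp
  qed
qed

text \<open>The factor 2 accounts for the difference of the means, which is at most the mean of the difference.\<close>

lemma (in prob_space) char_standardized_diff_bound:
  assumes X: "integrable M X" and Y: "integrable M Y" and q: "q > 0"
  shows "cmod (char (distr M borel (\<lambda>\<omega>. (X \<omega> - expectation X) / q)) t - char (distr M borel (\<lambda>\<omega>. (Y \<omega> - expectation Y) / q)) t)
     \<le> \<bar>t\<bar> * (2 * (expectation (\<lambda>\<omega>. \<bar>X \<omega> - Y \<omega>\<bar>) / q))"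
proof -
  have i: "integrable M (\<lambda>\<omega>. \<bar>X \<omega> - Y \<omega>\<bar>)" using X Y by simp
  have "cmod (char (distr M borel (\<lambda>\<omega>. (X \<omega> - expectation X) / q)) t - char (distr M borel (\<lambda>\<omega>. (Y \<omega> - expectation Y) / q)) t)
    \<le> \<bar>t\<bar> * expectation (\<lambda>\<omega>. \<bar>(X \<omega> - expectation X) / q - (Y \<omega> - expectation Y) / q\<bar>)"
    using X Y by (intro char_distr_diff_bound) simp_all
  also have "\<dots> \<le> \<bar>t\<bar> * (2 * (expectation (\<lambda>\<omega>. \<bar>X \<omega> - Y \<omega>\<bar>) / q))"
  proof (rule mult_left_mono)
    have "expectation (\<lambda>\<omega>. \<bar>(X \<omega> - expectation X) / q - (Y \<omega> - expectation Y) / q\<bar>)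
        \<le> expectation (\<lambda>\<omega>. (\<bar>X \<omega> - Y \<omega>\<bar> + expectation (\<lambda>\<omega>. \<bar>X \<omega> - Y \<omega>\<bar>)) / q)"
    proof (rule integral_mono)
      show "integrable M (\<lambda>\<omega>. (\<bar>X \<omega> - Y \<omega>\<bar> + expectation (\<lambda>\<omega>. \<bar>X \<omega> - Y \<omega>\<bar>)) / q)" using i by simp
      fix \<omega>
      have "\<bar>expectation X - expectation Y\<bar> \<le> expectation (\<lambda>\<omega>. \<bar>X \<omega> - Y \<omega>\<bar>)"
        using integral_abs_bound[of M "\<lambda>\<omega>. X \<omega> - Y \<omega>"] X Y by simp
      then have "\<bar>(X \<omega> - expectation X) - (Y \<omega> - expectation Y)\<bar> / q \<le> (\<bar>X \<omega> - Y \<omega>\<bar> + expectation (\<lambda>\<omega>. \<bar>X \<omega> - Y \<omega>\<bar>)) / q"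
        using q by (intro divide_right_mono) auto
      then show "\<bar>(X \<omega> - expectation X) / q - (Y \<omega> - expectation Y) / q\<bar> \<le> (\<bar>X \<omega> - Y \<omega>\<bar> + expectation (\<lambda>\<omega>. \<bar>X \<omega> - Y \<omega>\<bar>)) / q"
        using q by (simp flip: diff_divide_distrib)
    qed (use X Y in simp)
    also have "\<dots> = 2 * (expectation (\<lambda>\<omega>. \<bar>X \<omega> - Y \<omega>\<bar>) / q)"
      using i by (simp add: prob_space)
    finally show "expectation (\<lambda>\<omega>. \<bar>(X \<omega> - expectation X) / q - (Y \<omega> - expectation Y) / q\<bar>)
        \<le> 2 * (expectation (\<lambda>\<omega>. \<bar>X \<omega> - Y \<omega>\<bar>) / q)" .
  qed simp
  finally show ?thesis .
qed

section \<open>Sums of independent identically distributed summands\<close>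

lemma (in prob_space) char_centered_iid_sum:
  fixes V :: "nat \<Rightarrow> 'a \<Rightarrow> real"
  assumes ind: "indep_vars (\<lambda>_. borel) V UNIV" and iid: "\<And>j. distr M borel (V j) = distr M borel (V 0)"
  shows "char (distr M borel (\<lambda>\<omega>. \<Sum>j=1..n. (V j \<omega> - m))) t = char (distr M borel (\<lambda>\<omega>. V 0 \<omega> - m)) t ^ n"
proof -
  have [measurable]: "V j \<in> borel_measurable M" for j using ind by (simp add: indep_vars_def2)
  have "indep_vars (\<lambda>_. borel) (\<lambda>j \<omega>. V j \<omega> - m) UNIV"
    by (rule indep_vars_compose2[OF ind]) simp
  then have "indep_vars (\<lambda>_. borel) (\<lambda>j \<omega>. V j \<omega> - m) {1..n}"
    by (rule indep_vars_subset) simp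
  from char_distr_sum[OF this]
  have "char (distr M borel (\<lambda>\<omega>. \<Sum>j=1..n. (V j \<omega> - m))) t = (\<Prod>j=1..n. char (distr M borel (\<lambda>\<omega>. V j \<omega> - m)) t)" .
  moreover
  have "distr M borel (\<lambda>\<omega>. V j \<omega> - m) = distr M borel (\<lambda>\<omega>. V 0 \<omega> - m)" for j
  proof -
    have "distr M borel (\<lambda>\<omega>. V i \<omega> - m) = distr (distr M borel (V i)) borel (\<lambda>x. x - m)" for i
      by (subst distr_distr) (auto simp: comp_def)
    then show ?thesis using iid[of j] by simp
  qed
  then have "(\<Prod>j=1..n. char (distr M borel (\<lambda>\<omega>. V j \<omega> - m)) t) = (\<Prod>j=1..n. char (distr M borel (\<lambda>\<omega>. V 0 \<omega> - m)) t)"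
    by (metis (no_types))
  ultimately show ?thesis by simp
qed

text \<open>Translation changes a characteristic function by a factor of modulus 1, so the centered law may be used to
detect lattice steps.\<close>

lemma (in prob_space) lattice_with_step_iff_char:
  assumes [measurable]: "X \<in> borel_measurable M"
  shows "lattice_with_step M X h \<longleftrightarrow> 0 < h \<and> cmod (char (distr M borel (\<lambda>\<omega>. X \<omega> - m)) (2 * pi / h)) = 1"
proof (cases "h > 0")
  case True
  have R: "real_distribution (distr M borel (\<lambda>\<omega>. X \<omega> - m))" by (rule real_distribution_distr) simp
  have nz: "2 * pi / h \<noteq> 0" and hh: "2 * pi / (2 * pi / h) = h" using True by simp_all
  have "cmod (char (distr M borel (\<lambda>\<omega>. X \<omega> - m)) (2 * pi / h)) = 1 \<longleftrightarrow> (\<exists>a. AE \<omega> in M. (X \<omega> - m - a) / h \<in> \<int>)"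
    unfolding cmod_char_eq_1_iff_lattice[OF R nz] hh
  proof (intro ex_cong1 AE_distr_iff)
    fix a
    have "(\<lambda>x::real. (x - a) / h) -` \<int> \<inter> space borel \<in> sets borel"
      by (rule measurable_sets[where A=borel]) (auto intro: borel_closed closed_Ints)
    then show "{x \<in> space borel. (x - a) / h \<in> \<int>} \<in> sets borel" by (simp add: vimage_def)
  qed simp
  also have "\<dots> \<longleftrightarrow> (\<exists>a. AE \<omega> in M. (X \<omega> - a) / h \<in> \<int>)"
  proof
    assume "\<exists>a. AE \<omega> in M. (X \<omega> - m - a) / h \<in> \<int>"
    then obtain a where "AE \<omega> in M. (X \<omega> - m - a) / h \<in> \<int>" ..
    then have "AE \<omega> in M. (X \<omega> - (m + a)) / h \<in> \<int>" by (simp add: diff_diff_eq)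
    then show "\<exists>a. AE \<omega> in M. (X \<omega> - a) / h \<in> \<int>" ..
  next
    assume "\<exists>a. AE \<omega> in M. (X \<omega> - a) / h \<in> \<int>"
    then obtain a where "AE \<omega> in M. (X \<omega> - a) / h \<in> \<int>" ..
    then have "AE \<omega> in M. (X \<omega> - m - (a - m)) / h \<in> \<int>" by simp
    then show "\<exists>a. AE \<omega> in M. (X \<omega> - m - a) / h \<in> \<int>" ..
  qed
  finally show ?thesis using True unfolding lattice_with_step_def by simp
qed (simp add: lattice_with_step_def)

text \<open>This translates the arithmetic condition on the span into the two situations covered by the local limit
theorems. In the lattice case the largest step is 2 \<pi> divided by the least positive frequency where the modulus of
the characteristic function is 1.\<close>

lemma (in prob_space) span_dvd_char_cases:
  fixes X :: "'a \<Rightarrow> real"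
  defines "L \<equiv> distr M borel (\<lambda>\<omega>. X \<omega> - expectation X)"
  assumes X: "integrable M X" and L: "integrable L (\<lambda>x. x\<^sup>2)" "(\<integral>x. x\<^sup>2 \<partial>L) = s\<^sup>2" and s: "s > 0"
    and b: "b > 0" "span_dvd (rv_span M X) b"
  obtains (nonlattice) "\<And>t. t \<noteq> 0 \<Longrightarrow> cmod (char L t) < 1"
  | (lattice) h k where "h > 0" "b = real k * h" "cmod (char L (2 * pi / h)) = 1"
      "\<And>t. 0 < t \<Longrightarrow> t < 2 * pi / h \<Longrightarrow> cmod (char L t) < 1"
proof -
  have [measurable]: "X \<in> borel_measurable M" using X by simp
  have R: "real_distribution L" unfolding L_def by (rule real_distribution_distr) simp
  interpret L: real_distribution L by (rule R)
  have L1: "integrable L (\<lambda>x. x)" "(\<integral>x. x \<partial>L) = 0"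
    unfolding L_def using X by (simp_all add: integrable_distr_eq integral_distr prob_space)
  have nd: "\<not> degenerate_rv M X" using b(2) by (auto simp: span_dvd_def rv_span_def)
  note step = lattice_with_step_iff_char[of X _ "expectation X", folded L_def]
  show ?thesis
  proof (cases "\<exists>t. t \<noteq> 0 \<and> cmod (char L t) = 1")
    case False
    show ?thesis
    proof (rule nonlattice)
      fix t :: real assume "t \<noteq> 0"
      then show "cmod (char L t) < 1" using False L.cmod_char_le_1[of t] by (auto simp: less_le)
    qed
  next
    case True
    then obtain t1 where t1: "t1 \<noteq> 0" "cmod (char L t1) = 1" by blast
    obtain t0 where t0: "t0 > 0" "cmod (char L t0) = 1" "\<And>t. 0 < t \<Longrightarrow> t < t0 \<Longrightarrow> cmod (char L t) < 1"
      using least_char_modulus_1[OF R L1(1) L(1) L1(2) L(2) s t1] by blast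
    define h where "h = 2 * pi / t0"
    have h: "h > 0" "2 * pi / h = t0" using t0 by (simp_all add: h_def)
    have hstep: "lattice_with_step M X h" using h t0 by (simp add: step)
    have "(GREATEST h. lattice_with_step M X h) = h"
    proof (rule Greatest_equality[where P="lattice_with_step M X", OF hstep])
      fix h' assume "lattice_with_step M X h'"
      then have h': "h' > 0" "cmod (char L (2 * pi / h')) = 1" by (simp_all add: step)
      then have "\<not> 2 * pi / h' < t0" using t0(3)[of "2 * pi / h'"] by auto
      then show "h' \<le> h" using h' t0 by (simp add: h_def field_simps)
    qed
    then have "rv_span M X = ennreal h"
      using nd hstep by (auto simp: rv_span_def lattice_rv_def)
    then obtain k :: int where k: "b = of_int k * h"
      using b(2) h(1) by (auto simp: span_dvd_def)
    then have "0 < of_int k * h" using b by simp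
    then have "k > 0" using h(1) by (simp add: zero_less_mult_iff)
    then have "b = real (nat k) * h" using k by simp
    from lattice[OF h(1) this] show ?thesis using h t0 by simp
  qed
qed

lemma (in prob_space) local_limit_iid_sum:
  fixes V :: "nat \<Rightarrow> 'a \<Rightarrow> real"
  defines "L \<equiv> distr M borel (\<lambda>\<omega>. V 0 \<omega> - expectation (V 0))"
    and "\<nu> \<equiv> \<lambda>n. distr M borel (\<lambda>\<omega>. \<Sum>j=1..n. (V j \<omega> - expectation (V 0)))"
  assumes ind: "indep_vars (\<lambda>_. borel) V UNIV" and iid: "\<And>j. distr M borel (V j) = distr M borel (V 0)"
    and X: "integrable M (V 0)" and L: "integrable L (\<lambda>x. x\<^sup>2)" "(\<integral>x. x\<^sup>2 \<partial>L) = s\<^sup>2" and s: "s > 0"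
    and b: "b > 0" "span_dvd (rv_span M (V 0)) b"
  shows "uniform_limit UNIV (\<lambda>n u. sqrt (real n) * measure (\<nu> n) {u..<u + b} - b * normal_density 0 s (u / sqrt (real n)))
     (\<lambda>_. 0) sequentially"
proof -
  have [measurable]: "V j \<in> borel_measurable M" for j using ind by (simp add: indep_vars_def2)
  have R: "real_distribution L" unfolding L_def by (rule real_distribution_distr) simp
  have L1: "integrable L (\<lambda>x. x)" "(\<integral>x. x \<partial>L) = 0"
    unfolding L_def using X by (simp_all add: integrable_distr_eq integral_distr prob_space)
  have \<nu>: "real_distribution (\<nu> n)" "char (\<nu> n) t = char L t ^ n" for n t
    unfolding \<nu>_def L_def by (rule real_distribution_distr, simp, rule char_centered_iid_sum[OF ind iid])
  show ?thesis
  proof (rule span_dvd_char_cases[OF X, folded L_def, OF L s b])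
    assume nonlattice: "\<And>t. t \<noteq> 0 \<Longrightarrow> cmod (char L t) < 1"
    show ?thesis by (rule local_limit_nonlattice[OF R L1(1) L(1) L1(2) L(2) s nonlattice \<nu> b(1)])
  next
    fix h k
    assume lattice: "h > 0" "b = real k * h" "cmod (char L (2 * pi / h)) = 1"
      "\<And>t. 0 < t \<Longrightarrow> t < 2 * pi / h \<Longrightarrow> cmod (char L t) < 1"
    show ?thesis unfolding lattice(2)
      by (rule local_limit_lattice[OF R L1(1) L(1) L1(2) L(2) s lattice(1,3,4) \<nu>])
  qed
qed

section \<open>The local limit theorem and the law of the independent summand\<close>

theorem theorem2p1:
  fixes M :: "'a measure" and V :: "nat \<Rightarrow> 'a \<Rightarrow> real"
    and N :: "nat \<Rightarrow> 'b measure" and Y S Z :: "nat \<Rightarrow> 'b \<Rightarrow> real"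
    and \<sigma> :: real
  (* V 0 is the generic variable V; V 1, V 2, ... are V_1, V_2, ... *)
  assumes "prob_space M"
    and "prob_space.indep_vars M (\<lambda>_. borel) V UNIV"
    and "\<And>j. distr M borel (V j) = distr M borel (V 0)"
    and "\<And>n. n \<ge> 1 \<Longrightarrow> prob_space (N n)"
    and "\<And>n. n \<ge> 1 \<Longrightarrow> integrable (N n) (Y n)"
    and "\<And>n. n \<ge> 1 \<Longrightarrow> integrable (N n) (S n)"
    and "\<And>n. n \<ge> 1 \<Longrightarrow> integrable (N n) (Z n)"
    and "\<And>n. n \<ge> 1 \<Longrightarrow> prob_space.indep_var (N n) borel (Y n) borel (S n)"
    and "\<And>n. n \<ge> 1 \<Longrightarrow>
          distr (N n) borel (S n) = distr M borel (\<lambda>\<omega>. \<Sum>j=1..n. V j \<omega>)"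
    and "(\<lambda>n. prob_space.expectation (N n) (\<lambda>\<omega>. \<bar>Z n \<omega> - (Y n \<omega> + S n \<omega>)\<bar>) / sqrt (real n))
          \<longlonglongrightarrow> 0"
    and "(\<lambda>n. sqrt (real n) * \<P>(\<omega> in N n. Z n \<omega> \<noteq> Y n \<omega> + S n \<omega>)) \<longlonglongrightarrow> 0"
    and "\<sigma> \<ge> 0"
    and "weak_conv_m
           (\<lambda>n. distr (N n) borel
              (\<lambda>\<omega>. (Z n \<omega> - prob_space.expectation (N n) (Z n)) / sqrt (real n)))
           (centered_normal (\<sigma>\<^sup>2))"
  shows "(integrable M (\<lambda>\<omega>. (V 0 \<omega>)\<^sup>2) \<and> prob_space.variance M (V 0) \<le> \<sigma>\<^sup>2) \<and>
    (\<forall>(b::real) (c::nat \<Rightarrow> real).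
       b > 0 \<longrightarrow> (\<forall>n\<ge>1. c n > 0) \<longrightarrow> span_dvd (rv_span M (V 0)) b \<longrightarrow>
       (\<lambda>n. c n / sqrt (real n)) \<longlonglongrightarrow> 1 \<longrightarrow>
       (\<lambda>n. SUP u::real.
          \<bar>c n * \<P>(\<omega> in N n. Z n \<omega> \<in> {u..<u + b})
           - inverse \<sigma> * b
             * std_normal_density ((u - prob_space.expectation (N n) (Z n)) / (c n * \<sigma>))\<bar>)
         \<longlonglongrightarrow> 0) \<and>
    weak_conv_m
      (\<lambda>n. distr (N n) borel
         (\<lambda>\<omega>. (Y n \<omega> - prob_space.expectation (N n) (Y n)) / sqrt (real n)))
      (centered_normal (\<sigma>\<^sup>2 - prob_space.variance M (V 0)))"
proof -
  note V_indep = assms(2) and V_iid = assms(3) and YS_indep = assms(8) and S_law = assms(9)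
    and Z_approx = assms(10) and Z_neq = assms(11) and Z_clt = assms(13)
  interpret M: prob_space M by fact
  have N: "prob_space (N n)" if "n \<ge> 1" for n using assms(4) that by simp
  have Yi: "integrable (N n) (Y n)" and Si: "integrable (N n) (S n)" and Zi: "integrable (N n) (Z n)" if "n \<ge> 1" for n
    using assms(5-7) that by simp_all
  have V_meas [measurable]: "V j \<in> borel_measurable M" for j
    using V_indep by (simp add: M.indep_vars_def2)
  define m where "m = M.expectation (V 0)"
  define L where "L = distr M borel (\<lambda>\<omega>. V 0 \<omega> - m)"
  define \<nu> where "\<nu> n = distr M borel (\<lambda>\<omega>. \<Sum>j=1..n. (V j \<omega> - m))" for n
  define q where "q n = sqrt (real n)" for n
  define EY where "EY n = (\<integral>\<omega>. Y n \<omega> \<partial>N n)" for n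
  define EZ where "EZ n = (\<integral>\<omega>. Z n \<omega> \<partial>N n)" for n
  define EW where "EW n = EY n + real n * m" for n
  define \<delta> where "\<delta> n = (\<integral>\<omega>. \<bar>Z n \<omega> - (Y n \<omega> + S n \<omega>)\<bar> \<partial>N n)" for n
  have q: "q n > 0" if "n \<ge> 1" for n using that by (simp add: q_def)

  \<comment> \<open>The law of a single summand is that of S 1, which is where the integrability of V comes from.\<close>
  have V_int: "integrable M (V j)" for j
  proof -
    have "integrable (distr (N 1) borel (S 1)) (\<lambda>x. x)"
      using Si[of 1] by (subst integrable_distr_eq) auto
    then have "integrable (distr M borel (V 1)) (\<lambda>x. x)" by (simp add: S_law)
    then have "integrable (distr M borel (V j)) (\<lambda>x. x)" by (simp only: V_iid[of j] V_iid[of 1])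
    then show ?thesis by (subst (asm) integrable_distr_eq) auto
  qed
  have V_mean: "M.expectation (V j) = m" for j
  proof -
    have "M.expectation (V j) = (\<integral>x. x \<partial>distr M borel (V j))" by (subst integral_distr) auto
    also have "\<dots> = (\<integral>x. x \<partial>distr M borel (V 0))" by (simp only: V_iid[of j])
    also have "\<dots> = m" unfolding m_def by (subst integral_distr) auto
    finally show ?thesis .
  qed
  have S_mean: "(\<integral>\<omega>. S n \<omega> \<partial>N n) = real n * m" if "n \<ge> 1" for n
  proof -
    have "(\<integral>\<omega>. S n \<omega> \<partial>N n) = (\<integral>x. x \<partial>distr (N n) borel (S n))"
      using Si[OF that] by (subst integral_distr) auto
    also have "\<dots> = M.expectation (\<lambda>\<omega>. \<Sum>j=1..n. V j \<omega>)"
      unfolding S_law[OF that] by (subst integral_distr) auto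
    also have "\<dots> = real n * m" by (subst Bochner_Integration.integral_sum) (simp_all add: V_int V_mean)
    finally show ?thesis .
  qed
  have S_centered: "distr (N n) borel (\<lambda>\<omega>. S n \<omega> - real n * m) = \<nu> n" if "n \<ge> 1" for n
  proof -
    have "distr (N n) borel (\<lambda>\<omega>. S n \<omega> - real n * m) = distr (distr (N n) borel (S n)) borel (\<lambda>x. x - real n * m)"
      using Si[OF that] by (subst distr_distr) (auto simp: comp_def)
    also have "\<dots> = distr M borel (\<lambda>\<omega>. (\<Sum>j=1..n. V j \<omega>) - real n * m)"
      unfolding S_law[OF that] by (subst distr_distr) (auto simp: comp_def)
    also have "\<dots> = \<nu> n" unfolding \<nu>_def by (simp add: sum_subtractf)
    finally show ?thesis .
  qed
  have L: "real_distribution L" unfolding L_def by (rule M.real_distribution_distr) simp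
  have L_int: "integrable L (\<lambda>x. x)" and L_mean: "(\<integral>x. x \<partial>L) = 0"
    unfolding L_def using V_int[of 0] by (simp_all add: integrable_distr_eq integral_distr M.prob_space m_def)
  have \<nu>_char: "char (\<nu> n) t = char L t ^ n" for n t
    unfolding \<nu>_def L_def by (rule M.char_centered_iid_sum[OF V_indep V_iid])

  define \<phi>Y where "\<phi>Y n = char (distr (N n) borel (\<lambda>\<omega>. (Y n \<omega> - EY n) / q n))" for n
  define \<phi>W where "\<phi>W n = char (distr (N n) borel (\<lambda>\<omega>. (Y n \<omega> + S n \<omega> - EW n) / q n))" for n
  define \<phi>Z where "\<phi>Z n = char (distr (N n) borel (\<lambda>\<omega>. (Z n \<omega> - EZ n) / q n))" for n
  have W_mean: "(\<integral>\<omega>. Y n \<omega> + S n \<omega> \<partial>N n) = EW n" if "n \<ge> 1" for n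
    using Yi[OF that] Si[OF that] by (simp add: EW_def EY_def S_mean[OF that])
  have factor: "\<phi>W n t = \<phi>Y n t * char L (t / q n) ^ n" if "n \<ge> 1" for n t
  proof -
    interpret Nn: prob_space "N n" by (rule N[OF that])
    have [measurable]: "Y n \<in> borel_measurable (N n)" "S n \<in> borel_measurable (N n)"
      using Yi[OF that] Si[OF that] by auto
    have "Nn.indep_var borel (\<lambda>\<omega>. (Y n \<omega> - EY n) / q n) borel (\<lambda>\<omega>. (S n \<omega> - real n * m) / q n)"
      by (rule Nn.indep_var_compose[OF YS_indep[OF that], unfolded comp_def, where ?Y1.0="\<lambda>y. (y - EY n) / q n" and ?Y2.0="\<lambda>y. (y - real n * m) / q n"]) simp_all
    from Nn.char_distr_add[OF this, of t]
    have "\<phi>W n t = \<phi>Y n t * char (distr (N n) borel (\<lambda>\<omega>. (S n \<omega> - real n * m) / q n)) t"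
      unfolding \<phi>W_def \<phi>Y_def EW_def by (simp add: algebra_simps flip: add_divide_distrib diff_divide_distrib)
    also have "char (distr (N n) borel (\<lambda>\<omega>. (S n \<omega> - real n * m) / q n)) t = char (distr (N n) borel (\<lambda>\<omega>. S n \<omega> - real n * m)) (t / q n)"
      unfolding char_def by (simp add: integral_distr)
    also have "\<dots> = char L (t / q n) ^ n" unfolding S_centered[OF that] by (rule \<nu>_char)
    finally show ?thesis .
  qed
  have \<phi>Z: "(\<lambda>n. \<phi>Z n t) \<longlonglongrightarrow> of_real (exp (- \<sigma>\<^sup>2 * t\<^sup>2 / 2))" for t
  proof -
    have R: "real_distribution (distr (N (Suc n)) borel (\<lambda>\<omega>. (Z (Suc n) \<omega> - EZ (Suc n)) / q (Suc n)))" for n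
    proof -
      interpret prob_space "N (Suc n)" by (rule N) simp
      show ?thesis using Zi[of "Suc n"] by (intro real_distribution_distr) auto
    qed
    have Z_conv: "weak_conv_m (\<lambda>n. distr (N n) borel (\<lambda>\<omega>. (Z n \<omega> - EZ n) / q n)) (centered_normal (\<sigma>\<^sup>2))"
      unfolding q_def EZ_def by (rule Z_clt)
    have "weak_conv_m (\<lambda>n. distr (N (Suc n)) borel (\<lambda>\<omega>. (Z (Suc n) \<omega> - EZ (Suc n)) / q (Suc n))) (centered_normal (\<sigma>\<^sup>2))"
      by (rule iffD2[OF weak_conv_m_Suc Z_conv])
    from levy_continuity1[OF R real_distribution_centered_normal this, of t]
    have "(\<lambda>n. \<phi>Z (Suc n) t) \<longlonglongrightarrow> of_real (exp (- \<sigma>\<^sup>2 * t\<^sup>2 / 2))"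
      unfolding \<phi>Z_def by (simp add: char_centered_normal)
    then show ?thesis by (simp only: filterlim_sequentially_Suc[of "\<lambda>n. \<phi>Z n t"])
  qed
  have \<delta>0: "(\<lambda>n. \<delta> n / q n) \<longlonglongrightarrow> 0" using Z_approx by (simp only: \<delta>_def q_def)
  have \<phi>W: "(\<lambda>n. \<phi>W n t) \<longlonglongrightarrow> of_real (exp (- \<sigma>\<^sup>2 * t\<^sup>2 / 2))" for t
  proof -
    have "(\<lambda>n. \<phi>Z n t - \<phi>W n t) \<longlonglongrightarrow> 0"
    proof (rule Lim_null_comparison)
      have "(\<lambda>n. \<bar>t\<bar> * (2 * (\<delta> n / q n))) \<longlonglongrightarrow> \<bar>t\<bar> * (2 * 0)" by (intro tendsto_intros \<delta>0)
      then show "(\<lambda>n. \<bar>t\<bar> * (2 * (\<delta> n / q n))) \<longlonglongrightarrow> 0" by simp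
      have "norm (\<phi>Z n t - \<phi>W n t) \<le> \<bar>t\<bar> * (2 * (\<delta> n / q n))" if "n \<ge> 1" for n
      proof -
        interpret Nn: prob_space "N n" by (rule N[OF that])
        show ?thesis
          using Nn.char_standardized_diff_bound[OF Zi[OF that] Bochner_Integration.integrable_add[OF Yi[OF that] Si[OF that]] q[OF that], of t]
          unfolding \<phi>Z_def \<phi>W_def \<delta>_def W_mean[OF that] EZ_def .
      qed
      then show "\<forall>\<^sub>F n in sequentially. norm (\<phi>Z n t - \<phi>W n t) \<le> \<bar>t\<bar> * (2 * (\<delta> n / q n))"
        unfolding eventually_sequentially by blast
    qed
    from tendsto_diff[OF \<phi>Z[of t] this] show ?thesis by simp
  qed
  have \<phi>Y1: "cmod (\<phi>Y n t) \<le> 1" if "n \<ge> 1" for n t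
  proof -
    interpret Nn: prob_space "N n" by (rule N[OF that])
    have "real_distribution (distr (N n) borel (\<lambda>\<omega>. (Y n \<omega> - EY n) / q n))"
      using Yi[OF that] by (intro Nn.real_distribution_distr) auto
    then show ?thesis unfolding \<phi>Y_def by (rule real_distribution.cmod_char_le_1)
  qed
  have W_le: "cmod (\<phi>W n t) \<le> cmod (char L (t / q n) ^ n)" if "n \<ge> 1" for n t
    unfolding factor[OF that] norm_mult using \<phi>Y1[OF that, of t] by (simp add: mult_le_cancel_right2)

  \<comment> \<open>The limit of \<phi>W at 1 is positive; half of it serves as a lower bound for large n.\<close>
  have L_sq: "integrable L (\<lambda>x. x\<^sup>2)"
  proof (rule square_integrable_of_char_power[OF L])
    let ?d = "exp (- \<sigma>\<^sup>2 / 2)"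
    show "?d / 2 > 0" by simp
    have "(\<lambda>n. cmod (\<phi>W n 1)) \<longlonglongrightarrow> ?d" using tendsto_norm[OF \<phi>W[of 1]] by simp
    from order_tendstoD(1)[OF this, of "?d / 2"]
    have "\<forall>\<^sub>F n in sequentially. ?d / 2 < cmod (\<phi>W n 1)" by simp
    then show "\<forall>\<^sub>F n in sequentially. ?d / 2 \<le> cmod (char L (1 / sqrt (real n))) ^ n"
      using eventually_ge_at_top[of 1]
    proof eventually_elim
      case (elim n)
      have "cmod (\<phi>W n 1) \<le> cmod (char L (1 / q n)) ^ n" using W_le[OF elim(2), of 1] by (simp only: norm_power)
      with elim(1) show ?case unfolding q_def by linarith
    qed
  qed
  define s where "s = sqrt (\<integral>x. x\<^sup>2 \<partial>L)"
  have s0: "s \<ge> 0" by (simp add: s_def)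
  have s2: "(\<integral>x. x\<^sup>2 \<partial>L) = s\<^sup>2" by (simp add: s_def)
  have \<phi>S: "(\<lambda>n. char L (t / q n) ^ n) \<longlonglongrightarrow> of_real (exp (- s\<^sup>2 * t\<^sup>2 / 2))" for t
    unfolding q_def by (rule char_power_tendsto_gaussian[OF L L_int L_sq L_mean s2])
  have s\<sigma>: "s\<^sup>2 \<le> \<sigma>\<^sup>2"
  proof -
    have "cmod (of_real (exp (- \<sigma>\<^sup>2 * 1\<^sup>2 / 2))) \<le> cmod (of_real (exp (- s\<^sup>2 * 1\<^sup>2 / 2)))"
    proof (rule tendsto_le[OF sequentially_bot tendsto_norm[OF \<phi>S] tendsto_norm[OF \<phi>W]])
      show "\<forall>\<^sub>F n in sequentially. cmod (\<phi>W n 1) \<le> cmod (char L (1 / q n) ^ n)"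
        unfolding eventually_sequentially using W_le by blast
    qed
    then show ?thesis by simp
  qed
  have V_sq: "integrable M (\<lambda>\<omega>. (V 0 \<omega>)\<^sup>2)"
  proof -
    have "integrable M (\<lambda>\<omega>. (V 0 \<omega> - m)\<^sup>2)" using L_sq unfolding L_def by (subst (asm) integrable_distr_eq) auto
    then have "integrable M (\<lambda>\<omega>. (V 0 \<omega> - m)\<^sup>2 + 2 * m * V 0 \<omega> - m\<^sup>2)" using V_int by simp
    then show ?thesis by (simp add: power2_diff algebra_simps)
  qed
  have V_var: "M.variance (V 0) = s\<^sup>2"
    unfolding s2[symmetric] L_def m_def by (subst integral_distr) auto

  \<comment> \<open>The Gaussian limit of the powers has no zeros, so that the factor belonging to S can be divided out.\<close>
  have \<phi>Y: "(\<lambda>n. \<phi>Y n t) \<longlonglongrightarrow> of_real (exp (- (\<sigma>\<^sup>2 - s\<^sup>2) * t\<^sup>2 / 2))" for t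
  proof -
    have "(\<lambda>n. \<phi>W n t / char L (t / q n) ^ n) \<longlonglongrightarrow> of_real (exp (- \<sigma>\<^sup>2 * t\<^sup>2 / 2)) / of_real (exp (- s\<^sup>2 * t\<^sup>2 / 2))"
      by (intro tendsto_divide \<phi>W \<phi>S) simp
    also have "complex_of_real (exp (- \<sigma>\<^sup>2 * t\<^sup>2 / 2)) / of_real (exp (- s\<^sup>2 * t\<^sup>2 / 2)) = of_real (exp (- (\<sigma>\<^sup>2 - s\<^sup>2) * t\<^sup>2 / 2))"
      unfolding of_real_divide[symmetric] exp_diff[symmetric] by (simp add: algebra_simps diff_divide_distrib)
    finally have lim: "(\<lambda>n. \<phi>W n t / char L (t / q n) ^ n) \<longlonglongrightarrow> of_real (exp (- (\<sigma>\<^sup>2 - s\<^sup>2) * t\<^sup>2 / 2))" .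
    have "\<forall>\<^sub>F n in sequentially. char L (t / q n) ^ n \<noteq> 0"
      by (rule tendsto_imp_eventually_ne[OF \<phi>S]) simp
    then have "\<forall>\<^sub>F n in sequentially. \<phi>W n t / char L (t / q n) ^ n = \<phi>Y n t"
      using eventually_ge_at_top[of 1] by eventually_elim (simp add: factor)
    with lim show ?thesis by (rule Lim_transform_eventually)
  qed
  have Y_conv: "weak_conv_m (\<lambda>n. distr (N n) borel (\<lambda>\<omega>. (Y n \<omega> - EY n) / q n)) (centered_normal (\<sigma>\<^sup>2 - s\<^sup>2))"
  proof -
    have "weak_conv_m (\<lambda>n. distr (N (Suc n)) borel (\<lambda>\<omega>. (Y (Suc n) \<omega> - EY (Suc n)) / q (Suc n))) (centered_normal (\<sigma>\<^sup>2 - s\<^sup>2))"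
    proof (rule levy_continuity)
      show "real_distribution (distr (N (Suc n)) borel (\<lambda>\<omega>. (Y (Suc n) \<omega> - EY (Suc n)) / q (Suc n)))" for n
      proof -
        interpret prob_space "N (Suc n)" by (rule N) simp
        show ?thesis using Yi[of "Suc n"] by (intro real_distribution_distr) auto
      qed
      show "real_distribution (centered_normal (\<sigma>\<^sup>2 - s\<^sup>2))" using s\<sigma> by (intro real_distribution_centered_normal) simp
      show "(\<lambda>n. char (distr (N (Suc n)) borel (\<lambda>\<omega>. (Y (Suc n) \<omega> - EY (Suc n)) / q (Suc n))) t) \<longlonglongrightarrow> char (centered_normal (\<sigma>\<^sup>2 - s\<^sup>2)) t" for t
        using LIMSEQ_Suc[OF \<phi>Y[of t]] s\<sigma> unfolding \<phi>Y_def by (simp add: char_centered_normal)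
    qed
    then show ?thesis
      by (rule iffD1[OF weak_conv_m_Suc[of "\<lambda>n. distr (N n) borel (\<lambda>\<omega>. (Y n \<omega> - EY n) / q n)"]])
  qed

  have local: "(\<lambda>n. SUP u. \<bar>c n * \<P>(\<omega> in N n. Z n \<omega> \<in> {u..<u + b})
      - inverse \<sigma> * b * std_normal_density ((u - EZ n) / (c n * \<sigma>))\<bar>) \<longlonglongrightarrow> 0"
    if b: "b > 0" and c: "\<forall>n\<ge>1. c n > 0" and span: "span_dvd (rv_span M (V 0)) b"
      and cq: "(\<lambda>n. c n / sqrt (real n)) \<longlonglongrightarrow> 1" for b :: real and c :: "nat \<Rightarrow> real"
  proof -
    have nd: "\<not> degenerate_rv M (V 0)" using span by (auto simp: span_dvd_def rv_span_def)
    then have "s\<^sup>2 \<noteq> 0" using V_sq by (simp add: degenerate_rv_def V_var)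
    then have s: "s > 0" using s0 by (simp add: less_le)
    have "\<sigma>\<^sup>2 > 0" using s s\<sigma> by (meson less_le_trans zero_less_power)
    then have \<sigma>: "\<sigma> > 0" using \<open>\<sigma> \<ge> 0\<close> by (simp add: less_le)
    have llt: "uniform_limit UNIV (\<lambda>n u. q n * measure (\<nu> n) {u..<u + b} - b * normal_density 0 s (u / q n)) (\<lambda>_. 0) sequentially"
      unfolding q_def \<nu>_def m_def
      by (rule M.local_limit_iid_sum[OF V_indep V_iid V_int _ _ s b span]) (use L_sq s2 in \<open>simp_all only: L_def m_def\<close>)
    \<comment> \<open>At n = 0 nothing is known about N and Y, so an arbitrary law is put there.\<close>
    define K where "K n = (if n = 0 then return borel 0 else distr (N n) borel (\<lambda>\<omega>. (Y n \<omega> - EY n) / q n))" for n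
    have K: "real_distribution (K n)" for n
    proof (cases "n = 0")
      case False
      then interpret prob_space "N n" by (intro N) simp
      show ?thesis using False Yi[of n] by (auto simp: K_def intro!: real_distribution_distr)
    qed (simp add: K_def real_distribution_def real_distribution_axioms_def prob_space_return)
    have "(\<lambda>n. char (K n) t) \<longlonglongrightarrow> of_real (exp (- (\<sigma>\<^sup>2 - s\<^sup>2) * t\<^sup>2 / 2))" for t
    proof (rule Lim_transform_eventually[OF \<phi>Y])
      show "\<forall>\<^sub>F n in sequentially. \<phi>Y n t = char (K n) t"
        using eventually_ge_at_top[of 1] by eventually_elim (simp add: K_def \<phi>Y_def)
    qed
    from gaussian_smoothing_uniform[OF K _ s this]
    have smooth: "uniform_limit UNIV (\<lambda>n x. \<integral>y. normal_density 0 s (x - y) \<partial>K n) (normal_density 0 \<sigma>) sequentially"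
      using s\<sigma> \<sigma> by simp
    define r where "r n = c n / q n" for n
    have r: "r \<longlonglongrightarrow> 1" using cq by (simp add: r_def[abs_def] q_def)
    have r': "(\<lambda>n. q n / c n) \<longlonglongrightarrow> 1" using tendsto_inverse[OF r] by (simp add: r_def)
    define p where "p n = \<P>(\<omega> in N n. Z n \<omega> \<noteq> Y n \<omega> + S n \<omega>)" for n
    have p: "(\<lambda>n. q n * p n) \<longlonglongrightarrow> 0" using Z_neq by (simp only: p_def q_def)
    define R where "R n = 2 * (q n * p n) + b / \<sigma> * \<bar>r n - 1\<bar> + b / \<sigma> * (2 * \<bar>q n / c n - 1\<bar> + \<delta> n / q n / \<sigma>)" for n
    have "R \<longlonglongrightarrow> 2 * 0 + b / \<sigma> * \<bar>1 - 1\<bar> + b / \<sigma> * (2 * \<bar>1 - 1\<bar> + 0 / \<sigma>)"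
      unfolding R_def[abs_def] using \<sigma> by (intro tendsto_intros p r r' \<delta>0) simp
    then have R0: "R \<longlonglongrightarrow> 0" by simp
    show ?thesis
    proof (rule tendsto_SUP_abs_zeroI)
      fix e :: real assume e: "e > 0"
      define e1 where "e1 = e / 8"
      define e2 where "e2 = e / (8 * b)"
      have e12: "e1 > 0" "e2 > 0" "2 * (e1 + b * e2) = e / 2" using e b by (simp_all add: e1_def e2_def)
      have ev1: "\<forall>\<^sub>F n in sequentially. \<forall>v\<in>UNIV. dist (q n * measure (\<nu> n) {v..<v + b} - b * normal_density 0 s (v / q n)) 0 < e1"
        using llt e12(1) unfolding uniform_limit_iff by blast
      have ev2: "\<forall>\<^sub>F n in sequentially. \<forall>x\<in>UNIV. dist (\<integral>y. normal_density 0 s (x - y) \<partial>K n) (normal_density 0 \<sigma> x) < e2"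
        using smooth e12(2) unfolding uniform_limit_iff by blast
      have ev3: "\<forall>\<^sub>F n in sequentially. R n < e / 2" using order_tendstoD(2)[OF R0, of "e / 2"] e by simp
      have ev4: "\<forall>\<^sub>F n in sequentially. r n < 2" using order_tendstoD(2)[OF r, of 2] by simp
      show "\<forall>\<^sub>F n in sequentially. \<forall>u. \<bar>c n * \<P>(\<omega> in N n. Z n \<omega> \<in> {u..<u + b})
          - inverse \<sigma> * b * std_normal_density ((u - EZ n) / (c n * \<sigma>))\<bar> \<le> e"
        using ev1 ev2 ev3 ev4 eventually_ge_at_top[of 1]
      proof eventually_elim
        case (elim n)
        interpret Nn: prob_space "N n" by (rule N[OF elim(5)])
        have [measurable]: "Y n \<in> borel_measurable (N n)" "S n \<in> borel_measurable (N n)" "Z n \<in> borel_measurable (N n)"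
          using Yi[OF elim(5)] Si[OF elim(5)] Zi[OF elim(5)] by auto
        have qn: "q n > 0" by (rule q[OF elim(5)])
        show ?case
        proof
          fix u
          let ?z = "\<P>(\<omega> in N n. Z n \<omega> \<in> {u..<u + b})" and ?w = "\<P>(\<omega> in N n. Y n \<omega> + S n \<omega> \<in> {u..<u + b})"
          have zw: "\<bar>?z - ?w\<bar> \<le> p n"
          proof -
            have "?z \<le> ?w + p n" "?w \<le> ?z + p n"
              unfolding p_def by (rule order_trans[OF Nn.finite_measure_mono measure_Un_le]; auto)+
            then show ?thesis by linarith
          qed
          have means: "\<bar>EZ n - EW n\<bar> \<le> \<delta> n"
          proof -
            have "EZ n - EW n = (\<integral>\<omega>. Z n \<omega> - (Y n \<omega> + S n \<omega>) \<partial>N n)"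
              unfolding EZ_def W_mean[OF elim(5), symmetric] using Yi[OF elim(5)] Si[OF elim(5)] Zi[OF elim(5)] by simp
            then show ?thesis unfolding \<delta>_def by (simp only: integral_abs_bound)
          qed
          have "\<bar>q n * ?w - b * (\<integral>y. normal_density 0 s ((u - (EY n + real n * m)) / q n - y) \<partial>distr (N n) borel (\<lambda>\<omega>. (Y n \<omega> - EY n) / q n))\<bar> \<le> e1"
          proof (rule Nn.interval_prob_indep_sum[OF YS_indep[OF elim(5)] qn s])
            fix v
            have "measure (distr (N n) borel (S n)) {v..<v + b} = measure (\<nu> n) {v - real n * m..<v - real n * m + b}"
              unfolding S_centered[OF elim(5), symmetric]
              by (subst (1 2) measure_distr) (auto intro!: arg_cong[where f="measure (N n)"])
            then show "\<bar>q n * measure (distr (N n) borel (S n)) {v..<v + b} - b * normal_density 0 s ((v - real n * m) / q n)\<bar> \<le> e1"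
              using elim(1)[rule_format, of "v - real n * m"] by (simp add: dist_real_def)
          qed
          moreover have "K n = distr (N n) borel (\<lambda>\<omega>. (Y n \<omega> - EY n) / q n)" using elim(5) by (simp add: K_def)
          ultimately have 1: "\<bar>q n * ?w - b * (\<integral>y. normal_density 0 s ((u - EW n) / q n - y) \<partial>K n)\<bar> \<le> e1"
            by (simp only: EW_def)
          have "\<bar>(\<integral>y. normal_density 0 s ((u - EW n) / q n - y) \<partial>K n) - normal_density 0 \<sigma> ((u - EW n) / q n)\<bar> \<le> e2"
            using elim(2)[rule_format, of "(u - EW n) / q n"] by (simp add: dist_real_def)
          then have "b * \<bar>(\<integral>y. normal_density 0 s ((u - EW n) / q n - y) \<partial>K n) - normal_density 0 \<sigma> ((u - EW n) / q n)\<bar> \<le> b * e2"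
            using b by (intro mult_left_mono) auto
          then have "\<bar>b * (\<integral>y. normal_density 0 s ((u - EW n) / q n - y) \<partial>K n) - b * normal_density 0 \<sigma> ((u - EW n) / q n)\<bar> \<le> b * e2"
            using b by (simp add: abs_mult flip: right_diff_distrib)
          with 1 have w: "\<bar>q n * ?w - b * normal_density 0 \<sigma> ((u - EW n) / q n)\<bar> \<le> e1 + b * e2" by linarith
          have "c n / q n \<le> 2" using elim(4) by (simp add: r_def)
          from local_limit_perturbation[OF \<sigma> b qn c[rule_format, OF elim(5)] this zw means w]
          have "\<bar>c n * ?z - inverse \<sigma> * b * std_normal_density ((u - EZ n) / (c n * \<sigma>))\<bar> \<le> R n + 2 * (e1 + b * e2)"
            by (simp add: R_def r_def algebra_simps)
          then show "\<bar>c n * ?z - inverse \<sigma> * b * std_normal_density ((u - EZ n) / (c n * \<sigma>))\<bar> \<le> e"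
            using elim(3) e12(3) by linarith
        qed
      qed
    qed
  qed
  show ?thesis
    using V_sq s\<sigma> local Y_conv unfolding V_var EZ_def EY_def q_def by blast
qed

end
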